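(* Let $(M,\mathscr{L})$ be a pseudo-Finsler space modeled on a pseudo-Minkowski space $(V,L)$, with local vierbein $e^a_\mu(x)$ and commutation coefficients $c^a{}_{bc}(x)$. Then the Landsberg tensor, in vierbein components, is \begin{align*} L_{abc}&=L_{\alpha\beta\gamma}e^\alpha_ae^\beta_be^\gamma_c=-\tfrac12\,y_rG^r_{abc}=-\tfrac14\,c^e{}_{mn}\,y_r\,\frac{\partial^3}{\partial y^a\partial y^b\partial y^c}\big(g^{rm}y_ey^n\big)\\ &=-\tfrac12\,c^e{}_{mn}\Big(y^mC_{ebc}\delta^n_a+y^mC_{eca}\delta^n_b+y^mC_{eab}\delta^n_c+C^m_{bc}g_{ea}y^n+C^m_{ca}g_{eb}y^n+C^m_{ab}g_{ec}y^n\\ &\qquad+C^m_{bc}y_e\delta^n_a+C^m_{ca}y_e\delta^n_b+C^m_{ab}y_e\delta^n_c+2\big(C^m_{abc}-C^m_{sa}C^s_{bc}-C^m_{sc}C^s_{ab}-C^m_{sb}C^s_{ca}\big)y_ey^n\Big)\\ &=k_{mne}\,y^e\big(C^m_{bc}\delta^n_a+C^m_{ca}\delta^n_b+C^m_{ab}\delta^n_c\big)+k_{mne}\,y^ny^e\big(C^m_{abc}-C^s_{bc}C^m_{as}-C^s_{ca}C^m_{bs}-C^s_{ab}C^m_{cs}\big)\\ &=k_{mne}\,y^e\Big[C^{[m}_{bc}h^{n]}_a+C^{[m}_{ca}h^{n]}_b+C^{[m}_{ab}h^{n]}_c+y^{[n}h^{m]s}\,h^p_ah^q_bh^r_c\,\nabla^{VC}_sC_{pqr}\Big].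 \end{align*}
   Context: Einstein's summation convention is used. A pseudo-Minkowski space is a pair $(V,L)$ where $V$ is a finite-dimensional real vector space and $L\colon\bar\omega\to\mathbb{R}$ is defined on the closure of an open cone $\omega\subset V$ with vertex the origin, with $L\in C^4(\omega)\cap C^0(\bar\omega)$, $L(sy)=s^2L(y)$ for $s>0$, and non-degenerate Hessian on $\omega$. A pseudo-Finsler space is a pair $(M,\mathscr{L})$, $\dim M=\dim V$, $\mathscr{L}\colon\bar\Omega\to\mathbb{R}$, $\Omega\subset TM$ projecting onto $M$, such that each $(T_xM,\mathscr{L}_x)$, with $\mathscr{L}_x$ the restriction of $\mathscr{L}$ to the fibre (cone $\Omega_x=\Omega\cap T_xM$), is a pseudo-Minkowski space with signature independent of $x$; the dependence of $\mathscr{L}$ on $x$ is $C^2$. It is modeled on $(V,L)$ if locally, for $x\in U\subset M$, there are linear isomorphisms $\varphi_x\colon T_xM\to V$, sufficiently differentiable in $x$, with $\varphi_x(\Omega_x)=\omega$ and $L(\varphi_x(y))=\mathscr{L}_x(y)$ for every $y\in\bar\Omega_x$. Fix a basis $\{\tilde e_a\}$ of $V$ and put $e_a=\varphi_x^{-1}(\tilde e_a)=e^\mu_a\partial_\mu$, with dual basis $e^a=e^a_\mu dx^\mu$ (the vierbein), in local coordinates $x^\mu$ of $M$. A tangent vector is $y=y^\mu\partial_\mu=y^ae_a$, $y^\mu=y^ae^\mu_a$; regarding $L$ as a function of $(y^a)$, $\mathscr{L}(x^\mu,y^\nu)=L(e^a_\nu(x)y^\nu)$. The commutation coefficients are defined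 by $[e_a,e_b]=c^c{}_{ab}e_c$. With $\partial_a=\partial/\partial y^a$: $y_a=\partial_aL$, $g_{ab}=\partial_a\partial_bL$, $g^{ab}$ the inverse of $g_{ab}$, $C_{abc}=\frac12\partial_a\partial_b\partial_cL$, $C_{abcd}=\partial_aC_{bcd}$; indices of these (totally symmetric) objects are raised with $g^{ab}$ after differentiation: $C^m_{bc}=g^{ma}C_{abc}$, $C^m_{abc}=g^{md}C_{dabc}$. The upper index of $c$ is lowered to the left: $c_{abc}=g_{ad}c^d{}_{bc}$, and $k_{mne}=\frac12(c_{mne}+c_{nem}-c_{emn})$, antisymmetric in its first two indices. Square brackets on indices denote antisymmetrization with factor $\frac12$. Moreover $h^a_b:=\delta^a_b-\frac1{g_y(y,y)}y^ay_b$, where $g_y(y,y):=2L$, is the projection on the space tangent to the indicatrix, $h^{ab}=g^{bc}h^a_c$, and $\nabla^{VC}$ is the vertical Cartan derivative, with connection coefficients $C^c_{ab}$ in the coordinates $y^a$: $\nabla^{VC}_sC_{pqr}=\partial_sC_{pqr}-C^v_{sp}C_{vqr}-C^v_{sq}C_{pvr}-C^v_{sr}C_{pqv}$. With $g_{\mu\nu}=\partial^2\mathscr{L}/\partial y^\mu\partial y^\nu$ and inverse $g^{\mu\nu}$, the spray is $G^\mu:=\frac12g^{\mu\sigma}\big(\frac{\partial^2\mathscr{L}}{\partial x^\rho\partial y^\sigma}y^\rho-\frac{\partial\mathscr{L}}{\partial x^\sigma}\big)$; the Berwald curvature is $G^\rho_{\alpha\beta\gamma}:=\frac{\partial^3G^\rho}{\partial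 y^\alpha\partial y^\beta\partial y^\gamma}$, with vierbein components $G^r_{abc}:=G^\rho_{\alpha\beta\gamma}e^r_\rho e^\alpha_ae^\beta_be^\gamma_c$. The Landsberg tensor is the tensor with vierbein components $L_{abc}=-\frac12y_rG^r_{abc}$ (not to be confused with the function $L$), and $L_{\alpha\beta\gamma}$ are its coordinate components.
   Formalization: As L is only C^4, the third y-derivatives of the spray and of g^{rm}y_e y^n may not exist; equalities involving them are stated at vectors where the spray (for L_abc = second line) or all g^{rm}y_e y^n (for the third-derivative formula) are three times differentiable, e.g. if L is C^5. *)

theory Defs
  imports "HOL-Analysis.Analysis"
begin

section \<open>Differentiability and partial derivatives\<close>

text \<open>Intended for open \<open>S\<close>: all derivatives up to order \<open>k\<close> exist on \<open>S\<close> and are continuous.\<close>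

primrec Ck_on :: "nat \<Rightarrow> ('a::real_normed_vector \<Rightarrow> 'b::real_normed_vector) \<Rightarrow> 'a set \<Rightarrow> bool" where
  "Ck_on 0 f S \<longleftrightarrow> continuous_on S f"
| "Ck_on (Suc k) f S \<longleftrightarrow>
     f differentiable_on S \<and> (\<forall>v. Ck_on k (\<lambda>x. frechet_derivative f (at x) v) S)"

definition pd :: "'n::finite \<Rightarrow> (real^'n \<Rightarrow> real) \<Rightarrow> real^'n \<Rightarrow> real" where
  "pd i f x = frechet_derivative f (at x) (axis i 1)"

text \<open>For \<open>f\<close> of class C2 near \<open>y\<close> this says that \<open>f\<close> is three times differentiable at \<open>y\<close>.
  It is needed because \<open>L\<close> is only C4: the entries of the inverse metric and the spray are then
  only C2 in \<open>y\<close>, so that the third derivatives in the Berwald curvature may fail to exist.\<close>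

definition has_third_derivatives :: "(real^'n::finite \<Rightarrow> real) \<Rightarrow> real^'n \<Rightarrow> bool" where
  "has_third_derivatives f y \<longleftrightarrow> (\<forall>i j. pd i (pd j f) differentiable (at y))"

definition kron :: "'n \<Rightarrow> 'n \<Rightarrow> real" where
  "kron i j = (if i = j then 1 else 0)"

section \<open>Pseudo-Minkowski spaces\<close>

definition hessian :: "('v::euclidean_space \<Rightarrow> real) \<Rightarrow> 'v \<Rightarrow> 'v \<Rightarrow> 'v \<Rightarrow> real" where
  "hessian L y u v = frechet_derivative (\<lambda>z. frechet_derivative L (at z) v) (at y) u"

definition pos_index :: "('v::euclidean_space \<Rightarrow> 'v \<Rightarrow> real) \<Rightarrow> nat" where
  "pos_index B = Max {dim S |S. subspace S \<and> (\<forall>v\<in>S. v \<noteq> 0 \<longrightarrow> 0 < B v v)}"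

definition signature :: "('v::euclidean_space \<Rightarrow> 'v \<Rightarrow> real) \<Rightarrow> nat \<times> nat" where
  "signature B = (pos_index B, pos_index (\<lambda>u v. - B u v))"

text \<open>The function \<open>L\<close> is only meaningful on \<open>closure \<omega>\<close>.\<close>

definition pseudo_minkowski :: "'v::euclidean_space set \<Rightarrow> ('v \<Rightarrow> real) \<Rightarrow> bool" where
  "pseudo_minkowski \<omega> L \<longleftrightarrow>
     open \<omega> \<and> (\<forall>y\<in>\<omega>. \<forall>s>0. s *\<^sub>R y \<in> \<omega>) \<and>
     Ck_on 4 L \<omega> \<and> continuous_on (closure \<omega>) L \<and>
     (\<forall>y\<in>closure \<omega>. \<forall>s>0. L (s *\<^sub>R y) = s\<^sup>2 * L y) \<and>
     (\<forall>y\<in>\<omega>. \<forall>u. (\<forall>v. hessian L y u v = 0) \<longrightarrow> u = 0)"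

section \<open>Manifolds and tangent vectors\<close>

type_synonym ('m, 'n) chart = "'m set \<times> ('m \<Rightarrow> real^'n)"

definition chart_inv :: "('m, 'n::finite) chart \<Rightarrow> real^'n \<Rightarrow> 'm" where
  "chart_inv c = inv_into (fst c) (snd c)"

definition transition :: "('m, 'n::finite) chart \<Rightarrow> ('m, 'n) chart \<Rightarrow> real^'n \<Rightarrow> real^'n" where
  "transition c c' = snd c' \<circ> chart_inv c"

text \<open>C3 is the least regularity for which "\<open>\<L>\<close> is C2 in \<open>x\<close>" does not depend on the chart;
  every smooth atlas qualifies.\<close>

definition C3_manifold :: "'m topology \<Rightarrow> ('m, 'n::finite) chart set \<Rightarrow> bool" where
  "C3_manifold X A \<longleftrightarrow>
     Hausdorff_space X \<and> second_countable X \<and> \<Union>(fst ` A) = topspace X \<and>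
     (\<forall>c\<in>A. openin X (fst c) \<and> open (snd c ` fst c) \<and>
        homeomorphic_map (subtopology X (fst c)) (top_of_set (snd c ` fst c)) (snd c)) \<and>
     (\<forall>c\<in>A. \<forall>c'\<in>A. Ck_on 3 (transition c c') (snd c ` (fst c \<inter> fst c')))"

text \<open>A tangent vector at \<open>p\<close> is the family of its components in all charts around \<open>p\<close>, related by
  the Jacobians of the transition maps; the value at any other chart is \<open>0\<close>.\<close>

type_synonym ('m, 'n) tvec = "('m, 'n) chart \<Rightarrow> real^'n"

definition tangent_space :: "('m, 'n::finite) chart set \<Rightarrow> 'm \<Rightarrow> ('m, 'n) tvec set" where
  "tangent_space A p = {v.
     (\<forall>c\<in>A. \<forall>c'\<in>A. p \<in> fst c \<inter> fst c' \<longrightarrow>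
        v c' = frechet_derivative (transition c c') (at (snd c p)) (v c)) \<and>
     (\<forall>c. \<not> (c \<in> A \<and> p \<in> fst c) \<longrightarrow> v c = 0)}"

definition tvec_of :: "('m, 'n::finite) chart set \<Rightarrow> ('m, 'n) chart \<Rightarrow> 'm \<Rightarrow> real^'n \<Rightarrow> ('m, 'n) tvec" where
  "tvec_of A c p y = (\<lambda>c'. if c' \<in> A \<and> p \<in> fst c'
     then frechet_derivative (transition c c') (at (snd c p)) y else 0)"

section \<open>Pseudo-Finsler spaces modeled on a pseudo-Minkowski space\<close>

text \<open>The Finsler function in the coordinates of the chart \<open>c\<close>, as a function of \<open>x\<^sup>\<mu>\<close> and \<open>y\<^sup>\<mu>\<close>.\<close>

definition coord_fun ::
  "('m, 'n::finite) chart set \<Rightarrow> ('m, 'n) chart \<Rightarrow> ('m \<Rightarrow> ('m, 'n) tvec \<Rightarrow> real) \<Rightarrow> real^'n \<Rightarrow> real^'n \<Rightarrow> real"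
where
  "coord_fun A c \<L> x y = \<L> (chart_inv c x) (tvec_of A c (chart_inv c x) y)"

text \<open>The set \<open>\<Omega> p\<close> is the cone in the tangent space at \<open>p\<close>. As a cone need not be connected,
  independence of the signature from \<open>p\<close> is expressed for the set of values it takes on the cone.\<close>

definition pseudo_finsler :: "'m topology \<Rightarrow> ('m, 'n::finite) chart set \<Rightarrow>
    ('m \<Rightarrow> ('m, 'n) tvec set) \<Rightarrow> ('m \<Rightarrow> ('m, 'n) tvec \<Rightarrow> real) \<Rightarrow> bool" where
  "pseudo_finsler X A \<Omega> \<L> \<longleftrightarrow>
     C3_manifold X A \<and>
     (\<forall>p\<in>topspace X. \<Omega> p \<subseteq> tangent_space A p \<and> \<Omega> p \<noteq> {}) \<and>
     (\<forall>c\<in>A. \<forall>p\<in>fst c. pseudo_minkowski ((\<lambda>v. v c) ` \<Omega> p) (coord_fun A c \<L> (snd c p))) \<and>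
     (\<forall>c\<in>A. \<forall>c'\<in>A. \<forall>p\<in>fst c. \<forall>p'\<in>fst c'.
        {signature (hessian (coord_fun A c \<L> (snd c p)) (v c)) |v. v \<in> \<Omega> p} =
        {signature (hessian (coord_fun A c' \<L> (snd c' p')) (v c')) |v. v \<in> \<Omega> p'}) \<and>
     (\<forall>c\<in>A. \<forall>y S. open S \<and> S \<subseteq> snd c ` fst c \<and>
        (\<forall>x\<in>S. y \<in> (\<lambda>v. v c) ` \<Omega> (chart_inv c x)) \<longrightarrow>
        Ck_on 2 (\<lambda>x. coord_fun A c \<L> x y) S)"

text \<open>Here \<open>closure (\<Omega> p)\<close> is taken in the product topology on families of components, which
  induces the usual vector space topology on the (closed) tangent space. C1 is the regularity in
  \<open>x\<close> that is needed for the commutation coefficients and the spray to be defined.\<close>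

definition local_model :: "'m topology \<Rightarrow> ('m, 'n::finite) chart set \<Rightarrow>
    ('m \<Rightarrow> ('m, 'n) tvec set) \<Rightarrow> ('m \<Rightarrow> ('m, 'n) tvec \<Rightarrow> real) \<Rightarrow>
    'v::euclidean_space set \<Rightarrow> ('v \<Rightarrow> real) \<Rightarrow> 'm set \<Rightarrow> ('m \<Rightarrow> ('m, 'n) tvec \<Rightarrow> 'v) \<Rightarrow> bool" where
  "local_model X A \<Omega> \<L> \<omega> L U \<phi> \<longleftrightarrow>
     openin X U \<and>
     (\<forall>p\<in>U.
        (\<forall>u\<in>tangent_space A p. \<forall>v\<in>tangent_space A p. \<forall>r s.
           \<phi> p (\<lambda>c. r *\<^sub>R u c + s *\<^sub>R v c) = r *\<^sub>R \<phi> p u + s *\<^sub>R \<phi> p v) \<and>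
        bij_betw (\<phi> p) (tangent_space A p) UNIV \<and>
        \<phi> p ` \<Omega> p = \<omega> \<and>
        (\<forall>v\<in>closure (\<Omega> p). L (\<phi> p v) = \<L> p v)) \<and>
     (\<forall>c\<in>A. \<forall>y. Ck_on 1 (\<lambda>x. \<phi> (chart_inv c x) (tvec_of A c (chart_inv c x) y)) (snd c ` (fst c \<inter> U)))"

definition modeled_on :: "'m topology \<Rightarrow> ('m, 'n::finite) chart set \<Rightarrow>
    ('m \<Rightarrow> ('m, 'n) tvec set) \<Rightarrow> ('m \<Rightarrow> ('m, 'n) tvec \<Rightarrow> real) \<Rightarrow>
    'v::euclidean_space set \<Rightarrow> ('v \<Rightarrow> real) \<Rightarrow> bool" where
  "modeled_on X A \<Omega> \<L> \<omega> L \<longleftrightarrow>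
     (\<forall>p\<in>topspace X. \<exists>U \<phi>. p \<in> U \<and> local_model X A \<Omega> \<L> \<omega> L U \<phi>)"

section \<open>Vierbein and commutation coefficients\<close>

definition vector_basis :: "('n::finite \<Rightarrow> 'v::euclidean_space) \<Rightarrow> bool" where
  "vector_basis bas \<longleftrightarrow> inj bas \<and> independent (range bas) \<and> span (range bas) = UNIV"

text \<open>The entry in row \<open>\<mu>\<close>, column \<open>a\<close> is \<open>e\<^sup>\<mu>\<^sub>a\<close> at the coordinates \<open>x\<close>; the dual basis
  is given by the inverse matrix, with row index \<open>a\<close> and column index \<open>\<mu>\<close>.\<close>

definition vierbein :: "('m, 'n::finite) chart set \<Rightarrow> ('m \<Rightarrow> ('m, 'n) tvec \<Rightarrow> 'v::euclidean_space) \<Rightarrow>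
    ('n \<Rightarrow> 'v) \<Rightarrow> ('m, 'n) chart \<Rightarrow> real^'n \<Rightarrow> real^'n^'n" where
  "vierbein A \<phi> bas c x = (\<chi> \<mu> a.
     inv_into (tangent_space A (chart_inv c x)) (\<phi> (chart_inv c x)) (bas a) c $ \<mu>)"

definition lie_bracket :: "(real^'n::finite \<Rightarrow> real^'n) \<Rightarrow> (real^'n \<Rightarrow> real^'n) \<Rightarrow> real^'n \<Rightarrow> real^'n" where
  "lie_bracket V W x = frechet_derivative W (at x) (V x) - frechet_derivative V (at x) (W x)"

text \<open>For a matrix-valued \<open>e\<close> as above, \<open>commutation e x c a b\<close> is \<open>c\<^sup>c\<^sub>a\<^sub>b\<close> at \<open>x\<close>: the \<open>e\<^sub>c\<close>
  component of the bracket of \<open>e\<^sub>a\<close> and \<open>e\<^sub>b\<close>.\<close>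

definition commutation :: "(real^'n::finite \<Rightarrow> real^'n^'n) \<Rightarrow> real^'n \<Rightarrow> 'n \<Rightarrow> 'n \<Rightarrow> 'n \<Rightarrow> real" where
  "commutation e x c a b =
     (matrix_inv (e x) *v lie_bracket (\<lambda>z. column a (e z)) (\<lambda>z. column b (e z)) x) $ c"

section \<open>Fibre tensors\<close>

definition frame_fun :: "('n::finite \<Rightarrow> 'v::euclidean_space) \<Rightarrow> ('v \<Rightarrow> real) \<Rightarrow> real^'n \<Rightarrow> real" where
  "frame_fun bas L y = L (\<Sum>a\<in>UNIV. (y $ a) *\<^sub>R bas a)"

definition fmetric :: "(real^'n::finite \<Rightarrow> real) \<Rightarrow> real^'n \<Rightarrow> real^'n^'n" where
  "fmetric f y = (\<chi> a b. pd a (pd b f) y)"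

definition metric_inv :: "(real^'n::finite \<Rightarrow> real) \<Rightarrow> real^'n \<Rightarrow> real^'n^'n" where
  "metric_inv f y = matrix_inv (fmetric f y)"

definition cartan :: "(real^'n::finite \<Rightarrow> real) \<Rightarrow> real^'n \<Rightarrow> 'n \<Rightarrow> 'n \<Rightarrow> 'n \<Rightarrow> real" where
  "cartan f y a b c = 1/2 * pd a (pd b (pd c f)) y"

definition cartan4 :: "(real^'n::finite \<Rightarrow> real) \<Rightarrow> real^'n \<Rightarrow> 'n \<Rightarrow> 'n \<Rightarrow> 'n \<Rightarrow> 'n \<Rightarrow> real" where
  "cartan4 f y a b c d = pd a (\<lambda>z. cartan f z b c d) y"

text \<open>The first index after \<open>y\<close> is the raised one.\<close>

definition cartan_up :: "(real^'n::finite \<Rightarrow> real) \<Rightarrow> real^'n \<Rightarrow> 'n \<Rightarrow> 'n \<Rightarrow> 'n \<Rightarrow> real" where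
  "cartan_up f y m b c = (\<Sum>a\<in>UNIV. metric_inv f y $ m $ a * cartan f y a b c)"

definition cartan4_up :: "(real^'n::finite \<Rightarrow> real) \<Rightarrow> real^'n \<Rightarrow> 'n \<Rightarrow> 'n \<Rightarrow> 'n \<Rightarrow> 'n \<Rightarrow> real" where
  "cartan4_up f y m a b c = (\<Sum>d\<in>UNIV. metric_inv f y $ m $ d * cartan4 f y d a b c)"

definition vcartan_deriv :: "(real^'n::finite \<Rightarrow> real) \<Rightarrow> real^'n \<Rightarrow> 'n \<Rightarrow> 'n \<Rightarrow> 'n \<Rightarrow> 'n \<Rightarrow> real" where
  "vcartan_deriv f y s p q r = pd s (\<lambda>z. cartan f z p q r) y
     - (\<Sum>v\<in>UNIV. cartan_up f y v s p * cartan f y v q r)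
     - (\<Sum>v\<in>UNIV. cartan_up f y v s q * cartan f y p v r)
     - (\<Sum>v\<in>UNIV. cartan_up f y v s r * cartan f y p q v)"

text \<open>\<open>hproj f y a b\<close> is \<open>h\<^sup>a\<^sub>b\<close>, with \<open>g\<^sub>y(y,y) = 2 L\<close>. At null vectors (\<open>L = 0\<close>) HOL's
  convention \<open>x / 0 = 0\<close> makes it the identity.\<close>

definition hproj :: "(real^'n::finite \<Rightarrow> real) \<Rightarrow> real^'n \<Rightarrow> 'n \<Rightarrow> 'n \<Rightarrow> real" where
  "hproj f y a b = kron a b - 1 / (2 * f y) * y $ a * pd b f y"

definition hproj_up :: "(real^'n::finite \<Rightarrow> real) \<Rightarrow> real^'n \<Rightarrow> 'n \<Rightarrow> 'n \<Rightarrow> real" where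
  "hproj_up f y a b = (\<Sum>c\<in>UNIV. metric_inv f y $ b $ c * hproj f y a c)"

definition comm_low :: "real^'n^'n \<Rightarrow> ('n::finite \<Rightarrow> 'n \<Rightarrow> 'n \<Rightarrow> real) \<Rightarrow> 'n \<Rightarrow> 'n \<Rightarrow> 'n \<Rightarrow> real" where
  "comm_low g cc a b c = (\<Sum>d\<in>UNIV. g $ a $ d * cc d b c)"

definition kcoef :: "real^'n^'n \<Rightarrow> ('n::finite \<Rightarrow> 'n \<Rightarrow> 'n \<Rightarrow> real) \<Rightarrow> 'n \<Rightarrow> 'n \<Rightarrow> 'n \<Rightarrow> real" where
  "kcoef g cc m n e = 1/2 * (comm_low g cc m n e + comm_low g cc n e m - comm_low g cc e m n)"

definition antisymm :: "('n \<Rightarrow> 'n \<Rightarrow> real) \<Rightarrow> 'n \<Rightarrow> 'n \<Rightarrow> real" where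
  "antisymm T m n = 1/2 * (T m n - T n m)"

section \<open>Spray, Berwald curvature and Landsberg tensor\<close>

definition spray :: "(real^'n::finite \<Rightarrow> real^'n \<Rightarrow> real) \<Rightarrow> real^'n \<Rightarrow> 'n \<Rightarrow> real^'n \<Rightarrow> real" where
  "spray F x \<mu> y = 1/2 * (\<Sum>\<sigma>\<in>UNIV. metric_inv (F x) y $ \<mu> $ \<sigma> *
     ((\<Sum>\<rho>\<in>UNIV. pd \<rho> (\<lambda>x'. pd \<sigma> (F x') y) x * y $ \<rho>) - pd \<sigma> (\<lambda>x'. F x' y) x))"

definition berwald :: "(real^'n::finite \<Rightarrow> real^'n \<Rightarrow> real) \<Rightarrow> real^'n \<Rightarrow> real^'n \<Rightarrow> 'n \<Rightarrow> 'n \<Rightarrow> 'n \<Rightarrow> 'n \<Rightarrow> real" where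
  "berwald F x y \<rho> \<alpha> \<beta> \<gamma> = pd \<alpha> (pd \<beta> (pd \<gamma> (spray F x \<rho>))) y"

text \<open>\<open>E\<close> is the vierbein matrix at \<open>x\<close>.\<close>

definition berwald_frame :: "(real^'n::finite \<Rightarrow> real^'n \<Rightarrow> real) \<Rightarrow> real^'n^'n \<Rightarrow> real^'n \<Rightarrow> real^'n \<Rightarrow>
    'n \<Rightarrow> 'n \<Rightarrow> 'n \<Rightarrow> 'n \<Rightarrow> real" where
  "berwald_frame F E x y r a b c =
     (\<Sum>\<rho>\<in>UNIV. \<Sum>\<alpha>\<in>UNIV. \<Sum>\<beta>\<in>UNIV. \<Sum>\<gamma>\<in>UNIV. berwald F x y \<rho> \<alpha> \<beta> \<gamma> *
        matrix_inv E $ r $ \<rho> * E $ \<alpha> $ a * E $ \<beta> $ b * E $ \<gamma> $ c)"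

text \<open>Here \<open>f\<close> is the function \<open>L\<close> of the frame components, and \<open>matrix_inv E *v y\<close> are the frame
  components of the vector with coordinate components \<open>y\<close>.\<close>

definition landsberg_frame :: "(real^'n::finite \<Rightarrow> real) \<Rightarrow> (real^'n \<Rightarrow> real^'n \<Rightarrow> real) \<Rightarrow> real^'n^'n \<Rightarrow>
    real^'n \<Rightarrow> real^'n \<Rightarrow> 'n \<Rightarrow> 'n \<Rightarrow> 'n \<Rightarrow> real" where
  "landsberg_frame f F E x y a b c =
     - 1/2 * (\<Sum>r\<in>UNIV. pd r f (matrix_inv E *v y) * berwald_frame F E x y r a b c)"

definition landsberg_coord :: "(real^'n::finite \<Rightarrow> real) \<Rightarrow> (real^'n \<Rightarrow> real^'n \<Rightarrow> real) \<Rightarrow> real^'n^'n \<Rightarrow>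
    real^'n \<Rightarrow> real^'n \<Rightarrow> 'n \<Rightarrow> 'n \<Rightarrow> 'n \<Rightarrow> real" where
  "landsberg_coord f F E x y \<alpha> \<beta> \<gamma> =
     (\<Sum>a\<in>UNIV. \<Sum>b\<in>UNIV. \<Sum>c\<in>UNIV. landsberg_frame f F E x y a b c *
        matrix_inv E $ a $ \<alpha> * matrix_inv E $ b $ \<beta> * matrix_inv E $ c $ \<gamma>)"

end

theory Submission
  imports Defs
begin

text \<open>In a moving frame the spray is a quadratic form in the frame components \<open>y\<close> plus one half of
  \<open>H\<^sup>r = c\<^sup>e\<^sub>m\<^sub>n g\<^sup>r\<^sup>m y\<^sub>e y\<^sup>n\<close>: apart from the quadratic form, the derivatives of the dual basis enter
  it only through their antisymmetric part, the commutation coefficients. Hence the Landsberg tensor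
  is \<open>- 1/4\<close> times the third derivative of \<open>H\<close> contracted with \<open>y\<^sub>r\<close>. As
  \<open>g\<^sub>a\<^sub>r g\<^sup>r\<^sup>m\<close> is constant, the contractions of \<open>H\<close> with \<open>y\<^sub>r\<close>, with the metric and with the
  Cartan tensors are simple, and the product rule reduces the contracted third derivative to
  derivatives of these. The last two equalities are algebraic: they use the antisymmetry of \<open>c\<close> and
  \<open>k\<close> and the contractions of the fibre tensors with \<open>y\<close> given by Euler's relation.\<close>

section \<open>Functions of class Ck\<close>

text \<open>The obstacle is regularity. With \<open>L\<close> of class C4 the inverse metric is only
  C2, so third derivatives of \<open>H\<close> may fail to exist and cannot be obtained from third
  derivatives of \<open>g^rm\<close>. All identities are therefore derived from contractions in
  which the inverse metric has been absorbed: \<open>y_r H^r = 0\<close> by antisymmetry of the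
  commutation coefficients, \<open>g_ar H^r\<close> is a C2 expression, and the Cartan tensors
  contracted with \<open>H\<close> are C1. Existence of a third derivative enters in a single
  application of the product rule, at one point of the fibre. What that step requires is
  differentiability of the second derivatives of \<open>H\<close>, whereas the assumption concerns
  either the coordinate components of the spray or the single products \<open>g^rm y_e y^n\<close>.
  The first is carried over to \<open>H\<close> by solving the frame formula,
  \<open>H^r = 2 e^r_mu G^mu - Q^r\<close> with \<open>Q\<close> a quadratic polynomial. The last
  equality is an identity in \<kappa> = \<open>1 / (2 * f y)\<close>: all terms with \<kappa> cancel
  or vanish by antisymmetry, whatever the value of \<kappa>. Null vectors, where HOL makes \<kappa>
  zero, thus need no separate treatment.\<close>

lemma differentiable_transform_open:
  assumes "f differentiable (at x)" "open S" "x \<in> S" "\<And>z. z \<in> S \<Longrightarrow> f z = g z"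
  shows "g differentiable (at x)"
  using assms unfolding differentiable_def
  by (meson has_derivative_transform_within_open)

text \<open>\<open>frechet_derivative\<close> is a choice among all derivatives at the point, and
  the set of these depends only on the germ of the function. Hence no differentiability is assumed,
  here or in \<open>pd_cong\<close>.\<close>

lemma frechet_derivative_transform_open:
  assumes "open S" "x \<in> S" "\<And>z. z \<in> S \<Longrightarrow> f z = g z"
  shows "frechet_derivative f (at x) = frechet_derivative g (at x)"
proof -
  have "(f has_derivative D) (at x) \<longleftrightarrow> (g has_derivative D) (at x)" for D
    using assms by (metis has_derivative_transform_within_open)
  then show ?thesis by (simp add: frechet_derivative_def)
qed

text \<open>Formulas for the derivative of a sum, product or composite are known only on
  \<open>S\<close>, whereas \<open>Ck_on\<close> speaks of the chosen derivative itself. Each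
  closure property below replaces one by the other through this lemma.\<close>

lemma Ck_on_cong:
  assumes "open S" "\<And>z. z \<in> S \<Longrightarrow> f z = g z" "Ck_on k f S"
  shows "Ck_on k g S"
  using assms(2,3)
proof (induction k arbitrary: f g)
  case 0
  then show ?case by (metis Ck_on.simps(1) continuous_on_cong)
next
  case (Suc k)
  have fd: "f differentiable (at x)" if "x \<in> S" for x
    using Suc.prems(2) that assms(1) by (simp add: differentiable_on_eq_differentiable_at)
  have "g differentiable_on S"
    using fd differentiable_transform_open[OF _ assms(1)] Suc.prems(1)
    by (metis assms(1) differentiable_on_eq_differentiable_at)
  moreover have "Ck_on k (\<lambda>x. frechet_derivative g (at x) v) S" for v
    using Suc.IH[of "\<lambda>x. frechet_derivative f (at x) v" "\<lambda>x. frechet_derivative g (at x) v"]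
      Suc.prems frechet_derivative_transform_open[OF assms(1), of _ f g] by simp
  ultimately show ?case by simp
qed

lemma Ck_on_imp_differentiable:
  assumes "open S" "Ck_on k f S" "0 < k" "x \<in> S"
  shows "f differentiable (at x)"
  using assms by (cases k) (auto simp: differentiable_on_eq_differentiable_at)

lemma Ck_on_imp_continuous_on: "Ck_on k f S \<Longrightarrow> continuous_on S f"
  by (cases k) (auto simp: differentiable_imp_continuous_on)

lemma Ck_on_SucD: "Ck_on (Suc k) f S \<Longrightarrow> Ck_on k f S"
proof (induction k arbitrary: f)
  case 0
  then show ?case by (simp add: differentiable_imp_continuous_on)
next
  case (Suc k)
  then show ?case by simp
qed

lemma Ck_on_mono:
  assumes "Ck_on k f S" "j \<le> k"
  shows "Ck_on j f S"
  using assms(2,1) by (induction rule: inc_induct) (auto dest: Ck_on_SucD simp del: Ck_on.simps)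

lemma Ck_on_const [simp]: "Ck_on k (\<lambda>x. c) S"
  by (induction k arbitrary: c) (auto simp: differentiable_on_def)

lemma frechet_derivative_eqI: "(f has_derivative f') (at x) \<Longrightarrow> frechet_derivative f (at x) = f'"
  using frechet_derivative_at by blast

lemma Ck_on_linear_comp:
  assumes "open S" "Ck_on k f S" "bounded_linear T"
  shows "Ck_on k (\<lambda>x. T (f x)) S"
  using assms(2)
proof (induction k arbitrary: f)
  case 0
  then show ?case using assms(3) by (auto intro: bounded_linear.continuous_on)
next
  case (Suc k)
  have d: "((\<lambda>x. T (f x)) has_derivative (\<lambda>v. T (frechet_derivative f (at x) v))) (at x)"
    if "x \<in> S" for x
    using Suc.prems that assms(1,3) bounded_linear.has_derivative
    by (fastforce simp: differentiable_on_eq_differentiable_at frechet_derivative_works)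
  then have "(\<lambda>x. T (f x)) differentiable_on S"
    by (meson assms(1) differentiable_def differentiable_on_eq_differentiable_at)
  moreover have "Ck_on k (\<lambda>x. frechet_derivative (\<lambda>x. T (f x)) (at x) v) S" for v
  proof (rule Ck_on_cong[OF assms(1)])
    show "Ck_on k (\<lambda>x. T (frechet_derivative f (at x) v)) S"
      using Suc by simp
  qed (simp add: frechet_derivative_eqI[OF d])
  ultimately show ?case by simp
qed

lemma Ck_on_comp_linear:
  assumes "open S" "Ck_on k f S" "bounded_linear T" "open R" "T ` R \<subseteq> S"
  shows "Ck_on k (\<lambda>x. f (T x)) R"
  using assms(2)
proof (induction k arbitrary: f)
  case 0
  then show ?case
    using assms(3,5) by (auto intro: continuous_on_compose2 linear_continuous_on)
next
  case (Suc k)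
  have d: "((\<lambda>x. f (T x)) has_derivative (\<lambda>v. frechet_derivative f (at (T x)) (T v))) (at x)"
    if "x \<in> R" for x
  proof -
    have "(f has_derivative frechet_derivative f (at (T x))) (at (T x))"
      using Suc.prems that assms(1,5)
      by (simp add: differentiable_on_eq_differentiable_at frechet_derivative_works image_subset_iff)
    then show ?thesis
      using has_derivative_compose[OF bounded_linear_imp_has_derivative[OF assms(3), of "at x"]]
      by blast
  qed
  then have "(\<lambda>x. f (T x)) differentiable_on R"
    by (meson assms(4) differentiable_def differentiable_on_eq_differentiable_at)
  moreover have "Ck_on k (\<lambda>x. frechet_derivative (\<lambda>x. f (T x)) (at x) v) R" for v
  proof (rule Ck_on_cong[OF assms(4)])
    show "Ck_on k (\<lambda>x. frechet_derivative f (at (T x)) (T v)) R"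
      using Suc.IH[of "\<lambda>z. frechet_derivative f (at z) (T v)"] Suc.prems by simp
  qed (simp add: frechet_derivative_eqI[OF d])
  ultimately show ?case by simp
qed

lemma Ck_on_add:
  assumes "open S" "Ck_on k f S" "Ck_on k g S"
  shows "Ck_on k (\<lambda>x. f x + g x) S"
  using assms(2,3)
proof (induction k arbitrary: f g)
  case 0
  then show ?case by (auto intro: continuous_intros)
next
  case (Suc k)
  have d: "((\<lambda>x. f x + g x) has_derivative
      (\<lambda>v. frechet_derivative f (at x) v + frechet_derivative g (at x) v)) (at x)" if "x \<in> S" for x
    using Suc.prems that assms(1)
    by (intro has_derivative_add)
       (simp_all add: differentiable_on_eq_differentiable_at frechet_derivative_works)
  then have "(\<lambda>x. f x + g x) differentiable_on S"
    by (meson assms(1) differentiable_def differentiable_on_eq_differentiable_at)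
  moreover have "Ck_on k (\<lambda>x. frechet_derivative (\<lambda>x. f x + g x) (at x) v) S" for v
  proof (rule Ck_on_cong[OF assms(1)])
    show "Ck_on k (\<lambda>x. frechet_derivative f (at x) v + frechet_derivative g (at x) v) S"
      using Suc by simp
  qed (simp add: frechet_derivative_eqI[OF d])
  ultimately show ?case by simp
qed

lemma Ck_on_sum:
  assumes "open S" "\<And>i. i \<in> I \<Longrightarrow> Ck_on k (f i) S"
  shows "Ck_on k (\<lambda>x. \<Sum>i\<in>I. f i x) S"
  using assms(2) by (induction I rule: infinite_finite_induct) (auto intro: Ck_on_add[OF assms(1)])

lemma Ck_on_mult:
  fixes f g :: "'a::real_normed_vector \<Rightarrow> real"
  assumes "open S" "Ck_on k f S" "Ck_on k g S"
  shows "Ck_on k (\<lambda>x. f x * g x) S"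
  using assms(2,3)
proof (induction k arbitrary: f g)
  case 0
  then show ?case by (auto intro: continuous_intros)
next
  case (Suc k)
  have d: "((\<lambda>x. f x * g x) has_derivative
      (\<lambda>v. f x * frechet_derivative g (at x) v + frechet_derivative f (at x) v * g x)) (at x)"
    if "x \<in> S" for x
    using Suc.prems that assms(1)
    by (intro has_derivative_mult)
       (simp_all add: differentiable_on_eq_differentiable_at frechet_derivative_works)
  then have "(\<lambda>x. f x * g x) differentiable_on S"
    by (meson assms(1) differentiable_def differentiable_on_eq_differentiable_at)
  moreover have "Ck_on k (\<lambda>x. frechet_derivative (\<lambda>x. f x * g x) (at x) v) S" for v
  proof (rule Ck_on_cong[OF assms(1)])
    show "Ck_on k (\<lambda>x. f x * frechet_derivative g (at x) v + frechet_derivative f (at x) v * g x) S"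
      using Suc by (intro Ck_on_add[OF assms(1)] Suc.IH Ck_on_SucD[of k f] Ck_on_SucD[of k g]) simp_all
  qed (simp add: frechet_derivative_eqI[OF d])
  ultimately show ?case by simp
qed

lemma Ck_on_cmult:
  fixes f :: "'a::real_normed_vector \<Rightarrow> real"
  assumes "open S" "Ck_on k f S"
  shows "Ck_on k (\<lambda>x. c * f x) S"
  by (intro Ck_on_mult assms Ck_on_const)

lemma Ck_on_prod:
  fixes f :: "'i \<Rightarrow> 'a::real_normed_vector \<Rightarrow> real"
  assumes "open S" "\<And>i. i \<in> I \<Longrightarrow> Ck_on k (f i) S"
  shows "Ck_on k (\<lambda>x. \<Prod>i\<in>I. f i x) S"
  using assms(2) by (induction I rule: infinite_finite_induct) (auto intro: Ck_on_mult[OF assms(1)])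

text \<open>The derivative \<open>- f' / f^2\<close> contains the inverse again, in one order of
  regularity less; that is exactly what the induction hypothesis provides.\<close>

lemma Ck_on_inverse:
  fixes f :: "'a::real_normed_vector \<Rightarrow> real"
  assumes "open S" "Ck_on k f S" "\<And>x. x \<in> S \<Longrightarrow> f x \<noteq> 0"
  shows "Ck_on k (\<lambda>x. inverse (f x)) S"
  using assms(2)
proof (induction k)
  case 0
  then show ?case using assms(3) by (auto intro: continuous_intros)
next
  case (Suc k)
  have d: "((\<lambda>x. inverse (f x)) has_derivative
      (\<lambda>v. - (inverse (f x) * frechet_derivative f (at x) v * inverse (f x)))) (at x)"
    if "x \<in> S" for x
    using Suc.prems that assms(1,3)
    by (intro Deriv.has_derivative_inverse)
       (simp_all add: differentiable_on_eq_differentiable_at frechet_derivative_works)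
  then have "(\<lambda>x. inverse (f x)) differentiable_on S"
    by (meson assms(1) differentiable_def differentiable_on_eq_differentiable_at)
  moreover have "Ck_on k (\<lambda>x. frechet_derivative (\<lambda>x. inverse (f x)) (at x) v) S" for v
  proof (rule Ck_on_cong[OF assms(1)])
    have "Ck_on k (\<lambda>x. inverse (f x)) S"
      using Suc Ck_on_SucD by blast
    then show "Ck_on k (\<lambda>x. (- 1) * (inverse (f x) * frechet_derivative f (at x) v * inverse (f x))) S"
      using Suc.prems by (intro Ck_on_cmult Ck_on_mult assms(1)) simp_all
  qed (simp add: frechet_derivative_eqI[OF d])
  ultimately show ?case by simp
qed

lemma Ck_on_bounded_linear:
  assumes "open S" "bounded_linear T"
  shows "Ck_on k T S"
proof (cases k)
  case 0
  then show ?thesis using assms by (simp add: linear_continuous_on)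
next
  case (Suc n)
  have d: "(T has_derivative T) (at x)" for x
    using assms(2) by (rule bounded_linear_imp_has_derivative)
  then show ?thesis
    unfolding Suc by (auto simp: frechet_derivative_eqI[OF d] intro!: bounded_linear_imp_differentiable_on assms)
qed

lemma Ck_on_vec_nth: "open S \<Longrightarrow> Ck_on k (\<lambda>x::real^'n. x $ i) S"
  by (rule Ck_on_bounded_linear) (auto intro: bounded_linear_vec_nth)

lemma Ck_on_vec_nth_comp: "open S \<Longrightarrow> Ck_on k f S \<Longrightarrow> Ck_on k (\<lambda>x. (f x :: real^'n) $ i) S"
  by (rule Ck_on_linear_comp) (auto intro: bounded_linear_vec_nth)

lemma Ck_on_det:
  fixes M :: "'a::real_normed_vector \<Rightarrow> real^'n^'n"
  assumes "open S" "\<And>i j. Ck_on k (\<lambda>x. M x $ i $ j) S"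
  shows "Ck_on k (\<lambda>x. det (M x)) S"
  unfolding det_def using assms by (intro Ck_on_sum Ck_on_mult Ck_on_const Ck_on_prod) auto

section \<open>Inverse matrices\<close>

lemma matrix_inv_unique_right:
  fixes A B :: "real^'n^'n"
  assumes "A ** B = mat 1"
  shows "matrix_inv A = B"
proof -
  have BA: "B ** A = mat 1" using assms matrix_left_right_inverse by blast
  then have "invertible A" using assms invertible_def by blast
  then have "matrix_inv A ** A = mat 1" unfolding invertible_def matrix_inv_def by (metis (mono_tags, lifting) someI_ex)
  then show ?thesis by (metis assms matrix_mul_assoc matrix_mul_lid matrix_mul_rid)
qed

lemma matrix_inv_mul:
  fixes A :: "real^'n^'n"
  assumes "invertible A"
  shows "A ** matrix_inv A = mat 1" "matrix_inv A ** A = mat 1"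
  using assms matrix_inv_unique_right invertible_def matrix_left_right_inverse by metis+

text \<open>Cramer's rule makes every entry of the inverse a polynomial in the entries divided by
  the determinant, so that regularity of the inverse follows from the closure properties of
  \<open>Ck_on\<close>.\<close>

lemma matrix_inv_entry:
  fixes A :: "real^'n^'n"
  assumes "invertible A"
  shows "matrix_inv A $ i $ j = det (\<chi> k l. if l = i then axis j 1 $ k else A $ k $ l) * inverse (det A)"
proof -
  have "A *v (matrix_inv A *v axis j 1) = axis j 1"
    by (simp add: matrix_vector_mul_assoc matrix_inv_mul[OF assms])
  then have "matrix_inv A *v axis j 1
      = (\<chi> i. det (\<chi> k l. if l = i then axis j 1 $ k else A $ k $ l) / det A)"
    using cramer[of A "matrix_inv A *v axis j 1" "axis j 1"] assms invertible_det_nz by blast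
  moreover have "matrix_inv A $ i $ j = (matrix_inv A *v axis j 1) $ i"
    by (simp add: matrix_vector_mult_basis column_def)
  ultimately show ?thesis by (simp add: divide_inverse)
qed

lemma Ck_on_matrix_inv:
  fixes M :: "'a::real_normed_vector \<Rightarrow> real^'n^'n"
  assumes "open S" "\<And>i j. Ck_on k (\<lambda>x. M x $ i $ j) S" "\<And>x. x \<in> S \<Longrightarrow> invertible (M x)"
  shows "Ck_on k (\<lambda>x. matrix_inv (M x) $ i $ j) S"
proof (rule Ck_on_cong[OF assms(1)])
  \<comment> \<open>The column replaced in Cramer's rule is constant in \<open>x\<close>; the other
    entries are those of \<open>M x\<close>.\<close>
  have "Ck_on k (\<lambda>x. (\<chi> k l. if l = i then axis j 1 $ k else M x $ k $ l) $ k' $ l') S" for k' l'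
    using assms(2) by (cases "l' = i") auto
  then show "Ck_on k (\<lambda>x. det (\<chi> k l. if l = i then axis j 1 $ k else M x $ k $ l) * inverse (det (M x))) S"
    using assms(2,3)
    by (intro Ck_on_mult Ck_on_inverse Ck_on_det assms(1)) (simp_all flip: invertible_det_nz)
qed (simp add: matrix_inv_entry assms(3))

section \<open>Partial derivatives\<close>

lemma pd_cong:
  assumes "open S" "x \<in> S" "\<And>z. z \<in> S \<Longrightarrow> f z = g z"
  shows "pd i f x = pd i g x"
  unfolding pd_def using frechet_derivative_transform_open[OF assms] by simp

lemma pd_eqI: "(f has_derivative f') (at x) \<Longrightarrow> pd i f x = f' (axis i 1)"
  unfolding pd_def using frechet_derivative_eqI by metis

lemma pd_add:
  "f differentiable (at x) \<Longrightarrow> g differentiable (at x) \<Longrightarrow> pd i (\<lambda>x. f x + g x) x = pd i f x + pd i g x"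
  unfolding frechet_derivative_works
  by (subst pd_eqI[OF has_derivative_add]) (auto simp: pd_def)

lemma pd_mult:
  "f differentiable (at x) \<Longrightarrow> g differentiable (at x) \<Longrightarrow>
    pd i (\<lambda>x. f x * g x) x = pd i f x * g x + f x * pd i g x"
  unfolding frechet_derivative_works
  by (subst pd_eqI[OF has_derivative_mult]) (auto simp: pd_def)

lemma pd_const [simp]: "pd i (\<lambda>x. c) x = 0"
  by (simp add: pd_def)

lemma pd_cmult: "f differentiable (at x) \<Longrightarrow> pd i (\<lambda>x. c * f x) x = c * pd i f x"
  by (simp add: pd_mult)

lemma pd_sum:
  assumes "\<And>j. j \<in> I \<Longrightarrow> f j differentiable (at x)"
  shows "pd i (\<lambda>x. \<Sum>j\<in>I. f j x) x = (\<Sum>j\<in>I. pd i (f j) x)"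
proof (cases "finite I")
  case True
  then show ?thesis
    using assms by (induction I rule: finite_induct) (auto simp: pd_add intro: differentiable_sum)
qed simp

lemma pd_vec_nth: "pd i (\<lambda>x. x $ j) x = kron j i"
  by (subst pd_eqI[OF bounded_linear_imp_has_derivative[OF bounded_linear_vec_nth]])
     (auto simp: axis_def kron_def)

lemma differentiable_vec_nth [simp]: "(\<lambda>x::real^'n. x $ j) differentiable (at x)"
  by (rule bounded_linear_imp_differentiable) (rule bounded_linear_vec_nth)

lemma frechet_derivative_pd:
  fixes f :: "real^'n \<Rightarrow> real"
  assumes "f differentiable (at x)"
  shows "frechet_derivative f (at x) v = (\<Sum>i\<in>UNIV. v $ i * pd i f x)"
proof -
  interpret linear "frechet_derivative f (at x)"
    using assms by (rule linear_frechet_derivative)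
  have "frechet_derivative f (at x) (\<Sum>i\<in>UNIV. v $ i *\<^sub>R axis i 1) = (\<Sum>i\<in>UNIV. v $ i * pd i f x)"
    by (simp add: sum scale pd_def)
  then show ?thesis
    using basis_expansion[of v] by (simp add: scalar_mult_eq_scaleR)
qed

lemma Ck_on_pd: "Ck_on (Suc k) f S \<Longrightarrow> Ck_on k (pd i f) S"
  unfolding pd_def by simp

lemma differentiable_comp_matrix:
  fixes B :: "real^'n^'m"
  assumes "f differentiable (at (B *v x))"
  shows "(\<lambda>x. f (B *v x)) differentiable (at x)"
  using assms has_derivative_compose[OF bounded_linear_imp_has_derivative[OF matrix_vector_mul_bounded_linear]]
  unfolding differentiable_def by blast

lemma pd_comp_matrix:
  fixes B :: "real^'n^'m"
  assumes "f differentiable (at (B *v x))"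
  shows "pd i (\<lambda>x. f (B *v x)) x = (\<Sum>j\<in>UNIV. B $ j $ i * pd j f (B *v x))"
proof -
  have "((\<lambda>x. f (B *v x)) has_derivative (\<lambda>v. frechet_derivative f (at (B *v x)) (B *v v))) (at x)"
    using assms has_derivative_compose[OF bounded_linear_imp_has_derivative[OF matrix_vector_mul_bounded_linear]]
    unfolding frechet_derivative_works by blast
  then have "pd i (\<lambda>x. f (B *v x)) x = frechet_derivative f (at (B *v x)) (B *v axis i 1)"
    by (rule pd_eqI)
  then show ?thesis
    by (simp add: frechet_derivative_pd[OF assms] matrix_vector_mult_basis column_def)
qed

text \<open>Both mixed derivatives are values of the same second difference quotient, by the mean value
  theorem applied twice, in either order.\<close>

lemma second_difference_mean_value:
  fixes f :: "'a::real_normed_vector \<Rightarrow> real"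
  assumes S: "\<And>s t. 0 \<le> s \<Longrightarrow> s \<le> r \<Longrightarrow> 0 \<le> t \<Longrightarrow> t \<le> r \<Longrightarrow> x + s *\<^sub>R u + t *\<^sub>R v \<in> S"
    and "open S" "Ck_on 2 f S" "0 < r"
  obtains s t where "0 < s" "s < r" "0 < t" "t < r"
    "f (x + r *\<^sub>R u + r *\<^sub>R v) - f (x + r *\<^sub>R u) - f (x + r *\<^sub>R v) + f x
      = r * r * frechet_derivative (\<lambda>z. frechet_derivative f (at z) u) (at (x + s *\<^sub>R u + t *\<^sub>R v)) v"
proof -
  let ?D = "\<lambda>f z. frechet_derivative f (at z)"
  have f2: "Ck_on (Suc (Suc 0)) f S"
    using assms(3) by (simp add: numeral_2_eq_2)
  have d1: "(f has_derivative ?D f z) (at z)" if "z \<in> S" for z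
    using f2 that assms(2) by (simp add: differentiable_on_eq_differentiable_at frechet_derivative_works)
  have d2: "((\<lambda>z. ?D f z u) has_derivative ?D (\<lambda>z. ?D f z u) z) (at z)" if "z \<in> S" for z
    using f2 that assms(2) by (simp add: differentiable_on_eq_differentiable_at frechet_derivative_works)
  have line: "((\<lambda>s. g (w + s *\<^sub>R e)) has_real_derivative g' e) (at s)"
    if "(g has_derivative g') (at (w + s *\<^sub>R e))" for g :: "'a \<Rightarrow> real" and g' w e s
  proof -
    have "((\<lambda>s. w + s *\<^sub>R e) has_derivative (\<lambda>h. h *\<^sub>R e)) (at s)"
      by (auto intro!: derivative_eq_intros)
    from has_derivative_compose[OF this that] show ?thesis
      using linear_cmul[OF has_derivative_linear[OF that]]
      by (simp add: has_field_derivative_def mult_commute_abs)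
  qed
  \<comment> \<open>The second difference is \<open>g r - g 0\<close>. The first mean value step
    runs along \<open>u\<close>; it leaves a difference of first derivatives along \<open>v\<close>,
    to which the second step applies.\<close>
  define g where "g s = f ((x + r *\<^sub>R v) + s *\<^sub>R u) - f (x + s *\<^sub>R u)" for s
  have "(g has_real_derivative ?D f ((x + r *\<^sub>R v) + s *\<^sub>R u) u - ?D f (x + s *\<^sub>R u) u) (at s)"
    if "0 \<le> s" "s \<le> r" for s
    unfolding g_def using that S[of s r] S[of s 0] assms(4)
    by (intro DERIV_diff line d1) (auto simp: algebra_simps)
  from MVT2[OF assms(4) this] obtain s where s: "0 < s" "s < r"
    "g r - g 0 = (r - 0) * (?D f ((x + r *\<^sub>R v) + s *\<^sub>R u) u - ?D f (x + s *\<^sub>R u) u)"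
    by blast
  have "((\<lambda>t. ?D f ((x + s *\<^sub>R u) + t *\<^sub>R v) u) has_real_derivative
      ?D (\<lambda>z. ?D f z u) ((x + s *\<^sub>R u) + t *\<^sub>R v) v) (at t)" if "0 \<le> t" "t \<le> r" for t
    using that S[of s t] s by (intro line[of "\<lambda>z. ?D f z u"] d2) auto
  from MVT2[OF assms(4) this] obtain t where t: "0 < t" "t < r"
    "?D f ((x + s *\<^sub>R u) + r *\<^sub>R v) u - ?D f ((x + s *\<^sub>R u) + 0 *\<^sub>R v) u
      = (r - 0) * ?D (\<lambda>z. ?D f z u) ((x + s *\<^sub>R u) + t *\<^sub>R v) v"
    by blast
  from s t show thesis
    by (intro that[of s t]) (simp_all add: g_def algebra_simps)
qed

text \<open>Schwarz's theorem. On a parallelogram with sides \<open>r u\<close> and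
  \<open>r v\<close> both mixed derivatives take a common value, each at some point of its own; as
  \<open>r\<close> shrinks, continuity carries the equality to \<open>x\<close>.\<close>

lemma frechet_derivative_commute:
  fixes f :: "'a::real_normed_vector \<Rightarrow> real"
  assumes "open S" "Ck_on 2 f S" "x \<in> S"
  shows "frechet_derivative (\<lambda>z. frechet_derivative f (at z) u) (at x) v
       = frechet_derivative (\<lambda>z. frechet_derivative f (at z) v) (at x) u"
proof -
  let ?H = "\<lambda>u v x. frechet_derivative (\<lambda>z. frechet_derivative f (at z) u) (at x) v"
  have f2: "Ck_on (Suc (Suc 0)) f S"
    using assms(2) by (simp add: numeral_2_eq_2)
  have cont: "isCont (?H u v) x" for u v
    using f2 assms(1,3) by (auto simp: continuous_on_eq_continuous_at)
  obtain \<epsilon> where \<epsilon>: "\<epsilon> > 0" "ball x \<epsilon> \<subseteq> S"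
    using assms(1,3) open_contains_ball by blast
  \<comment> \<open>The parallelogram lies in the ball of radius \<open>r * N\<close>; the summand 1
    makes this strict and keeps \<open>N\<close> positive when \<open>u = v = 0\<close>.\<close>
  define N where "N = norm u + norm v + 1"
  have N: "N > 0" unfolding N_def by (smt (verit) norm_ge_zero)
  have near: "x + s *\<^sub>R u + t *\<^sub>R v \<in> ball x (r * N)" if "0 < r" "0 \<le> s" "s \<le> r" "0 \<le> t" "t \<le> r" for s t r
  proof -
    have "norm (s *\<^sub>R u + t *\<^sub>R v) \<le> s * norm u + t * norm v"
      using that norm_triangle_ineq[of "s *\<^sub>R u" "t *\<^sub>R v"] by simp
    also have "\<dots> \<le> r * norm u + r * norm v"
      using that by (intro add_mono mult_right_mono) auto
    also have "\<dots> < r * N" using that by (simp add: N_def algebra_simps)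
    finally show ?thesis by (simp add: dist_norm norm_minus_commute algebra_simps)
  qed
  show ?thesis
  proof (rule ccontr)
    assume "?H u v x \<noteq> ?H v u x"
    \<comment> \<open>Half the supposed gap: two equal numbers, each within \<open>d\<close> of one
      of the two values, force the gap below \<open>2 * d\<close>.\<close>
    define d where "d = \<bar>?H u v x - ?H v u x\<bar> / 2"
    have "d > 0" using \<open>?H u v x \<noteq> ?H v u x\<close> by (simp add: d_def)
    obtain \<delta>1 where \<delta>1: "\<delta>1 > 0" "\<And>z. dist z x < \<delta>1 \<Longrightarrow> dist (?H u v z) (?H u v x) < d"
      using cont[of u v] \<open>d > 0\<close> unfolding continuous_at_eps_delta by blast
    obtain \<delta>2 where \<delta>2: "\<delta>2 > 0" "\<And>z. dist z x < \<delta>2 \<Longrightarrow> dist (?H v u z) (?H v u x) < d"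
      using cont[of v u] \<open>d > 0\<close> unfolding continuous_at_eps_delta by blast
    define r where "r = min \<epsilon> (min \<delta>1 \<delta>2) / N"
    have r: "r > 0" "r * N \<le> \<epsilon>" "r * N \<le> \<delta>1" "r * N \<le> \<delta>2"
      using N \<epsilon> \<delta>1 \<delta>2 by (auto simp: r_def)
    have inS: "x + s *\<^sub>R u + t *\<^sub>R v \<in> S" if "0 \<le> s" "s \<le> r" "0 \<le> t" "t \<le> r" for s t
      using near[OF r(1) that] \<epsilon>(2) r(2) by (auto simp: subset_iff)
    then have inS': "x + s *\<^sub>R v + t *\<^sub>R u \<in> S" if "0 \<le> s" "s \<le> r" "0 \<le> t" "t \<le> r" for s t
      using that by (metis add.assoc add.commute)
    obtain s t where st: "0 < s" "s < r" "0 < t" "t < r"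
      "f (x + r *\<^sub>R u + r *\<^sub>R v) - f (x + r *\<^sub>R u) - f (x + r *\<^sub>R v) + f x
        = r * r * ?H u v (x + s *\<^sub>R u + t *\<^sub>R v)"
      using second_difference_mean_value[OF inS assms(1,2) r(1)] by blast
    obtain s' t' where st': "0 < s'" "s' < r" "0 < t'" "t' < r"
      "f (x + r *\<^sub>R v + r *\<^sub>R u) - f (x + r *\<^sub>R v) - f (x + r *\<^sub>R u) + f x
        = r * r * ?H v u (x + s' *\<^sub>R v + t' *\<^sub>R u)"
      using second_difference_mean_value[OF inS' assms(1,2) r(1)] by blast
    have "r * r * ?H u v (x + s *\<^sub>R u + t *\<^sub>R v) = r * r * ?H v u (x + s' *\<^sub>R v + t' *\<^sub>R u)"
      unfolding st(5)[symmetric] st'(5)[symmetric] by (simp add: algebra_simps)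
    then have "?H u v (x + s *\<^sub>R u + t *\<^sub>R v) = ?H v u (x + s' *\<^sub>R v + t' *\<^sub>R u)"
      using r(1) by simp
    moreover have "dist (?H u v (x + s *\<^sub>R u + t *\<^sub>R v)) (?H u v x) < d"
      using near[of r s t] st r by (intro \<delta>1(2)) (auto simp: dist_commute)
    moreover have "dist (?H v u (x + s' *\<^sub>R v + t' *\<^sub>R u)) (?H v u x) < d"
      using near[of r t' s'] st' r by (intro \<delta>2(2)) (auto simp: dist_commute algebra_simps)
    ultimately have "\<bar>?H u v x - ?H v u x\<bar> < 2 * d"
      unfolding dist_real_def by linarith
    then show False by (simp add: d_def)
  qed
qed

lemma pd_commute:
  assumes "open S" "Ck_on 2 f S" "x \<in> S"
  shows "pd i (pd j f) x = pd j (pd i f) x"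
  using frechet_derivative_commute[OF assms] unfolding pd_def .

section \<open>Tensors on a fibre\<close>

lemma sum_kron [simp]:
  fixes F :: "'n::finite \<Rightarrow> real"
  shows "(\<Sum>n\<in>UNIV. F n * kron n a) = F a" "(\<Sum>n\<in>UNIV. F n * kron a n) = F a"
    "(\<Sum>n\<in>UNIV. kron n a * F n) = F a" "(\<Sum>n\<in>UNIV. kron a n * F n) = F a"
  by (simp_all add: kron_def if_distrib[of "\<lambda>t. _ * t"] if_distrib[of "\<lambda>t. t * _"] cong: if_cong)

lemma pd_sum_mult:
  assumes "\<And>r. u r differentiable (at y)" "\<And>r. v r differentiable (at y)"
  shows "pd a (\<lambda>z. \<Sum>r\<in>(UNIV::'k::finite set). u r z * v r z) y
       = (\<Sum>r\<in>UNIV. pd a (u r) y * v r y) + (\<Sum>r\<in>UNIV. u r y * pd a (v r) y)"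
  by (subst pd_sum) (auto simp: pd_mult assms sum.distrib intro: differentiable_mult assms)

lemma mat_entry: "mat 1 $ i $ j = kron i j"
  by (simp add: mat_def kron_def)

text \<open>The Euler relation is the only consequence of homogeneity that matters on the open cone \<open>S\<close>.\<close>

locale fibre =
  fixes f :: "real^'n::finite \<Rightarrow> real" and S :: "(real^'n) set"
  assumes open_S: "open S"
    and C4: "Ck_on 4 f S"
    and invertible_fmetric: "y \<in> S \<Longrightarrow> invertible (fmetric f y)"
    and euler: "y \<in> S \<Longrightarrow> (\<Sum>b\<in>UNIV. pd a (pd b f) y * y $ b) = pd a f y"
begin

abbreviation g where "g a b y \<equiv> pd a (pd b f) y"
abbreviation gi where "gi a b y \<equiv> metric_inv f y $ a $ b"

lemma Ck_pd: "Ck_on 3 (pd a f) S"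
  using Ck_on_pd[of 3 f S] C4 by (simp add: numeral_eq_Suc)

lemma Ck_g: "Ck_on 2 (pd a (pd b f)) S"
  using Ck_on_pd[of 2 "pd b f" S] Ck_pd by (simp add: numeral_eq_Suc)

lemma Ck_g_pd: "Ck_on 1 (pd a (pd b (pd c f))) S"
  using Ck_on_pd[of 1 "pd b (pd c f)" S] Ck_g by (simp add: numeral_eq_Suc)

lemma Ck_gi: "Ck_on 2 (gi a b) S"
  unfolding metric_inv_def
  by (rule Ck_on_matrix_inv[OF open_S]) (auto simp: fmetric_def Ck_g invertible_fmetric[unfolded fmetric_def])

lemma Ck_cartan: "Ck_on 1 (\<lambda>y. cartan f y a b c) S"
  unfolding cartan_def by (intro Ck_on_cmult open_S Ck_g_pd)

lemma Ck_cartan_up: "Ck_on 1 (\<lambda>y. cartan_up f y a b c) S"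
  unfolding cartan_up_def
  by (intro Ck_on_sum Ck_on_mult Ck_cartan open_S Ck_on_mono[OF Ck_gi]) simp

lemma Ck_vec_nth: "Ck_on k (\<lambda>y. y $ i) S"
  by (rule Ck_on_vec_nth[OF open_S])

lemma differentiable [simp]:
  assumes "y \<in> S"
  shows "pd a f differentiable (at y)" "pd a (pd b f) differentiable (at y)"
    "pd a (pd b (pd c f)) differentiable (at y)"
    "gi a b differentiable (at y)" "(\<lambda>y. cartan f y a b c) differentiable (at y)"
    "(\<lambda>y. cartan_up f y a b c) differentiable (at y)"
  by (auto intro: Ck_on_imp_differentiable[OF open_S Ck_pd] Ck_on_imp_differentiable[OF open_S Ck_g]
      Ck_on_imp_differentiable[OF open_S Ck_g_pd] Ck_on_imp_differentiable[OF open_S Ck_gi]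
      Ck_on_imp_differentiable[OF open_S Ck_cartan] Ck_on_imp_differentiable[OF open_S Ck_cartan_up] assms)

lemma g_commute: "y \<in> S \<Longrightarrow> g a b y = g b a y"
  by (rule pd_commute[OF open_S Ck_on_mono[OF C4]]) auto

lemma cartan_commute:
  assumes "y \<in> S"
  shows "cartan f y a b c = cartan f y b a c" "cartan f y a b c = cartan f y a c b"
    "cartan f y a b c = cartan f y c b a"
proof -
  show *: "cartan f y a b c = cartan f y b a c" for a b c
    unfolding cartan_def using assms
    by (subst pd_commute[OF open_S Ck_on_mono[OF Ck_pd]]) auto
  show **: "cartan f y a b c = cartan f y a c b" for a b c
    unfolding cartan_def using assms pd_cong[OF open_S, of y "pd b (pd c f)" "pd c (pd b f)"]
    by (auto simp: g_commute)
  show "cartan f y a b c = cartan f y c b a"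
    using * ** by metis
qed

text \<open>The new index is exchanged with an old one by Schwarz's theorem for \<open>g\<close>,
  which is still C2; the symmetry of the Cartan tensor on all of \<open>S\<close> is inherited by
  its derivative.\<close>

lemma cartan4_commute:
  assumes "y \<in> S"
  shows "cartan4 f y a b c d = cartan4 f y b a c d" "cartan4 f y a b c d = cartan4 f y a c b d"
    "cartan4 f y a b c d = cartan4 f y a b d c"
proof -
  have "cartan4 f y a b c d = 1/2 * pd a (pd b (pd c (pd d f))) y" for a b
    unfolding cartan4_def cartan_def using assms by (subst pd_cmult) auto
  then show "cartan4 f y a b c d = cartan4 f y b a c d"
    by (simp only: pd_commute[OF open_S Ck_g assms, of a b])
  show "cartan4 f y a b c d = cartan4 f y a c b d" "cartan4 f y a b c d = cartan4 f y a b d c"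
    unfolding cartan4_def by (rule pd_cong[OF open_S assms], simp add: cartan_commute)+
qed

lemma cartan_up_commute: "y \<in> S \<Longrightarrow> cartan_up f y m b c = cartan_up f y m c b"
  unfolding cartan_up_def using cartan_commute by simp

lemma pd_g: "pd a (pd b (pd c f)) y = 2 * cartan f y a b c"
  by (simp add: cartan_def)

lemma pd_cartan: "pd a (\<lambda>z. cartan f z b c d) y = cartan4 f y a b c d"
  by (simp add: cartan4_def)

lemma g_gi:
  assumes "y \<in> S"
  shows "(\<Sum>b\<in>UNIV. g a b y * gi b c y) = kron a c" "(\<Sum>b\<in>UNIV. gi a b y * g b c y) = kron a c"
proof -
  have "(fmetric f y ** metric_inv f y) $ a $ c = kron a c" "(metric_inv f y ** fmetric f y) $ a $ c = kron a c"
    using matrix_inv_mul[OF invertible_fmetric[OF assms]] by (simp_all add: metric_inv_def mat_entry)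
  then show "(\<Sum>b\<in>UNIV. g a b y * gi b c y) = kron a c" "(\<Sum>b\<in>UNIV. gi a b y * g b c y) = kron a c"
    by (simp_all add: matrix_matrix_mult_def fmetric_def)
qed

lemma gi_commute:
  assumes "y \<in> S"
  shows "gi a b y = gi b a y"
proof -
  have "fmetric f y = transpose (fmetric f y)"
    using g_commute[OF assms] by (simp add: vec_eq_iff fmetric_def transpose_def)
  then have "fmetric f y ** transpose (metric_inv f y) = mat 1"
    using matrix_inv_mul(2)[OF invertible_fmetric[OF assms]]
    by (metis matrix_transpose_mul transpose_mat metric_inv_def)
  then have "metric_inv f y = transpose (metric_inv f y)"
    using matrix_inv_unique_right metric_inv_def by metis
  then have "gi a b y = transpose (metric_inv f y) $ a $ b" by (rule arg_cong)
  then show ?thesis by (simp add: transpose_def)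
qed

lemma lower_raise:
  assumes "y \<in> S"
  shows "(\<Sum>b\<in>UNIV. g a b y * (\<Sum>c\<in>UNIV. gi b c y * u c)) = u a"
proof -
  have "(\<Sum>b\<in>UNIV. g a b y * (\<Sum>c\<in>UNIV. gi b c y * u c)) = (\<Sum>b\<in>UNIV. \<Sum>c\<in>UNIV. g a b y * gi b c y * u c)"
    by (simp add: sum_distrib_left mult.assoc)
  also have "\<dots> = (\<Sum>c\<in>UNIV. (\<Sum>b\<in>UNIV. g a b y * gi b c y) * u c)"
    by (subst sum.swap) (simp add: sum_distrib_right)
  finally show ?thesis by (simp add: g_gi[OF assms])
qed

lemma raise_lower:
  assumes "y \<in> S"
  shows "(\<Sum>b\<in>UNIV. gi a b y * (\<Sum>c\<in>UNIV. g b c y * u c)) = u a"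
proof -
  have "(\<Sum>b\<in>UNIV. gi a b y * (\<Sum>c\<in>UNIV. g b c y * u c)) = (\<Sum>b\<in>UNIV. \<Sum>c\<in>UNIV. gi a b y * g b c y * u c)"
    by (simp add: sum_distrib_left mult.assoc)
  also have "\<dots> = (\<Sum>c\<in>UNIV. (\<Sum>b\<in>UNIV. gi a b y * g b c y) * u c)"
    by (subst sum.swap) (simp add: sum_distrib_right)
  finally show ?thesis by (simp add: g_gi[OF assms])
qed

lemma raise_pd: "y \<in> S \<Longrightarrow> (\<Sum>b\<in>UNIV. gi a b y * pd b f y) = y $ a"
  using raise_lower[of y a "\<lambda>b. y $ b"] euler by simp

lemma lower_cartan_up: "y \<in> S \<Longrightarrow> (\<Sum>m\<in>UNIV. g d m y * cartan_up f y m b c) = cartan f y d b c"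
  unfolding cartan_up_def by (rule lower_raise)

text \<open>Differentiating \<open>g_bc y^c = y_b\<close> produces \<open>g_ab\<close> on both
  sides, once from \<open>y^c\<close> and once from \<open>y_b\<close>.\<close>

lemma cartan_radial:
  assumes "y \<in> S"
  shows "(\<Sum>c\<in>UNIV. cartan f y a b c * y $ c) = 0"
proof -
  have "pd a (pd b f) y = pd a (\<lambda>z. \<Sum>c\<in>UNIV. g b c z * z $ c) y"
    by (rule pd_cong[OF open_S assms]) (simp add: euler)
  also have "\<dots> = 2 * (\<Sum>c\<in>UNIV. cartan f y a b c * y $ c) + g b a y"
    using assms by (subst pd_sum_mult) (auto simp: pd_g pd_vec_nth sum_distrib_left mult.assoc)
  finally show ?thesis using g_commute[OF assms] by simp
qed

text \<open>Differentiate \<open>C_bcd y^d = 0\<close>; the derivative that falls on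
  \<open>y^d\<close> gives the Cartan tensor, with a minus sign after solving.\<close>

lemma cartan4_radial:
  assumes "y \<in> S"
  shows "(\<Sum>d\<in>UNIV. cartan4 f y a b c d * y $ d) = - cartan f y a b c"
proof -
  have "0 = pd a (\<lambda>z. \<Sum>d\<in>UNIV. cartan f z b c d * z $ d) y"
    using pd_cong[OF open_S assms, of "\<lambda>z. \<Sum>d\<in>UNIV. cartan f z b c d * z $ d" "\<lambda>z. 0"]
    by (simp add: cartan_radial)
  also have "\<dots> = (\<Sum>d\<in>UNIV. cartan4 f y a b c d * y $ d) + cartan f y b c a"
    using assms by (subst pd_sum_mult) (auto simp: pd_cartan pd_vec_nth)
  finally show ?thesis using cartan_commute[OF assms] by (metis add_eq_0_iff2)
qed

text \<open>The derivative of the inverse metric is never computed: the identity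
  \<open>g_ds C^s_bc = C_dbc\<close> is differentiated instead, and the result is raised
  again.\<close>

lemma pd_cartan_up:
  assumes "y \<in> S"
  shows "pd a (\<lambda>z. cartan_up f z m b c) y
       = cartan4_up f y m a b c - 2 * (\<Sum>s\<in>UNIV. cartan_up f y m s a * cartan_up f y s b c)"
proof -
  have lowered: "(\<Sum>s\<in>UNIV. g d s y * pd a (\<lambda>z. cartan_up f z s b c) y)
      = cartan4 f y d a b c - 2 * (\<Sum>s\<in>UNIV. cartan f y d s a * cartan_up f y s b c)" for d
  proof -
    have "cartan4 f y a d b c = pd a (\<lambda>z. \<Sum>s\<in>UNIV. g d s z * cartan_up f z s b c) y"
      unfolding cartan4_def by (rule pd_cong[OF open_S assms]) (simp add: lower_cartan_up)
    also have "\<dots> = 2 * (\<Sum>s\<in>UNIV. cartan f y a d s * cartan_up f y s b c)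
        + (\<Sum>s\<in>UNIV. g d s y * pd a (\<lambda>z. cartan_up f z s b c) y)"
      using assms by (subst pd_sum_mult) (auto simp: pd_g sum_distrib_left mult.assoc)
    finally show ?thesis
      by (simp add: cartan_commute(1)[OF assms, of a d] cartan_commute(2)[OF assms, of d a] cartan4_commute(1)[OF assms, of a d])
  qed
  have "pd a (\<lambda>z. cartan_up f z m b c) y
      = (\<Sum>d\<in>UNIV. gi m d y * (\<Sum>s\<in>UNIV. g d s y * pd a (\<lambda>z. cartan_up f z s b c) y))"
    by (simp add: raise_lower[OF assms])
  also have "\<dots> = cartan4_up f y m a b c
      - (\<Sum>d\<in>UNIV. \<Sum>s\<in>UNIV. 2 * (gi m d y * cartan f y d s a * cartan_up f y s b c))"
    unfolding lowered by (simp add: cartan4_up_def right_diff_distrib sum_subtractf sum_distrib_left mult_ac)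
  also have "(\<Sum>d\<in>UNIV. \<Sum>s\<in>UNIV. 2 * (gi m d y * cartan f y d s a * cartan_up f y s b c))
      = 2 * (\<Sum>s\<in>UNIV. cartan_up f y m s a * cartan_up f y s b c)"
    by (subst sum.swap) (simp add: cartan_up_def[of f y m] sum_distrib_left sum_distrib_right)
  finally show ?thesis .
qed

end

section \<open>The third derivative contracted with \<open>y_r\<close>\<close>

lemma pd_diff:
  "f differentiable (at x) \<Longrightarrow> g differentiable (at x) \<Longrightarrow> pd i (\<lambda>x. f x - g x) x = pd i f x - pd i g x"
  unfolding frechet_derivative_works
  by (subst pd_eqI[OF has_derivative_diff]) (auto simp: pd_def)

context fibre
begin

text \<open>Moves the inverse metric contained in \<open>H\<close> onto the tensor contracted with
  \<open>H\<close>, where it is absorbed into \<open>y^m\<close> or a raised Cartan tensor.\<close>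

lemma raise_swap:
  assumes "y \<in> S"
  shows "(\<Sum>r\<in>UNIV. u r * (\<Sum>m\<in>UNIV. gi r m y * v m)) = (\<Sum>m\<in>UNIV. (\<Sum>r\<in>UNIV. gi m r y * u r) * v m)"
proof -
  have "(\<Sum>r\<in>UNIV. u r * (\<Sum>m\<in>UNIV. gi r m y * v m)) = (\<Sum>r\<in>UNIV. \<Sum>m\<in>UNIV. gi m r y * u r * v m)"
    by (simp add: sum_distrib_left mult_ac gi_commute[OF assms])
  also have "\<dots> = (\<Sum>m\<in>UNIV. (\<Sum>r\<in>UNIV. gi m r y * u r) * v m)"
    by (subst sum.swap) (simp add: sum_distrib_right)
  finally show ?thesis .
qed

text \<open>The third derivatives of \<open>H\<close> are only needed contracted with \<open>pd r f\<close>; moving derivatives off \<open>H\<close>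
  by the product rule, every remaining contraction of \<open>H\<close> with the metric or the Cartan tensors
  can be expressed by \<open>V\<close>, so that no third derivatives of the inverse metric occur.\<close>

lemma contracted_third_derivative:
  fixes V H :: "'n \<Rightarrow> real^'n \<Rightarrow> real"
  defines "T b c z \<equiv> \<Sum>m\<in>UNIV. cartan_up f z m b c * V m z"
  assumes V: "\<And>m. Ck_on 2 (V m) S"
    and H: "\<And>r z. z \<in> S \<Longrightarrow> H r z = (\<Sum>m\<in>UNIV. gi r m z * V m z)"
    and radial: "\<And>z. z \<in> S \<Longrightarrow> (\<Sum>m\<in>UNIV. z $ m * V m z) = 0"
    and y: "y \<in> S" and dH: "\<And>r. pd b (pd c (H r)) differentiable (at y)"
  shows "(\<Sum>r\<in>UNIV. pd r f y * pd a (pd b (pd c (H r))) y)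
    = - pd a (pd b (V c)) y - pd a (pd c (V b)) y - pd b (pd c (V a)) y
      + 2 * (pd a (T b c) y + pd b (T a c) y + pd c (T a b) y)
      - 2 * (\<Sum>m\<in>UNIV. cartan4_up f y m a b c * V m y)"
proof -
  have CkH: "Ck_on 2 (H r) S" for r
  proof (rule Ck_on_cong[OF open_S])
    show "Ck_on 2 (\<lambda>z. \<Sum>m\<in>UNIV. gi r m z * V m z) S"
      by (intro Ck_on_sum Ck_on_mult open_S Ck_gi V)
  qed (simp add: H)
  have CkT: "Ck_on 1 (T b c) S" for b c
    unfolding T_def by (intro Ck_on_sum Ck_on_mult open_S Ck_cartan_up Ck_on_mono[OF V]) simp
  have CkpdV: "Ck_on 1 (pd c (V m)) S" and CkpdH: "Ck_on 1 (pd c (H m)) S" for c m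
    using Ck_on_pd[of 1 "V m" S] Ck_on_pd[of 1 "H m" S] V CkH by (simp_all add: numeral_2_eq_2)
  have diff [simp]: "V m differentiable (at z)" "H m differentiable (at z)" "T i j differentiable (at z)"
    "pd i (V m) differentiable (at z)" "pd i (H m) differentiable (at z)" if "z \<in> S" for m i j z
    using Ck_on_imp_differentiable[OF open_S _ _ that] V[of m] CkH[of m] CkT[of i j] CkpdV[of i m] CkpdH[of i m]
    by (meson zero_less_numeral zero_less_one)+
  have T_commute: "T i j z = T j i z" if "z \<in> S" for i j z
    unfolding T_def using cartan_up_commute[OF that, of _ i j] by simp

  \<comment> \<open>These four contractions hold on all of \<open>S\<close> (or at each of its
    points), and none of their right-hand sides shows the inverse metric except through a raised
    index. They may therefore be differentiated.\<close>
  have yH: "(\<Sum>r\<in>UNIV. pd r f z * H r z) = 0" if "z \<in> S" for z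
    using that by (simp add: H raise_swap raise_pd radial)
  have gH: "(\<Sum>r\<in>UNIV. g i r z * H r z) = V i z" if "z \<in> S" for i z
    using that by (simp add: H lower_raise)
  have CH: "(\<Sum>r\<in>UNIV. cartan f z i j r * H r z) = T i j z" if "z \<in> S" for i j z
  proof -
    have "cartan f z i j r = cartan f z r i j" for r
      using cartan_commute[OF that] by metis
    then show ?thesis using that by (simp add: H raise_swap T_def cartan_up_def)
  qed
  have C4H: "(\<Sum>r\<in>UNIV. cartan4 f z i j l r * H r z) = (\<Sum>m\<in>UNIV. cartan4_up f z m i j l * V m z)"
    if "z \<in> S" for i j l z
  proof -
    have "cartan4 f z i j l r = cartan4 f z r i j l" for r
      using cartan4_commute[OF that] by metis
    then show ?thesis using that by (simp add: H raise_swap cartan4_up_def)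
  qed

  \<comment> \<open>The pattern of the following steps: differentiate a contraction identity by the
    product rule and solve for the sum in which the derivative falls on \<open>H\<close>.\<close>
  have y_dH: "(\<Sum>r\<in>UNIV. pd r f z * pd j (H r) z) = - V j z" if z: "z \<in> S" for j z
  proof -
    have "0 = pd j (\<lambda>z. \<Sum>r\<in>UNIV. pd r f z * H r z) z"
      using pd_cong[OF open_S z, of "\<lambda>z. \<Sum>r\<in>UNIV. pd r f z * H r z" "\<lambda>z. 0"] yH by simp
    also have "\<dots> = (\<Sum>r\<in>UNIV. g j r z * H r z) + (\<Sum>r\<in>UNIV. pd r f z * pd j (H r) z)"
      using z by (subst pd_sum_mult) auto
    finally show ?thesis using z by (simp add: gH)
  qed
  have g_dH: "(\<Sum>r\<in>UNIV. g i r z * pd j (H r) z) = pd j (V i) z - 2 * T i j z" if z: "z \<in> S" for i j z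
  proof -
    have "pd j (V i) z = pd j (\<lambda>z. \<Sum>r\<in>UNIV. g i r z * H r z) z"
      by (rule pd_cong[OF open_S z]) (simp add: gH)
    also have "\<dots> = 2 * (\<Sum>r\<in>UNIV. cartan f z j i r * H r z) + (\<Sum>r\<in>UNIV. g i r z * pd j (H r) z)"
      using z by (subst pd_sum_mult) (auto simp: pd_g sum_distrib_left mult.assoc)
    finally show ?thesis using z T_commute[OF z, of i j] by (simp add: CH)
  qed
  have C_dH: "(\<Sum>r\<in>UNIV. cartan f y i j r * pd l (H r) y)
      = pd l (T i j) y - (\<Sum>m\<in>UNIV. cartan4_up f y m l i j * V m y)" for i j l
  proof -
    have "pd l (T i j) y = pd l (\<lambda>z. \<Sum>r\<in>UNIV. cartan f z i j r * H r z) y"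
      by (rule pd_cong[OF open_S y]) (simp add: CH)
    also have "\<dots> = (\<Sum>r\<in>UNIV. cartan4 f y l i j r * H r y) + (\<Sum>r\<in>UNIV. cartan f y i j r * pd l (H r) y)"
      using y by (subst pd_sum_mult) (auto simp: pd_cartan)
    finally show ?thesis using y by (simp add: C4H)
  qed
  have y_ddH: "(\<Sum>r\<in>UNIV. pd r f z * pd b (pd c (H r)) z) = (- pd b (V c) z - pd c (V b) z) + 2 * T b c z"
    if z: "z \<in> S" for z
  proof -
    have "pd b (\<lambda>z. (- 1) * V c z) z = pd b (\<lambda>z. \<Sum>r\<in>UNIV. pd r f z * pd c (H r) z) z"
      by (rule pd_cong[OF open_S z]) (simp add: y_dH)
    moreover have "pd b (\<lambda>z. (- 1) * V c z) z = - pd b (V c) z"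
      using z by (subst pd_cmult) auto
    moreover have "pd b (\<lambda>z. \<Sum>r\<in>UNIV. pd r f z * pd c (H r) z) z
      = (\<Sum>r\<in>UNIV. g b r z * pd c (H r) z) + (\<Sum>r\<in>UNIV. pd r f z * pd b (pd c (H r)) z)"
      using z by (subst pd_sum_mult) auto
    ultimately show ?thesis using z by (simp add: g_dH)
  qed
  have g_ddH: "(\<Sum>r\<in>UNIV. g a r y * pd b (pd c (H r)) y)
      = pd b (pd c (V a)) y - 2 * pd b (T a c) y - 2 * (pd c (T a b) y - (\<Sum>m\<in>UNIV. cartan4_up f y m a b c * V m y))"
  proof -
    have "pd b (\<lambda>z. pd c (V a) z - 2 * T a c z) y = pd b (\<lambda>z. \<Sum>r\<in>UNIV. g a r z * pd c (H r) z) y"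
      by (rule pd_cong[OF open_S y]) (simp add: g_dH)
    also have "\<dots> = 2 * (\<Sum>r\<in>UNIV. cartan f y a b r * pd c (H r) y) + (\<Sum>r\<in>UNIV. g a r y * pd b (pd c (H r)) y)"
      using y by (subst pd_sum_mult) (auto simp: pd_g cartan_commute(1)[OF y, of b a] sum_distrib_left mult.assoc)
    moreover have "pd b (\<lambda>z. pd c (V a) z - 2 * T a c z) y = pd b (pd c (V a)) y - 2 * pd b (T a c) y"
      using y by (simp add: pd_diff pd_cmult)
    moreover have "cartan4_up f y m c a b = cartan4_up f y m a b c" for m
      unfolding cartan4_up_def using cartan4_commute[OF y] by (metis (no_types, lifting))
    ultimately show ?thesis by (simp add: C_dH)
  qed
  \<comment> \<open>The only appeal to \<open>dH\<close>: the sum itself is C1 by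
    \<open>y_ddH\<close>, but splitting its derivative by the product rule requires each factor to
    be differentiable at \<open>y\<close>.\<close>
  have Eq: "pd a (\<lambda>z. \<Sum>r\<in>UNIV. pd r f z * pd b (pd c (H r)) z) y
      = (\<Sum>r\<in>UNIV. g a r y * pd b (pd c (H r)) y) + (\<Sum>r\<in>UNIV. pd r f y * pd a (pd b (pd c (H r))) y)"
    using y dH by (subst pd_sum_mult) auto
  have "pd a (\<lambda>z. \<Sum>r\<in>UNIV. pd r f z * pd b (pd c (H r)) z) y
      = pd a (\<lambda>z. ((- 1) * pd b (V c) z - pd c (V b) z) + 2 * T b c z) y"
    by (rule pd_cong[OF open_S y]) (simp add: y_ddH)
  also have "\<dots> = - pd a (pd b (V c)) y - pd a (pd c (V b)) y + 2 * pd a (T b c) y"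
    using y by (subst pd_add; (subst pd_diff)?; (subst pd_cmult)?; (subst pd_cmult)?; simp)
  finally show ?thesis using Eq g_ddH by simp
qed

end

section \<open>Contraction with the commutation coefficients\<close>

lemma sum_rotate:
  fixes F :: "'a::finite \<Rightarrow> 'b::finite \<Rightarrow> 'c::finite \<Rightarrow> 'd::comm_monoid_add"
  shows "(\<Sum>i\<in>UNIV. \<Sum>j\<in>UNIV. \<Sum>k\<in>UNIV. F i j k) = (\<Sum>j\<in>UNIV. \<Sum>k\<in>UNIV. \<Sum>i\<in>UNIV. F i j k)"
  by (subst sum.swap, rule sum.cong, simp, subst sum.swap, simp)

definition contract :: "('n::finite \<Rightarrow> 'n \<Rightarrow> 'n \<Rightarrow> real) \<Rightarrow> ('n \<Rightarrow> 'n \<Rightarrow> 'n \<Rightarrow> real) \<Rightarrow> real" where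
  "contract K F = (\<Sum>e\<in>UNIV. \<Sum>m\<in>UNIV. \<Sum>n\<in>UNIV. K e m n * F e m n)"

lemma contract_add: "contract K (\<lambda>e m n. F e m n + G e m n) = contract K F + contract K G"
  by (simp add: contract_def distrib_left sum.distrib)

lemma contract_diff: "contract K (\<lambda>e m n. F e m n - G e m n) = contract K F - contract K G"
  by (simp add: contract_def right_diff_distrib sum_subtractf)

lemma contract_cmult: "contract K (\<lambda>e m n. s * F e m n) = s * contract K F"
  by (simp add: contract_def sum_distrib_left mult_ac)

context fibre
begin

text \<open>The vertical Cartan derivative of the Cartan tensor with its differentiation index
  raised, as \<open>raise_vcartan_deriv\<close> shows; it is written in the shape in which it
  emerges from the third derivative.\<close>

definition vcartan_deriv_up :: "real^'n \<Rightarrow> 'n \<Rightarrow> 'n \<Rightarrow> 'n \<Rightarrow> 'n \<Rightarrow> real" where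
  "vcartan_deriv_up y a b c m = cartan4_up f y m a b c - (\<Sum>s\<in>UNIV. cartan_up f y m s a * cartan_up f y s b c)
     - (\<Sum>s\<in>UNIV. cartan_up f y m s c * cartan_up f y s a b)
     - (\<Sum>s\<in>UNIV. cartan_up f y m s b * cartan_up f y s c a)"

text \<open>The covector \<open>V_m = c^e_mn y_e y^n\<close> is an explicit product whose
  derivatives are computed directly. In the sum over the three distributions of \<open>a\<close>,
  \<open>b\<close>, \<open>c\<close>, the terms of the form \<open>c^e_ij g_ke\<close> cancel in
  pairs by antisymmetry; what is left are the ten terms of the claim.\<close>

lemma third_derivative_contract:
  fixes K :: "'n \<Rightarrow> 'n \<Rightarrow> 'n \<Rightarrow> real" and H :: "'n \<Rightarrow> real^'n \<Rightarrow> real"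
  assumes K: "\<And>e m n. K e m n = - K e n m"
    and H: "\<And>r z. z \<in> S \<Longrightarrow> H r z = contract K (\<lambda>e m n. gi r m z * pd e f z * z $ n)"
    and y: "y \<in> S" and dH: "\<And>r. pd b (pd c (H r)) differentiable (at y)"
  shows "- 1/4 * (\<Sum>r\<in>UNIV. pd r f y * pd a (pd b (pd c (H r))) y) = - 1/2 * contract K (\<lambda>e m n.
     y $ m * cartan f y e b c * kron n a + y $ m * cartan f y e c a * kron n b + y $ m * cartan f y e a b * kron n c
     + cartan_up f y m b c * g e a y * y $ n + cartan_up f y m c a * g e b y * y $ n + cartan_up f y m a b * g e c y * y $ n
     + cartan_up f y m b c * pd e f y * kron n a + cartan_up f y m c a * pd e f y * kron n b
     + cartan_up f y m a b * pd e f y * kron n c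
     + 2 * vcartan_deriv_up y a b c m * pd e f y * y $ n)"
proof -
  define V where "V m z = (\<Sum>e\<in>UNIV. \<Sum>n\<in>UNIV. K e m n * (pd e f z * z $ n))" for m z
  have V: "Ck_on 2 (V m) S" for m
    unfolding V_def
    by (intro Ck_on_sum Ck_on_cmult Ck_on_mult open_S Ck_vec_nth Ck_on_mono[OF Ck_pd]) simp
  have VH: "H r z = (\<Sum>m\<in>UNIV. gi r m z * V m z)" if "z \<in> S" for r z
  proof -
    have "H r z = (\<Sum>e\<in>UNIV. \<Sum>m\<in>UNIV. \<Sum>n\<in>UNIV. gi r m z * (K e m n * (pd e f z * z $ n)))"
      using that by (simp add: H contract_def mult_ac)
    also have "\<dots> = (\<Sum>m\<in>UNIV. gi r m z * V m z)"
      by (subst sum.swap) (simp add: V_def sum_distrib_left)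
    finally show ?thesis .
  qed
  \<comment> \<open>For each \<open>e\<close>, the antisymmetric \<open>K e\<close> is contracted
    with the symmetric product \<open>z^m z^n\<close>.\<close>
  have radial: "(\<Sum>m\<in>UNIV. z $ m * V m z) = 0" for z
  proof -
    have "(\<Sum>m\<in>UNIV. \<Sum>n\<in>UNIV. K e m n * (z $ m * z $ n)) = 0" for e
    proof -
      have "(\<Sum>m\<in>UNIV. \<Sum>n\<in>UNIV. K e m n * (z $ m * z $ n)) = (\<Sum>m\<in>UNIV. \<Sum>n\<in>UNIV. K e n m * (z $ m * z $ n))"
        by (subst sum.swap) (simp add: mult_ac)
      also have "\<dots> = - (\<Sum>m\<in>UNIV. \<Sum>n\<in>UNIV. K e m n * (z $ m * z $ n))"
        by (subst K) (simp add: sum_negf)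
      finally show ?thesis by simp
    qed
    then have "0 = (\<Sum>e\<in>UNIV. pd e f z * (\<Sum>m\<in>UNIV. \<Sum>n\<in>UNIV. K e m n * (z $ m * z $ n)))"
      by simp
    also have "\<dots> = (\<Sum>m\<in>UNIV. z $ m * V m z)"
      unfolding V_def sum_distrib_left by (subst sum.swap) (simp add: mult_ac)
    finally show ?thesis by simp
  qed
  have dV: "pd i (V m) z = (\<Sum>e\<in>UNIV. \<Sum>n\<in>UNIV. K e m n * (g i e z * z $ n + pd e f z * kron n i))"
    if "z \<in> S" for i m z
    unfolding V_def using that
    by (simp add: pd_sum pd_cmult pd_mult pd_vec_nth differentiable_sum differentiable_mult)
  have ddV: "pd i (pd j (V m)) y = (\<Sum>e\<in>UNIV. \<Sum>n\<in>UNIV.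
      K e m n * (2 * cartan f y i j e * y $ n + g j e y * kron n i + g i e y * kron n j))" for i j m
  proof -
    have "pd i (pd j (V m)) y
        = pd i (\<lambda>z. \<Sum>e\<in>UNIV. \<Sum>n\<in>UNIV. K e m n * (g j e z * z $ n + pd e f z * kron n j)) y"
      by (rule pd_cong[OF open_S y]) (simp add: dV)
    also have "\<dots> = (\<Sum>e\<in>UNIV. \<Sum>n\<in>UNIV.
      K e m n * (2 * cartan f y i j e * y $ n + g j e y * kron n i + g i e y * kron n j))"
      using y by (simp add: pd_sum pd_cmult pd_mult pd_add pd_vec_nth pd_g differentiable_sum
          differentiable_mult differentiable_add mult.assoc)
    finally show ?thesis .
  qed
  \<comment> \<open>The Cartan term is brought to the shape with \<open>y^m\<close> in front by
    exchanging the antisymmetric indices, which accounts for the minus sign. The two metric terms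
    are kept apart for the cancellation.\<close>
  have ddV': "pd i (pd j (V l)) y = - 2 * contract K (\<lambda>e m n. y $ m * cartan f y e i j * kron n l)
      + (\<Sum>e\<in>UNIV. K e l i * g j e y) + (\<Sum>e\<in>UNIV. K e l j * g i e y)" for i j l
  proof -
    have "contract K (\<lambda>e m n. y $ m * cartan f y e i j * kron n l)
        = (\<Sum>e\<in>UNIV. \<Sum>m\<in>UNIV. K e m l * (y $ m * cartan f y e i j))"
      by (simp add: contract_def flip: mult.assoc)
    also have "\<dots> = - (\<Sum>e\<in>UNIV. \<Sum>n\<in>UNIV. K e l n * (cartan f y i j e * y $ n))"
    proof -
      have "cartan f y e i j = cartan f y i j e" for e
        using cartan_commute[OF y] by metis
      then show ?thesis by (subst K) (simp add: sum_negf mult_ac)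
    qed
    finally have *: "contract K (\<lambda>e m n. y $ m * cartan f y e i j * kron n l)
        = - (\<Sum>e\<in>UNIV. \<Sum>n\<in>UNIV. K e l n * (cartan f y i j e * y $ n))" .
    have "K e l n * (2 * cartan f y i j e * y $ n + g j e y * kron n i + g i e y * kron n j)
        = 2 * (K e l n * (cartan f y i j e * y $ n)) + K e l n * g j e y * kron n i + K e l n * g i e y * kron n j"
      for e n
      by (simp add: algebra_simps)
    then show ?thesis
      unfolding ddV * by (simp add: sum.distrib sum_distrib_left sum_negf)
  qed
  have CV: "(\<Sum>m\<in>UNIV. cartan_up f y m j l * pd i (V m) y)
      = contract K (\<lambda>e m n. cartan_up f y m j l * g e i y * y $ n)
        + contract K (\<lambda>e m n. cartan_up f y m j l * pd e f y * kron n i)" for i j l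
  proof -
    have "(\<Sum>m\<in>UNIV. cartan_up f y m j l * pd i (V m) y)
        = (\<Sum>m\<in>UNIV. \<Sum>e\<in>UNIV. \<Sum>n\<in>UNIV. K e m n
            * (cartan_up f y m j l * g e i y * y $ n + cartan_up f y m j l * pd e f y * kron n i))"
      using y by (simp add: dV g_commute[OF y, of i] sum_distrib_left algebra_simps)
    also have "\<dots> = contract K (\<lambda>e m n. cartan_up f y m j l * g e i y * y $ n
        + cartan_up f y m j l * pd e f y * kron n i)"
      unfolding contract_def by (subst sum.swap) simp
    finally show ?thesis by (simp add: contract_add)
  qed
  have BV: "(\<Sum>m\<in>UNIV. B m * V m y) = contract K (\<lambda>e m n. B m * pd e f y * y $ n)" for B
  proof -
    have "(\<Sum>m\<in>UNIV. B m * V m y) = (\<Sum>m\<in>UNIV. \<Sum>e\<in>UNIV. \<Sum>n\<in>UNIV. K e m n * (B m * pd e f y * y $ n))"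
      by (simp add: V_def sum_distrib_left mult_ac)
    then show ?thesis unfolding contract_def by (subst sum.swap) simp
  qed
  have dT: "pd i (\<lambda>z. \<Sum>m\<in>UNIV. cartan_up f z m j l * V m z) y
      = (\<Sum>m\<in>UNIV. cartan4_up f y m i j l * V m y)
        - 2 * (\<Sum>m\<in>UNIV. (\<Sum>s\<in>UNIV. cartan_up f y m s i * cartan_up f y s j l) * V m y)
        + (\<Sum>m\<in>UNIV. cartan_up f y m j l * pd i (V m) y)" for i j l
    using y Ck_on_imp_differentiable[OF open_S V]
    by (subst pd_sum_mult) (auto simp: pd_cartan_up left_diff_distrib sum_subtractf mult.assoc simp flip: sum_distrib_left)
  have sym4: "cartan4_up f y m b a c = cartan4_up f y m a b c"
    "cartan4_up f y m c a b = cartan4_up f y m a b c" for m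
    unfolding cartan4_up_def using cartan4_commute[OF y] by (metis (no_types, lifting))+
  \<comment> \<open>Pairs the six metric terms from \<open>ddV'\<close>: each combination occurs
    twice, with the antisymmetric indices exchanged.\<close>
  have cancel: "(\<Sum>e\<in>UNIV. K e i j * h e) = - (\<Sum>e\<in>UNIV. K e j i * h e)" for i j and h :: "'n \<Rightarrow> real"
    by (subst K) (simp add: sum_negf)
  have main: "(\<Sum>r\<in>UNIV. pd r f y * pd a (pd b (pd c (H r))) y)
    = - pd a (pd b (V c)) y - pd a (pd c (V b)) y - pd b (pd c (V a)) y
      + 2 * (pd a (\<lambda>z. \<Sum>m\<in>UNIV. cartan_up f z m b c * V m z) y
        + pd b (\<lambda>z. \<Sum>m\<in>UNIV. cartan_up f z m a c * V m z) y
        + pd c (\<lambda>z. \<Sum>m\<in>UNIV. cartan_up f z m a b * V m z) y)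
      - 2 * (\<Sum>m\<in>UNIV. cartan4_up f y m a b c * V m y)"
    by (rule contracted_third_derivative[OF V VH radial y dH])
  let ?c1 = "\<lambda>i j l. contract K (\<lambda>e m n. y $ m * cartan f y e i j * kron n l)"
  let ?c2 = "\<lambda>j l i. contract K (\<lambda>e m n. cartan_up f y m j l * g e i y * y $ n)
      + contract K (\<lambda>e m n. cartan_up f y m j l * pd e f y * kron n i)"
  let ?cc = "\<lambda>i j l. contract K (\<lambda>e m n. (\<Sum>s\<in>UNIV. cartan_up f y m s i * cartan_up f y s j l) * pd e f y * y $ n)"
  let ?c4 = "contract K (\<lambda>e m n. cartan4_up f y m a b c * pd e f y * y $ n)"
  \<comment> \<open>Each derivative of a \<open>T\<close> term contributes one fourth-order tensor
    and \<open>- 2\<close> times one quadratic term. Doubled and reduced by the final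
    \<open>- 2\<close>, they leave 4 times the tensor minus 4 times the quadratic terms.\<close>
  have "(\<Sum>r\<in>UNIV. pd r f y * pd a (pd b (pd c (H r))) y)
     = 2 * (?c1 a b c + ?c1 a c b + ?c1 b c a) + 2 * (?c2 b c a + ?c2 a c b + ?c2 a b c)
       + 4 * (?c4 - ?cc a b c - ?cc b a c - ?cc c a b)"
    unfolding main dT ddV' CV BV sym4
    using cancel[of c b "\<lambda>e. g a e y"] cancel[of a b "\<lambda>e. g c e y"] cancel[of a c "\<lambda>e. g b e y"]
    by (simp add: algebra_simps)
  moreover have "contract K (\<lambda>e m n. 2 * vcartan_deriv_up y a b c m * pd e f y * y $ n)
      = 2 * (?c4 - ?cc a b c - ?cc b a c - ?cc c a b)"
  proof -
    have "contract K (\<lambda>e m n. 2 * vcartan_deriv_up y a b c m * pd e f y * y $ n)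
      = contract K (\<lambda>e m n. 2 * (cartan4_up f y m a b c * pd e f y * y $ n
        - (\<Sum>s\<in>UNIV. cartan_up f y m s a * cartan_up f y s b c) * pd e f y * y $ n
        - (\<Sum>s\<in>UNIV. cartan_up f y m s b * cartan_up f y s a c) * pd e f y * y $ n
        - (\<Sum>s\<in>UNIV. cartan_up f y m s c * cartan_up f y s a b) * pd e f y * y $ n))"
      unfolding vcartan_deriv_up_def cartan_up_commute[OF y, of _ c a] by (simp add: algebra_simps)
    then show ?thesis unfolding contract_cmult contract_diff .
  qed
  moreover have "cartan f y e c a = cartan f y e a c" "cartan_up f y m c a = cartan_up f y m a c" for e m
    using cartan_commute(2)[OF y] cartan_up_commute[OF y] by auto
  ultimately show ?thesis unfolding contract_add by simp
qed

end

section \<open>Contraction with the coefficients \<open>k\<close>\<close>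

definition kcontract :: "('n::finite \<Rightarrow> 'n \<Rightarrow> 'n \<Rightarrow> real) \<Rightarrow> real^'n \<Rightarrow> ('n \<Rightarrow> 'n \<Rightarrow> real) \<Rightarrow> real" where
  "kcontract k y F = (\<Sum>m\<in>UNIV. \<Sum>n\<in>UNIV. \<Sum>e\<in>UNIV. k m n e * y $ e * F m n)"

lemma kcontract_add: "kcontract k y (\<lambda>m n. F m n + G m n) = kcontract k y F + kcontract k y G"
  by (simp add: kcontract_def distrib_left sum.distrib)

lemma kcontract_diff: "kcontract k y (\<lambda>m n. F m n - G m n) = kcontract k y F - kcontract k y G"
  by (simp add: kcontract_def right_diff_distrib sum_subtractf)

lemma kcontract_cmult: "kcontract k y (\<lambda>m n. s * F m n) = s * kcontract k y F"
  by (simp add: kcontract_def sum_distrib_left mult_ac)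

lemma kcontract_transpose:
  assumes "\<And>m n e. k m n e = - k n m e"
  shows "kcontract k y (\<lambda>m n. F n m) = - kcontract k y F"
proof -
  have "kcontract k y (\<lambda>m n. F n m) = (\<Sum>n\<in>UNIV. \<Sum>m\<in>UNIV. \<Sum>e\<in>UNIV. k m n e * y $ e * F n m)"
    unfolding kcontract_def by (rule sum.swap)
  also have "\<dots> = - kcontract k y F"
  proof -
    have "k m n e * y $ e * F n m = - (k n m e * y $ e * F n m)" for m n e
      by (simp add: assms[of m n e])
    then show ?thesis by (simp only: kcontract_def sum_negf)
  qed
  finally show ?thesis .
qed

text \<open>The reason why the brackets on \<open>m\<close> and \<open>n\<close> may be inserted or
  dropped under \<open>k_mne\<close>.\<close>

lemma kcontract_antisymm:
  assumes "\<And>m n e. k m n e = - k n m e"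
  shows "kcontract k y (antisymm F) = kcontract k y F"
proof -
  have "kcontract k y (antisymm F) = kcontract k y (\<lambda>m n. 1/2 * (F m n - F n m))"
    by (simp add: kcontract_def antisymm_def)
  also have "\<dots> = kcontract k y F"
    unfolding kcontract_cmult kcontract_diff kcontract_transpose[where k = k and F = F, OF assms] by simp
  finally show ?thesis .
qed

lemma comm_low_antisym:
  assumes "\<And>e m n. K e m n = - K e n m"
  shows "comm_low G K a m n = - comm_low G K a n m"
  unfolding comm_low_def by (subst assms) (simp add: sum_negf)

text \<open>Exchanging \<open>m\<close> and \<open>n\<close> interchanges the first two terms up to
  sign and reverses the third.\<close>

lemma kcoef_antisym:
  assumes "\<And>e m n. K e m n = - K e n m"
  shows "kcoef G K m n e = - kcoef G K n m e"
proof -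
  have anti: "comm_low G K a m n = - comm_low G K a n m" for a m n
    by (rule comm_low_antisym) (rule assms)
  show ?thesis
    unfolding kcoef_def using anti[of m n e] anti[of n e m] anti[of e m n] by (simp add: field_simps)
qed

context fibre
begin

text \<open>The three terms of \<open>k_mae\<close> yield the three kinds of term one by one: in
  \<open>c_mae\<close> the metric lowers the index of the Cartan tensor, in \<open>c_aem\<close> it
  stays as \<open>g_ea\<close>, and in \<open>c_ema\<close> Euler's relation turns
  \<open>g_de y^e\<close> into \<open>y_d\<close>.\<close>

lemma kcontract_cartan_up:
  assumes K: "\<And>e m n. K e m n = - K e n m" and y: "y \<in> S"
  shows "kcontract (kcoef (fmetric f y) K) y (\<lambda>m n. cartan_up f y m b c * kron n a)
    = - 1/2 * (contract K (\<lambda>e m n. y $ m * cartan f y e b c * kron n a)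
      + contract K (\<lambda>e m n. cartan_up f y m b c * g e a y * y $ n)
      + contract K (\<lambda>e m n. cartan_up f y m b c * pd e f y * kron n a))"
proof -
  let ?c = "comm_low (fmetric f y) K" and ?C = "cartan_up f y"
  have "kcontract (kcoef (fmetric f y) K) y (\<lambda>m n. ?C m b c * kron n a)
      = (\<Sum>m\<in>UNIV. \<Sum>e\<in>UNIV. \<Sum>n\<in>UNIV. kcoef (fmetric f y) K m n e * y $ e * ?C m b c * kron n a)"
    unfolding kcontract_def by (rule sum.cong[OF refl], subst sum.swap) (simp add: mult.assoc)
  also have "\<dots> = (\<Sum>m\<in>UNIV. \<Sum>e\<in>UNIV. kcoef (fmetric f y) K m a e * y $ e * ?C m b c)"
    by simp
  also have "\<dots> = 1/2 * ((\<Sum>m\<in>UNIV. \<Sum>e\<in>UNIV. ?c m a e * y $ e * ?C m b c)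
      + (\<Sum>m\<in>UNIV. \<Sum>e\<in>UNIV. ?c a e m * y $ e * ?C m b c)
      - (\<Sum>m\<in>UNIV. \<Sum>e\<in>UNIV. ?c e m a * y $ e * ?C m b c))"
    by (simp add: kcoef_def algebra_simps sum.distrib sum_subtractf add_divide_distrib
        diff_divide_distrib flip: sum_divide_distrib)
  also have "(\<Sum>m\<in>UNIV. \<Sum>e\<in>UNIV. ?c m a e * y $ e * ?C m b c)
      = - contract K (\<lambda>e m n. y $ m * cartan f y e b c * kron n a)"
  proof -
    have "(\<Sum>m\<in>UNIV. \<Sum>e\<in>UNIV. ?c m a e * y $ e * ?C m b c)
        = (\<Sum>m\<in>UNIV. \<Sum>e\<in>UNIV. \<Sum>d\<in>UNIV. K d a e * y $ e * (g d m y * ?C m b c))"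
      by (simp add: comm_low_def fmetric_def sum_distrib_left sum_distrib_right g_commute[OF y] mult_ac)
    also have "\<dots> = (\<Sum>e\<in>UNIV. \<Sum>d\<in>UNIV. K d a e * y $ e * cartan f y d b c)"
      by (subst sum_rotate) (simp add: lower_cartan_up[OF y] flip: sum_distrib_left)
    also have "\<dots> = (\<Sum>d\<in>UNIV. \<Sum>e\<in>UNIV. - (K d e a * (y $ e * cartan f y d b c)))"
      by (subst sum.swap, subst K) (simp add: mult.assoc)
    also have "\<dots> = - contract K (\<lambda>e m n. y $ m * cartan f y e b c * kron n a)"
      by (simp add: contract_def sum_negf flip: mult.assoc)
    finally show ?thesis .
  qed
  also have "(\<Sum>m\<in>UNIV. \<Sum>e\<in>UNIV. ?c a e m * y $ e * ?C m b c)
      = - contract K (\<lambda>e m n. ?C m b c * g e a y * y $ n)"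
  proof -
    have "(\<Sum>m\<in>UNIV. \<Sum>e\<in>UNIV. ?c a e m * y $ e * ?C m b c)
        = (\<Sum>m\<in>UNIV. \<Sum>e\<in>UNIV. \<Sum>d\<in>UNIV. - (K d m e * (?C m b c * g d a y * y $ e)))"
      unfolding comm_low_def
      by (subst K) (simp add: fmetric_def sum_distrib_left sum_distrib_right g_commute[OF y, of a]
          sum_negf mult_ac)
    also have "\<dots> = - contract K (\<lambda>e m n. ?C m b c * g e a y * y $ n)"
      unfolding contract_def by (subst (2) sum_rotate) (simp add: sum_negf)
    finally show ?thesis .
  qed
  also have "(\<Sum>m\<in>UNIV. \<Sum>e\<in>UNIV. ?c e m a * y $ e * ?C m b c)
      = contract K (\<lambda>e m n. ?C m b c * pd e f y * kron n a)"
  proof -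
    have "(\<Sum>m\<in>UNIV. \<Sum>e\<in>UNIV. ?c e m a * y $ e * ?C m b c)
        = (\<Sum>m\<in>UNIV. \<Sum>e\<in>UNIV. \<Sum>d\<in>UNIV. K d m a * ?C m b c * (g d e y * y $ e))"
      by (simp add: comm_low_def fmetric_def sum_distrib_left sum_distrib_right g_commute[OF y] mult_ac)
    also have "\<dots> = (\<Sum>m\<in>UNIV. \<Sum>d\<in>UNIV. \<Sum>e\<in>UNIV. K d m a * ?C m b c * (g d e y * y $ e))"
      by (rule sum.cong[OF refl], rule sum.swap)
    also have "\<dots> = (\<Sum>m\<in>UNIV. \<Sum>d\<in>UNIV. K d m a * ?C m b c * pd d f y)"
      by (simp add: euler[OF y] flip: sum_distrib_left)
    also have "\<dots> = contract K (\<lambda>e m n. ?C m b c * pd e f y * kron n a)"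
      by (subst sum.swap) (simp add: contract_def flip: mult.assoc)
    finally show ?thesis .
  qed
  finally show ?thesis by (simp add: algebra_simps)
qed

text \<open>Against \<open>y^n y^e\<close> the term \<open>c_mne\<close> vanishes by antisymmetry,
  while \<open>c_nem\<close> and \<open>- c_emn\<close> agree after renaming. So the factor
  \<open>1/2\<close> disappears, and Euler's relation gives \<open>y_e\<close>.\<close>

lemma kcontract_radial:
  assumes K: "\<And>e m n. K e m n = - K e n m" and y: "y \<in> S"
  shows "kcontract (kcoef (fmetric f y) K) y (\<lambda>m n. B m * y $ n)
    = - contract K (\<lambda>e m n. B m * pd e f y * y $ n)"
proof -
  let ?c = "comm_low (fmetric f y) K"
  have anti: "?c a m n = - ?c a n m" for a m n
    by (rule comm_low_antisym) (rule K)
  have zero: "(\<Sum>n\<in>UNIV. \<Sum>e\<in>UNIV. ?c m n e * y $ e * y $ n) = 0" for m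
  proof -
    have "(\<Sum>n\<in>UNIV. \<Sum>e\<in>UNIV. ?c m n e * y $ e * y $ n) = - (\<Sum>n\<in>UNIV. \<Sum>e\<in>UNIV. ?c m n e * y $ e * y $ n)"
      by (subst sum.swap, subst anti) (simp add: sum_negf mult_ac)
    then show ?thesis by simp
  qed
  have swap: "(\<Sum>n\<in>UNIV. \<Sum>e\<in>UNIV. ?c n e m * y $ e * y $ n) = - (\<Sum>n\<in>UNIV. \<Sum>e\<in>UNIV. ?c e m n * y $ e * y $ n)" for m
    by (subst sum.swap, subst anti) (simp add: sum_negf mult_ac)
  have "(\<Sum>n\<in>UNIV. \<Sum>e\<in>UNIV. kcoef (fmetric f y) K m n e * y $ e * y $ n)
      = 1/2 * ((\<Sum>n\<in>UNIV. \<Sum>e\<in>UNIV. ?c m n e * y $ e * y $ n)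
        + (\<Sum>n\<in>UNIV. \<Sum>e\<in>UNIV. ?c n e m * y $ e * y $ n)
        - (\<Sum>n\<in>UNIV. \<Sum>e\<in>UNIV. ?c e m n * y $ e * y $ n))" for m
    by (simp add: kcoef_def algebra_simps sum.distrib sum_subtractf add_divide_distrib
        diff_divide_distrib flip: sum_divide_distrib)
  then have "(\<Sum>n\<in>UNIV. \<Sum>e\<in>UNIV. kcoef (fmetric f y) K m n e * y $ e * y $ n)
      = - (\<Sum>n\<in>UNIV. \<Sum>e\<in>UNIV. ?c e m n * y $ e * y $ n)" for m
    by (simp add: zero swap)
  also have "(\<Sum>n\<in>UNIV. \<Sum>e\<in>UNIV. ?c e m n * y $ e * y $ n)
      = (\<Sum>d\<in>UNIV. \<Sum>n\<in>UNIV. K d m n * (pd d f y * y $ n))" for m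
  proof -
    have "(\<Sum>n\<in>UNIV. \<Sum>e\<in>UNIV. ?c e m n * y $ e * y $ n)
        = (\<Sum>n\<in>UNIV. \<Sum>e\<in>UNIV. \<Sum>d\<in>UNIV. K d m n * y $ n * (g d e y * y $ e))"
      by (simp add: comm_low_def fmetric_def sum_distrib_left sum_distrib_right g_commute[OF y] mult_ac)
    also have "\<dots> = (\<Sum>d\<in>UNIV. \<Sum>n\<in>UNIV. \<Sum>e\<in>UNIV. K d m n * y $ n * (g d e y * y $ e))"
      by (subst (2) sum_rotate) simp
    also have "\<dots> = (\<Sum>d\<in>UNIV. \<Sum>n\<in>UNIV. K d m n * y $ n * pd d f y)"
      unfolding sum_distrib_left[symmetric] euler[OF y] ..
    finally show ?thesis by (simp add: mult_ac)
  qed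
  finally have inner: "(\<Sum>n\<in>UNIV. \<Sum>e\<in>UNIV. kcoef (fmetric f y) K m n e * y $ e * y $ n)
      = - (\<Sum>d\<in>UNIV. \<Sum>n\<in>UNIV. K d m n * (pd d f y * y $ n))" for m .
  have "kcontract (kcoef (fmetric f y) K) y (\<lambda>m n. B m * y $ n)
      = (\<Sum>m\<in>UNIV. B m * (\<Sum>n\<in>UNIV. \<Sum>e\<in>UNIV. kcoef (fmetric f y) K m n e * y $ e * y $ n))"
    by (simp add: kcontract_def sum_distrib_left mult_ac)
  also have "\<dots> = - (\<Sum>m\<in>UNIV. \<Sum>d\<in>UNIV. \<Sum>n\<in>UNIV. K d m n * (B m * pd d f y * y $ n))"
    unfolding inner by (simp add: sum_distrib_left sum_negf mult_ac)
  also have "\<dots> = - contract K (\<lambda>e m n. B m * pd e f y * y $ n)"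
    unfolding contract_def by (subst sum.swap) simp
  finally show ?thesis .
qed

section \<open>The vertical Cartan derivative and the projection\<close>

lemma vcartan_deriv_commute:
  assumes "y \<in> S"
  shows "vcartan_deriv f y s p q r = vcartan_deriv f y s q p r" "vcartan_deriv f y s p q r = vcartan_deriv f y s p r q"
  unfolding vcartan_deriv_def pd_cartan
  by (simp_all add: cartan4_commute[OF assms] cartan_commute[OF assms])

text \<open>In every quadratic term the index contracted with \<open>y\<close> sits on a Cartan
  tensor, which kills the term; only \<open>cartan4_radial\<close> contributes.\<close>

lemma vcartan_deriv_radial:
  assumes y: "y \<in> S"
  shows "(\<Sum>r\<in>UNIV. vcartan_deriv f y s p q r * y $ r) = - cartan f y s p q"
proof -
  have C_up: "(\<Sum>r\<in>UNIV. cartan_up f y v s r * y $ r) = 0" for v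
  proof -
    have "(\<Sum>r\<in>UNIV. cartan_up f y v s r * y $ r) = (\<Sum>d\<in>UNIV. gi v d y * (\<Sum>r\<in>UNIV. cartan f y d s r * y $ r))"
      unfolding cartan_up_def sum_distrib_left sum_distrib_right by (subst sum.swap) (simp add: mult_ac)
    then show ?thesis by (simp add: cartan_radial[OF y])
  qed
  have contracted: "(\<Sum>r\<in>UNIV. (\<Sum>v\<in>UNIV. u v * w v r) * y $ r) = (\<Sum>v\<in>UNIV. u v * (\<Sum>r\<in>UNIV. w v r * y $ r))"
    "(\<Sum>r\<in>UNIV. (\<Sum>v\<in>UNIV. w v r * u v) * y $ r) = (\<Sum>v\<in>UNIV. u v * (\<Sum>r\<in>UNIV. w v r * y $ r))"
    for u :: "'n \<Rightarrow> real" and w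
    unfolding sum_distrib_left sum_distrib_right by (subst sum.swap, simp add: mult_ac)+
  show ?thesis
    unfolding vcartan_deriv_def pd_cartan left_diff_distrib sum_subtractf contracted
    by (simp add: cartan4_radial[OF y] cartan_radial[OF y] C_up)
qed

text \<open>Only the terms of first order in the radial part of the projection survive.\<close>

lemma hproj_vcartan_deriv:
  assumes y: "y \<in> S"
  defines "\<kappa> \<equiv> 1 / (2 * f y)"
  shows "(\<Sum>t\<in>UNIV. \<Sum>q\<in>UNIV. \<Sum>r\<in>UNIV. hproj f y t a * hproj f y q b * hproj f y r c * vcartan_deriv f y s t q r)
    = vcartan_deriv f y s a b c
      + \<kappa> * (pd a f y * cartan f y s b c + pd b f y * cartan f y s a c + pd c f y * cartan f y s a b)"
proof -
  let ?D = "vcartan_deriv f y s" and ?C = "cartan f y s"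
  \<comment> \<open>A projection subtracts \<kappa> times a contraction with \<open>y\<close>.
    Nothing relates \<kappa> to \<open>f y\<close> from here on, so the value at null vectors is
    covered.\<close>
  have h: "(\<Sum>r\<in>UNIV. hproj f y r c * u r) = u c - \<kappa> * pd c f y * (\<Sum>r\<in>UNIV. u r * y $ r)" for c u
    unfolding hproj_def \<kappa>_def[symmetric] left_diff_distrib sum_subtractf
    by (simp add: sum_distrib_left mult_ac)
  have rad: "(\<Sum>r\<in>UNIV. ?D t q r * y $ r) = - ?C t q" "(\<Sum>q\<in>UNIV. ?D t q r * y $ q) = - ?C t r"
    "(\<Sum>t\<in>UNIV. ?D t q r * y $ t) = - ?C q r" for t q r
  proof -
    have perm: "?D t q r = ?D t r q" "?D t q r = ?D q r t" for t q r
      using vcartan_deriv_commute[OF y] by metis+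
    show "(\<Sum>r\<in>UNIV. ?D t q r * y $ r) = - ?C t q" for t q
      by (rule vcartan_deriv_radial[OF y])
    then show "(\<Sum>q\<in>UNIV. ?D t q r * y $ q) = - ?C t r" "(\<Sum>t\<in>UNIV. ?D t q r * y $ t) = - ?C q r"
      by (simp_all only: perm(1)[of t _ r] perm(2)[of _ q r])
  qed
  have Crad: "(\<Sum>r\<in>UNIV. ?C t r * y $ r) = 0" "(\<Sum>t\<in>UNIV. ?C t r * y $ t) = 0" for t r
    using cartan_radial[OF y] by (simp, simp only: cartan_commute(2)[OF y, of s _ r])
  have "(\<Sum>t\<in>UNIV. \<Sum>q\<in>UNIV. \<Sum>r\<in>UNIV. hproj f y t a * hproj f y q b * hproj f y r c * ?D t q r)
      = (\<Sum>t\<in>UNIV. hproj f y t a * (\<Sum>q\<in>UNIV. hproj f y q b * (\<Sum>r\<in>UNIV. hproj f y r c * ?D t q r)))"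
    by (simp add: sum_distrib_left mult_ac)
  also have "\<dots> = (\<Sum>t\<in>UNIV. hproj f y t a * (\<Sum>q\<in>UNIV. hproj f y q b * (?D t q c + \<kappa> * pd c f y * ?C t q)))"
    by (simp add: h rad)
  also have "\<dots> = (\<Sum>t\<in>UNIV. hproj f y t a * (?D t b c + \<kappa> * pd c f y * ?C t b + \<kappa> * pd b f y * ?C t c))"
    by (simp add: h rad distrib_right sum.distrib mult.assoc Crad flip: sum_distrib_left)
  also have "\<dots> = ?D a b c + \<kappa> * pd c f y * ?C a b + \<kappa> * pd b f y * ?C a c + \<kappa> * pd a f y * ?C b c"
    by (simp add: h rad distrib_right sum.distrib mult.assoc Crad flip: sum_distrib_left)
  finally show ?thesis by (simp add: algebra_simps)
qed

text \<open>Raising the differentiation index turns each product of a raised and a lowered Cartan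
  tensor into a product of two raised ones, with the summation index changing level.\<close>

lemma raise_vcartan_deriv:
  assumes y: "y \<in> S"
  shows "(\<Sum>s\<in>UNIV. gi m s y * vcartan_deriv f y s a b c) = vcartan_deriv_up y a b c m"
proof -
  \<comment> \<open>The summation index occupies a different slot of the second factor in each of
    the three correction terms; \<open>u\<close> stands for that factor in any of these
    orders.\<close>
  have up: "(\<Sum>s\<in>UNIV. gi m s y * (\<Sum>v\<in>UNIV. cartan_up f y v s p * u v))
      = (\<Sum>v\<in>UNIV. cartan_up f y m v p * cartan_up f y v q r)"
    if u: "\<And>v. u v = cartan f y v q r" for p q r u
  proof -
    have "(\<Sum>v\<in>UNIV. cartan_up f y v s p * u v) = (\<Sum>d\<in>UNIV. cartan f y s d p * cartan_up f y d q r)" for s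
    proof -
      have "(\<Sum>v\<in>UNIV. cartan_up f y v s p * u v)
          = (\<Sum>v\<in>UNIV. (\<Sum>d\<in>UNIV. gi v d y * cartan f y d s p) * cartan f y v q r)"
        by (simp add: cartan_up_def u)
      also have "\<dots> = (\<Sum>d\<in>UNIV. cartan f y d s p * (\<Sum>v\<in>UNIV. gi d v y * cartan f y v q r))"
        by (simp add: raise_swap[OF y])
      finally show ?thesis
        by (simp add: cartan_commute(1)[OF y, of s] cartan_up_def)
    qed
    then have "(\<Sum>s\<in>UNIV. gi m s y * (\<Sum>v\<in>UNIV. cartan_up f y v s p * u v))
        = (\<Sum>s\<in>UNIV. gi m s y * (\<Sum>d\<in>UNIV. cartan f y s d p * cartan_up f y d q r))"
      by simp
    also have "\<dots> = (\<Sum>d\<in>UNIV. (\<Sum>s\<in>UNIV. gi m s y * cartan f y s d p) * cartan_up f y d q r)"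
      unfolding sum_distrib_left sum_distrib_right by (subst sum.swap) (simp add: mult_ac)
    finally show ?thesis by (simp add: cartan_up_def[of f y m])
  qed
  have "(\<Sum>s\<in>UNIV. gi m s y * vcartan_deriv f y s a b c)
      = cartan4_up f y m a b c
       - (\<Sum>s\<in>UNIV. gi m s y * (\<Sum>v\<in>UNIV. cartan_up f y v s a * cartan f y v b c))
       - (\<Sum>s\<in>UNIV. gi m s y * (\<Sum>v\<in>UNIV. cartan_up f y v s b * cartan f y a v c))
       - (\<Sum>s\<in>UNIV. gi m s y * (\<Sum>v\<in>UNIV. cartan_up f y v s c * cartan f y a b v))"
    by (simp add: vcartan_deriv_def pd_cartan cartan4_up_def right_diff_distrib sum_subtractf)
  also have "\<dots> = vcartan_deriv_up y a b c m"
    unfolding vcartan_deriv_up_def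
    by (subst up[of _ b c], simp, subst up[of _ c a], metis cartan_commute[OF y],
        subst up[of _ a b], metis cartan_commute[OF y]) simp
  finally show ?thesis .
qed

lemma hproj_up_eq:
  assumes y: "y \<in> S"
  shows "hproj_up f y m s = gi m s y - 1 / (2 * f y) * y $ m * y $ s"
proof -
  have "hproj_up f y m s = gi s m y - 1 / (2 * f y) * y $ m * (\<Sum>c\<in>UNIV. gi s c y * pd c f y)"
    unfolding hproj_up_def hproj_def right_diff_distrib sum_subtractf sum_distrib_left
    by (simp add: mult_ac)
  then show ?thesis
    unfolding raise_pd[OF y] by (simp add: gi_commute[OF y, of s m])
qed


text \<open>\<open>kcontract_cartan_up\<close>, for the three cyclic arrangements of
  \<open>a\<close>, \<open>b\<close>, \<open>c\<close>, absorbs the first nine terms. The tenth is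
  \<open>kcontract_radial\<close>, its factor 2 meeting the \<open>1/2\<close>.\<close>

lemma contract_eq_kcontract:
  assumes K: "\<And>e m n. K e m n = - K e n m" and y: "y \<in> S"
  shows "- 1/2 * contract K (\<lambda>e m n.
     y $ m * cartan f y e b c * kron n a + y $ m * cartan f y e c a * kron n b + y $ m * cartan f y e a b * kron n c
     + cartan_up f y m b c * g e a y * y $ n + cartan_up f y m c a * g e b y * y $ n + cartan_up f y m a b * g e c y * y $ n
     + cartan_up f y m b c * pd e f y * kron n a + cartan_up f y m c a * pd e f y * kron n b
     + cartan_up f y m a b * pd e f y * kron n c
     + 2 * vcartan_deriv_up y a b c m * pd e f y * y $ n)
   = kcontract (kcoef (fmetric f y) K) y (\<lambda>m n.
      cartan_up f y m b c * kron n a + cartan_up f y m c a * kron n b + cartan_up f y m a b * kron n c)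
     + kcontract (kcoef (fmetric f y) K) y (\<lambda>m n. vcartan_deriv_up y a b c m * y $ n)"
  unfolding contract_add kcontract_add kcontract_radial[OF K y] kcontract_cartan_up[OF K y]
  using contract_cmult[of K 2 "\<lambda>e m n. vcartan_deriv_up y a b c m * pd e f y * y $ n"]
  by (simp add: algebra_simps)

text \<open>Once the brackets are dropped, the projections in the Cartan terms leave
  \<open>- \<kappa> y_a C^m_bc y^n\<close> and its cyclic images. The projected vertical derivative
  produces the same terms with a plus sign, and its remaining radial part is proportional to
  \<open>y^m y^n\<close>, which \<open>k\<close> annihilates.\<close>

lemma kcontract_hproj:
  assumes K: "\<And>e m n. K e m n = - K e n m" and y: "y \<in> S"
  defines "k \<equiv> kcoef (fmetric f y) K"
  shows "kcontract k y (\<lambda>m n.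
      cartan_up f y m b c * kron n a + cartan_up f y m c a * kron n b + cartan_up f y m a b * kron n c)
     + kcontract k y (\<lambda>m n. vcartan_deriv_up y a b c m * y $ n)
   = kcontract k y (\<lambda>m n.
       antisymm (\<lambda>i j. cartan_up f y i b c * hproj f y j a) m n
     + antisymm (\<lambda>i j. cartan_up f y i c a * hproj f y j b) m n
     + antisymm (\<lambda>i j. cartan_up f y i a b * hproj f y j c) m n
     + (\<Sum>s\<in>UNIV. \<Sum>t\<in>UNIV. \<Sum>q\<in>UNIV. \<Sum>r\<in>UNIV. antisymm (\<lambda>i j. y $ i * hproj_up f y j s) n m
        * hproj f y t a * hproj f y q b * hproj f y r c * vcartan_deriv f y s t q r))"
proof -
  define \<kappa> where "\<kappa> = 1 / (2 * f y)"
  \<comment> \<open>The fully projected vertical derivative, in the form given by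
    \<open>hproj_vcartan_deriv\<close>.\<close>
  define Z where "Z s = vcartan_deriv f y s a b c
    + \<kappa> * (pd a f y * cartan f y s b c + pd b f y * cartan f y s a c + pd c f y * cartan f y s a b)" for s
  define \<zeta> where "\<zeta> = (\<Sum>s\<in>UNIV. y $ s * Z s)"
  have k: "k m n e = - k n m e" for m n e
    unfolding k_def by (rule kcoef_antisym) (rule K)
  \<comment> \<open>A symmetric tensor contracted with \<open>k\<close> equals its own negative;
    this disposes of the \<zeta> term below without evaluating \<zeta>.\<close>
  have "kcontract k y (\<lambda>m n. y $ n * y $ m) = - kcontract k y (\<lambda>m n. y $ n * y $ m)"
    using kcontract_transpose[where k = k and y = y and F = "\<lambda>m n. y $ n * y $ m", OF k]
    by (simp add: mult.commute)
  then have radial: "kcontract k y (\<lambda>m n. y $ n * y $ m) = 0" by simp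
  have raised: "(\<Sum>s\<in>UNIV. hproj_up f y m s * Z s) = vcartan_deriv_up y a b c m
      + \<kappa> * (pd a f y * cartan_up f y m b c + pd b f y * cartan_up f y m c a + pd c f y * cartan_up f y m a b)
      - \<kappa> * \<zeta> * y $ m" for m
  proof -
    have "(\<Sum>s\<in>UNIV. hproj_up f y m s * Z s) = (\<Sum>s\<in>UNIV. gi m s y * Z s) - \<kappa> * \<zeta> * y $ m"
      unfolding hproj_up_eq[OF y] \<kappa>_def[symmetric] \<zeta>_def left_diff_distrib sum_subtractf sum_distrib_left
        sum_distrib_right by (simp add: mult_ac)
    also have "(\<Sum>s\<in>UNIV. gi m s y * Z s) = (\<Sum>s\<in>UNIV. gi m s y * vcartan_deriv f y s a b c)
      + \<kappa> * (pd a f y * cartan_up f y m b c + pd b f y * cartan_up f y m a c + pd c f y * cartan_up f y m a b)"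
      unfolding Z_def cartan_up_def by (simp add: distrib_left sum.distrib sum_distrib_left mult_ac)
    finally show ?thesis
      by (simp add: raise_vcartan_deriv[OF y] cartan_up_commute[OF y, of m a c])
  qed
  have first: "kcontract k y (antisymm (\<lambda>i j. cartan_up f y i b' c' * hproj f y j a'))
      = kcontract k y (\<lambda>m n. cartan_up f y m b' c' * kron n a')
        - \<kappa> * pd a' f y * kcontract k y (\<lambda>m n. cartan_up f y m b' c' * y $ n)" for a' b' c'
  proof -
    have "kcontract k y (antisymm (\<lambda>i j. cartan_up f y i b' c' * hproj f y j a'))
      = kcontract k y (\<lambda>i j. cartan_up f y i b' c' * hproj f y j a')"
      by (rule kcontract_antisymm) (rule k)
    also have "\<dots> = kcontract k y (\<lambda>m n. cartan_up f y m b' c' * kron n a'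
        - \<kappa> * pd a' f y * (cartan_up f y m b' c' * y $ n))"
      unfolding hproj_def \<kappa>_def[symmetric] by (simp add: algebra_simps)
    finally show ?thesis unfolding kcontract_diff kcontract_cmult .
  qed
  \<comment> \<open>The bracket is evaluated at \<open>n m\<close>, so its leading term is
    \<open>y^n h^ms\<close>; rewriting it at \<open>m n\<close> lets the bracket be dropped as for
    the Cartan terms.\<close>
  have second: "(\<Sum>s\<in>UNIV. \<Sum>t\<in>UNIV. \<Sum>q\<in>UNIV. \<Sum>r\<in>UNIV. antisymm (\<lambda>i j. y $ i * hproj_up f y j s) n m
        * hproj f y t a * hproj f y q b * hproj f y r c * vcartan_deriv f y s t q r)
      = antisymm (\<lambda>m n. y $ n * (\<Sum>s\<in>UNIV. hproj_up f y m s * Z s)) m n" for m n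
  proof -
    have "(\<Sum>s\<in>UNIV. \<Sum>t\<in>UNIV. \<Sum>q\<in>UNIV. \<Sum>r\<in>UNIV. antisymm (\<lambda>i j. y $ i * hproj_up f y j s) n m
        * hproj f y t a * hproj f y q b * hproj f y r c * vcartan_deriv f y s t q r)
      = (\<Sum>s\<in>UNIV. antisymm (\<lambda>i j. y $ i * hproj_up f y j s) n m * Z s)"
      unfolding Z_def \<kappa>_def hproj_vcartan_deriv[OF y, symmetric]
      by (simp add: sum_distrib_left mult.assoc)
    also have "\<dots> = antisymm (\<lambda>m n. y $ n * (\<Sum>s\<in>UNIV. hproj_up f y m s * Z s)) m n"
      unfolding antisymm_def sum_distrib_left sum_subtractf[symmetric] by (simp add: algebra_simps)
    finally show ?thesis .
  qed
  have "kcontract k y (antisymm (\<lambda>m n. y $ n * (\<Sum>s\<in>UNIV. hproj_up f y m s * Z s)))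
     = kcontract k y (\<lambda>m n. y $ n * (\<Sum>s\<in>UNIV. hproj_up f y m s * Z s))"
    by (rule kcontract_antisymm) (rule k)
  also have "\<dots> = kcontract k y (\<lambda>m n. vcartan_deriv_up y a b c m * y $ n
      + \<kappa> * pd a f y * (cartan_up f y m b c * y $ n) + \<kappa> * pd b f y * (cartan_up f y m c a * y $ n)
      + \<kappa> * pd c f y * (cartan_up f y m a b * y $ n) - \<kappa> * \<zeta> * (y $ n * y $ m))"
    unfolding raised by (simp add: algebra_simps)
  also have "\<dots> = kcontract k y (\<lambda>m n. vcartan_deriv_up y a b c m * y $ n)
      + \<kappa> * pd a f y * kcontract k y (\<lambda>m n. cartan_up f y m b c * y $ n)
      + \<kappa> * pd b f y * kcontract k y (\<lambda>m n. cartan_up f y m c a * y $ n)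
      + \<kappa> * pd c f y * kcontract k y (\<lambda>m n. cartan_up f y m a b * y $ n)"
    unfolding kcontract_add kcontract_diff kcontract_cmult radial by simp
  finally show ?thesis
    unfolding kcontract_add second first by simp
qed

end

section \<open>The spray in a moving frame\<close>

lemma has_derivative_components:
  fixes u :: "'a::real_normed_vector \<Rightarrow> real^'n"
  assumes "\<And>i. ((\<lambda>x. u x $ i) has_derivative D i) (at x)"
  shows "(u has_derivative (\<lambda>v. \<chi> i. D i v)) (at x)"
proof -
  have eq: "(\<Sum>i\<in>UNIV. w $ i *\<^sub>R axis i 1) = w" for w :: "real^'n"
    using basis_expansion[of w] by (simp add: scalar_mult_eq_scaleR)
  have "((\<lambda>x. \<Sum>i\<in>UNIV. u x $ i *\<^sub>R axis i (1::real)) has_derivative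
      (\<lambda>v. \<Sum>i\<in>UNIV. (\<chi> i. D i v) $ i *\<^sub>R axis i 1)) (at x)"
    unfolding vec_lambda_beta by (intro has_derivative_sum has_derivative_scaleR_left assms)
  then show ?thesis unfolding eq .
qed

lemma pd_chain:
  fixes h :: "real^'n \<Rightarrow> real" and u :: "real^'m \<Rightarrow> real^'n"
  assumes h: "h differentiable (at (u x))" and u: "\<And>b. (\<lambda>x. u x $ b) differentiable (at x)"
  shows "pd i (\<lambda>x. h (u x)) x = (\<Sum>b\<in>UNIV. pd b h (u x) * pd i (\<lambda>x. u x $ b) x)"
    and "(\<lambda>x. h (u x)) differentiable (at x)"
proof -
  have "(u has_derivative (\<lambda>v. \<chi> b. frechet_derivative (\<lambda>x. u x $ b) (at x) v)) (at x)"
    using u by (intro has_derivative_components) (simp add: frechet_derivative_works)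
  then have d: "((\<lambda>x. h (u x)) has_derivative
      (\<lambda>v. frechet_derivative h (at (u x)) (\<chi> b. frechet_derivative (\<lambda>x. u x $ b) (at x) v))) (at x)"
    using h has_derivative_compose frechet_derivative_works by blast
  then show "(\<lambda>x. h (u x)) differentiable (at x)" unfolding differentiable_def by blast
  show "pd i (\<lambda>x. h (u x)) x = (\<Sum>b\<in>UNIV. pd b h (u x) * pd i (\<lambda>x. u x $ b) x)"
    unfolding pd_eqI[OF d] frechet_derivative_pd[OF h] by (simp add: pd_def mult.commute)
qed

lemma frechet_derivative_components:
  fixes u :: "'a::real_normed_vector \<Rightarrow> real^'n"
  assumes "\<And>i. (\<lambda>x. u x $ i) differentiable (at x)"
  shows "frechet_derivative u (at x) v $ i = frechet_derivative (\<lambda>x. u x $ i) (at x) v"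
proof -
  have "(u has_derivative (\<lambda>v. \<chi> i. frechet_derivative (\<lambda>x. u x $ i) (at x) v)) (at x)"
    using assms by (intro has_derivative_components) (simp add: frechet_derivative_works)
  then show ?thesis by (simp add: frechet_derivative_eqI)
qed

text \<open>Here \<open>M x\<close> maps coordinate components at \<open>x\<close> to frame components, \<open>E x\<close> is the vierbein.\<close>

locale moving_frame = fibre f S for f :: "real^'n::finite \<Rightarrow> real" and S +
  fixes M E :: "real^'n \<Rightarrow> real^'n^'n" and F :: "real^'n \<Rightarrow> real^'n \<Rightarrow> real"
    and N :: "(real^'n) set" and x0 :: "real^'n"
  assumes open_N: "open N" and x0: "x0 \<in> N"
    and C1_M: "Ck_on 1 (\<lambda>x. M x $ i $ j) N"
    and ME: "x \<in> N \<Longrightarrow> M x ** E x = mat 1"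
    and F_eq: "x \<in> N \<Longrightarrow> M x *v y \<in> S \<Longrightarrow> F x y = f (M x *v y)"
begin

text \<open>The derivatives of the dual basis, with the index of differentiation first.\<close>

definition dM where "dM \<rho> a \<sigma> = pd \<rho> (\<lambda>x. M x $ a $ \<sigma>) x0"

abbreviation cc where "cc \<equiv> commutation E x0"

lemma EM: "x \<in> N \<Longrightarrow> E x ** M x = mat 1"
  using ME matrix_left_right_inverse by blast

lemma matrix_inv_E: "x \<in> N \<Longrightarrow> matrix_inv (E x) = M x"
  by (rule matrix_inv_unique_right[OF EM])

lemma ME_sum: "x \<in> N \<Longrightarrow> (\<Sum>\<mu>\<in>UNIV. M x $ a $ \<mu> * E x $ \<mu> $ b) = kron a b"
  using arg_cong[OF ME, of x "\<lambda>A. A $ a $ b"] by (simp add: matrix_matrix_mult_def mat_entry)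

lemma ME_vec: "M x0 *v (E x0 *v z) = z" and EM_vec: "E x0 *v (M x0 *v z) = z"
  using ME[OF x0] EM[OF x0] by (simp_all add: matrix_vector_mul_assoc)

lemma C1_E: "Ck_on 1 (\<lambda>x. E x $ i $ j) N"
proof (rule Ck_on_cong[OF open_N])
  show "Ck_on 1 (\<lambda>x. matrix_inv (M x) $ i $ j) N"
    using ME EM by (intro Ck_on_matrix_inv open_N C1_M) (auto simp: invertible_def)
qed (simp add: matrix_inv_unique_right[OF ME])

lemma differentiable_M [simp]: "x \<in> N \<Longrightarrow> (\<lambda>x. M x $ i $ j) differentiable (at x)"
  and differentiable_E [simp]: "x \<in> N \<Longrightarrow> (\<lambda>x. E x $ i $ j) differentiable (at x)"
  using Ck_on_imp_differentiable[OF open_N C1_M] Ck_on_imp_differentiable[OF open_N C1_E] by auto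

text \<open>Differentiate \<open>M E = 1\<close>: derivatives of the vierbein, which occur in the
  brackets, are traded for derivatives of the dual basis, which occur in the spray.\<close>

lemma M_dE: "(\<Sum>\<mu>\<in>UNIV. M x0 $ a $ \<mu> * pd \<rho> (\<lambda>x. E x $ \<mu> $ n) x0) = - (\<Sum>\<mu>\<in>UNIV. dM \<rho> a \<mu> * E x0 $ \<mu> $ n)"
proof -
  have "0 = pd \<rho> (\<lambda>x. \<Sum>\<mu>\<in>UNIV. M x $ a $ \<mu> * E x $ \<mu> $ n) x0"
    using pd_cong[OF open_N x0, of "\<lambda>x. \<Sum>\<mu>\<in>UNIV. M x $ a $ \<mu> * E x $ \<mu> $ n" "\<lambda>x. kron a n" \<rho>]
    by (simp add: ME_sum)
  also have "\<dots> = (\<Sum>\<mu>\<in>UNIV. dM \<rho> a \<mu> * E x0 $ \<mu> $ n) + (\<Sum>\<mu>\<in>UNIV. M x0 $ a $ \<mu> * pd \<rho> (\<lambda>x. E x $ \<mu> $ n) x0)"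
    using x0 by (subst pd_sum_mult) (auto simp: dM_def)
  finally show ?thesis by simp
qed

lemma lie_bracket_frame:
  "lie_bracket (\<lambda>z. column d (E z)) (\<lambda>z. column n (E z)) x0 $ \<mu>
    = (\<Sum>\<rho>\<in>UNIV. E x0 $ \<rho> $ d * pd \<rho> (\<lambda>x. E x $ \<mu> $ n) x0)
      - (\<Sum>\<rho>\<in>UNIV. E x0 $ \<rho> $ n * pd \<rho> (\<lambda>x. E x $ \<mu> $ d) x0)"
proof -
  have "frechet_derivative (\<lambda>z. column d (E z)) (at x0) v $ \<mu> = (\<Sum>\<rho>\<in>UNIV. v $ \<rho> * pd \<rho> (\<lambda>x. E x $ \<mu> $ d) x0)" for d v
    using frechet_derivative_components[of "\<lambda>z. column d (E z)" x0 v \<mu>]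
      frechet_derivative_pd[of "\<lambda>x. E x $ \<mu> $ d" x0 v] x0 by (simp add: column_def)
  then show ?thesis by (simp add: lie_bracket_def column_def)
qed

text \<open>The Maurer-Cartan equation: the commutation coefficients are minus the exterior
  derivatives of the dual basis, evaluated on pairs of frame vectors.\<close>

lemma commutation_eq:
  "cc a d n = (\<Sum>\<rho>\<in>UNIV. E x0 $ \<rho> $ n * (\<Sum>\<mu>\<in>UNIV. dM \<rho> a \<mu> * E x0 $ \<mu> $ d))
    - (\<Sum>\<rho>\<in>UNIV. E x0 $ \<rho> $ d * (\<Sum>\<mu>\<in>UNIV. dM \<rho> a \<mu> * E x0 $ \<mu> $ n))"
proof -
  have half: "(\<Sum>\<mu>\<in>UNIV. M x0 $ a $ \<mu> * (\<Sum>\<rho>\<in>UNIV. E x0 $ \<rho> $ d * pd \<rho> (\<lambda>x. E x $ \<mu> $ n) x0))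
      = - (\<Sum>\<rho>\<in>UNIV. E x0 $ \<rho> $ d * (\<Sum>\<mu>\<in>UNIV. dM \<rho> a \<mu> * E x0 $ \<mu> $ n))" for d n
  proof -
    have "(\<Sum>\<mu>\<in>UNIV. M x0 $ a $ \<mu> * (\<Sum>\<rho>\<in>UNIV. E x0 $ \<rho> $ d * pd \<rho> (\<lambda>x. E x $ \<mu> $ n) x0))
        = (\<Sum>\<rho>\<in>UNIV. E x0 $ \<rho> $ d * (\<Sum>\<mu>\<in>UNIV. M x0 $ a $ \<mu> * pd \<rho> (\<lambda>x. E x $ \<mu> $ n) x0))"
      unfolding sum_distrib_left by (subst sum.swap) (simp add: mult_ac)
    then show ?thesis unfolding M_dE by (simp add: sum_negf)
  qed
  have "cc a d n = (\<Sum>\<mu>\<in>UNIV. M x0 $ a $ \<mu> * lie_bracket (\<lambda>z. column d (E z)) (\<lambda>z. column n (E z)) x0 $ \<mu>)"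
    by (simp add: commutation_def matrix_inv_E[OF x0] matrix_vector_mult_def)
  then show ?thesis
    unfolding lie_bracket_frame right_diff_distrib sum_subtractf half by simp
qed

lemma commutation_antisym: "cc a d n = - cc a n d"
  unfolding commutation_eq by simp

lemma continuous_M: "continuous_on N (\<lambda>x. M x *v w)"
  unfolding matrix_vector_mult_def
  by (intro continuous_on_vec_lambda continuous_on_sum continuous_on_mult continuous_on_const
      Ck_on_imp_continuous_on[OF C1_M])

lemma open_coord: "open {w. B *v w \<in> S}" for B :: "real^'n^'n"
  using open_vimage[OF open_S linear_continuous_on[OF matrix_vector_mul_bounded_linear[of B]]]
  by (simp add: vimage_def)

lemma pd_F:
  assumes "x \<in> N" "M x *v w \<in> S"
  shows "pd \<sigma> (F x) w = (\<Sum>a\<in>UNIV. M x $ a $ \<sigma> * pd a f (M x *v w))"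
proof -
  have "pd \<sigma> (F x) w = pd \<sigma> (\<lambda>w. f (M x *v w)) w"
    using assms by (intro pd_cong[OF open_coord[of "M x"]]) (auto simp: F_eq)
  then show ?thesis
    using Ck_on_imp_differentiable[OF open_S C4] assms by (simp add: pd_comp_matrix)
qed

text \<open>At fixed \<open>x0\<close> the passage to frame components is linear, so the Hessian
  becomes \<open>M^T g M\<close>, and its inverse is \<open>E g^-1 E^T\<close>.\<close>

lemma metric_inv_F:
  assumes z: "z \<in> S"
  shows "metric_inv (F x0) (E x0 *v z) $ \<mu> $ \<sigma> = (\<Sum>c\<in>UNIV. \<Sum>d\<in>UNIV. E x0 $ \<mu> $ c * gi c d z * E x0 $ \<sigma> $ d)"
proof -
  have "fmetric (F x0) (E x0 *v z) = transpose (M x0) ** (fmetric f z ** M x0)"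
  proof -
    have "pd \<sigma> (pd \<tau> (F x0)) (E x0 *v z) = (\<Sum>b\<in>UNIV. M x0 $ b $ \<tau> * (\<Sum>a\<in>UNIV. M x0 $ a $ \<sigma> * g a b z))" for \<sigma> \<tau>
    proof -
      have "pd \<sigma> (pd \<tau> (F x0)) (E x0 *v z) = pd \<sigma> (\<lambda>w. \<Sum>b\<in>UNIV. M x0 $ b $ \<tau> * pd b f (M x0 *v w)) (E x0 *v z)"
        using z by (intro pd_cong[OF open_coord[of "M x0"]]) (auto simp: ME_vec pd_F[OF x0])
      also have "\<dots> = (\<Sum>b\<in>UNIV. M x0 $ b $ \<tau> * (\<Sum>a\<in>UNIV. M x0 $ a $ \<sigma> * g a b z))"
      proof -
        have "(\<lambda>w. pd b f (M x0 *v w)) differentiable (at (E x0 *v z))" for b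
          using z by (intro differentiable_comp_matrix) (simp add: ME_vec)
        then show ?thesis using z by (simp add: pd_sum pd_cmult pd_comp_matrix ME_vec)
      qed
      finally show ?thesis .
    qed
    then show ?thesis
      unfolding fmetric_def
      by (simp add: vec_eq_iff matrix_matrix_mult_def transpose_def sum_distrib_left mult_ac)
         (subst sum.swap, simp add: mult_ac)
  qed
  moreover have "transpose (M x0) ** (fmetric f z ** M x0) ** (E x0 ** (metric_inv f z ** transpose (E x0))) = mat 1"
  proof -
    have "transpose (M x0) ** (fmetric f z ** M x0) ** (E x0 ** (metric_inv f z ** transpose (E x0)))
        = transpose (M x0) ** (fmetric f z ** ((M x0 ** E x0) ** (metric_inv f z ** transpose (E x0))))"
      by (simp add: matrix_mul_assoc)
    also have "\<dots> = transpose (M x0) ** ((fmetric f z ** metric_inv f z) ** transpose (E x0))"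
      by (simp add: ME[OF x0] matrix_mul_assoc)
    also have "\<dots> = transpose (E x0 ** M x0)"
      by (simp add: metric_inv_def matrix_inv_mul[OF invertible_fmetric[OF z]] matrix_transpose_mul)
    finally show ?thesis by (simp add: EM[OF x0] transpose_mat)
  qed
  ultimately have "metric_inv (F x0) (E x0 *v z) = E x0 ** (metric_inv f z ** transpose (E x0))"
    unfolding metric_inv_def by (metis matrix_inv_unique_right)
  then show ?thesis
    by (simp add: matrix_matrix_mult_def transpose_def sum_distrib_left mult_ac)
qed

end

context moving_frame
begin

definition H :: "'n \<Rightarrow> real^'n \<Rightarrow> real" where
  "H r z = contract cc (\<lambda>e m n. gi r m z * pd e f z * z $ n)"

text \<open>Only the part of the derivatives of the dual basis that is symmetric in the two
  coordinate indices enters here. Being quadratic in \<open>z\<close>, this contribution to the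
  spray is lost in the Berwald curvature.\<close>

definition Q :: "'n \<Rightarrow> real^'n \<Rightarrow> real" where
  "Q b z = (\<Sum>\<rho>\<in>UNIV. \<Sum>\<nu>\<in>UNIV. dM \<rho> b \<nu> * ((E x0 *v z) $ \<rho> * (E x0 *v z) $ \<nu>))"

text \<open>For fixed coordinate components \<open>w\<close>, the frame components stay in the cone
  for nearby \<open>x\<close>; hence the formula for \<open>F\<close> may be differentiated in
  \<open>x\<close>.\<close>

lemma open_horizontal: "open {x \<in> N. M x *v w \<in> S}"
  using continuous_open_preimage[OF continuous_M open_N open_S] by (simp add: vimage_def Int_def)

text \<open>Derivatives in \<open>x\<close> are taken at fixed coordinate components, so a function
  of the frame components varies only through \<open>M\<close>.\<close>

lemma pd_horizontal:
  assumes h: "h differentiable (at (M x0 *v w))"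
  shows "pd \<rho> (\<lambda>x. h (M x *v w)) x0 = (\<Sum>b\<in>UNIV. pd b h (M x0 *v w) * (\<Sum>\<nu>\<in>UNIV. dM \<rho> b \<nu> * w $ \<nu>))"
    and "(\<lambda>x. h (M x *v w)) differentiable (at x0)"
proof -
  have "(\<lambda>x. (M x *v w) $ b) differentiable (at x0)" for b
    using x0 by (auto simp: matrix_vector_mult_def intro!: differentiable_sum differentiable_mult)
  note * = pd_chain[of h "\<lambda>x. M x *v w" x0, OF h this]
  show "(\<lambda>x. h (M x *v w)) differentiable (at x0)" by (rule *(2))
  have "pd \<rho> (\<lambda>x. (M x *v w) $ b) x0 = (\<Sum>\<nu>\<in>UNIV. dM \<rho> b \<nu> * w $ \<nu>)" for b
    unfolding matrix_vector_mult_def using x0 by (simp add: pd_sum_mult dM_def)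
  then show "pd \<rho> (\<lambda>x. h (M x *v w)) x0 = (\<Sum>b\<in>UNIV. pd b h (M x0 *v w) * (\<Sum>\<nu>\<in>UNIV. dM \<rho> b \<nu> * w $ \<nu>))"
    unfolding *(1) by simp
qed

lemma pd_pd_F:
  assumes z: "M x0 *v w \<in> S"
  shows "pd \<rho> (\<lambda>x. pd \<sigma> (F x) w) x0 = (\<Sum>a\<in>UNIV. dM \<rho> a \<sigma> * pd a f (M x0 *v w))
    + (\<Sum>a\<in>UNIV. M x0 $ a $ \<sigma> * (\<Sum>b\<in>UNIV. g b a (M x0 *v w) * (\<Sum>\<nu>\<in>UNIV. dM \<rho> b \<nu> * w $ \<nu>)))"
proof -
  have "pd \<rho> (\<lambda>x. pd \<sigma> (F x) w) x0 = pd \<rho> (\<lambda>x. \<Sum>a\<in>UNIV. M x $ a $ \<sigma> * pd a f (M x *v w)) x0"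
    using z x0 by (intro pd_cong[OF open_horizontal[of w]]) (auto simp: pd_F)
  also have "\<dots> = (\<Sum>a\<in>UNIV. dM \<rho> a \<sigma> * pd a f (M x0 *v w))
      + (\<Sum>a\<in>UNIV. M x0 $ a $ \<sigma> * pd \<rho> (\<lambda>x. pd a f (M x *v w)) x0)"
    using z x0 pd_horizontal(2)[of "pd _ f" w] by (subst pd_sum_mult) (auto simp: dM_def)
  finally show ?thesis using z by (simp add: pd_horizontal(1)[of "pd _ f" w])
qed

lemma pd_F_horizontal:
  assumes z: "M x0 *v w \<in> S"
  shows "pd \<sigma> (\<lambda>x. F x w) x0 = (\<Sum>b\<in>UNIV. pd b f (M x0 *v w) * (\<Sum>\<nu>\<in>UNIV. dM \<sigma> b \<nu> * w $ \<nu>))"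
proof -
  have "pd \<sigma> (\<lambda>x. F x w) x0 = pd \<sigma> (\<lambda>x. f (M x *v w)) x0"
    using z x0 by (intro pd_cong[OF open_horizontal[of w]]) (auto simp: F_eq)
  then show ?thesis
    using pd_horizontal(1)[of f w] Ck_on_imp_differentiable[OF open_S C4 _ z] by simp
qed

text \<open>The chain rule produces three terms. The one with the Hessian gives \<open>Q\<close>;
  the other two differ only in which coordinate index of \<open>dM\<close> meets \<open>w\<close>,
  so that their difference is a commutation coefficient.\<close>

lemma spray_bracket:
  assumes z: "z \<in> S"
  defines "w \<equiv> E x0 *v z"
  shows "(\<Sum>\<sigma>\<in>UNIV. E x0 $ \<sigma> $ d *
      ((\<Sum>\<rho>\<in>UNIV. pd \<rho> (\<lambda>x. pd \<sigma> (F x) w) x0 * w $ \<rho>) - pd \<sigma> (\<lambda>x. F x w) x0))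
    = (\<Sum>b\<in>UNIV. g d b z * Q b z) + (\<Sum>a\<in>UNIV. pd a f z * (\<Sum>n\<in>UNIV. cc a d n * z $ n))"
proof -
  have Mw: "M x0 *v w = z" by (simp add: w_def ME_vec)
  have wE: "w $ \<rho> = (\<Sum>n\<in>UNIV. E x0 $ \<rho> $ n * z $ n)" for \<rho>
    by (simp add: w_def matrix_vector_mult_def)
  \<comment> \<open>\<open>A\<close> contracts \<open>w\<close> with the index of differentiation of
    \<open>dM\<close>, and \<open>B\<close> contracts it with the index of the covector.\<close>
  define A where "A \<sigma> a = (\<Sum>\<rho>\<in>UNIV. dM \<rho> a \<sigma> * w $ \<rho>)" for \<sigma> a
  define B where "B \<sigma> a = (\<Sum>\<nu>\<in>UNIV. dM \<sigma> a \<nu> * w $ \<nu>)" for \<sigma> a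
  have first: "(\<Sum>\<rho>\<in>UNIV. pd \<rho> (\<lambda>x. pd \<sigma> (F x) w) x0 * w $ \<rho>)
      = (\<Sum>a\<in>UNIV. pd a f z * A \<sigma> a) + (\<Sum>a\<in>UNIV. M x0 $ a $ \<sigma> * (\<Sum>b\<in>UNIV. g a b z * Q b z))" for \<sigma>
  proof -
    have "(\<Sum>\<rho>\<in>UNIV. (\<Sum>a\<in>UNIV. dM \<rho> a \<sigma> * pd a f z) * w $ \<rho>) = (\<Sum>a\<in>UNIV. pd a f z * A \<sigma> a)"
      unfolding A_def sum_distrib_left sum_distrib_right by (subst sum.swap) (simp add: mult_ac)
    moreover have "(\<Sum>\<rho>\<in>UNIV. (\<Sum>a\<in>UNIV. M x0 $ a $ \<sigma> * (\<Sum>b\<in>UNIV. g b a z * B \<rho> b)) * w $ \<rho>)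
        = (\<Sum>a\<in>UNIV. M x0 $ a $ \<sigma> * (\<Sum>b\<in>UNIV. g a b z * Q b z))"
    proof -
      have Qw: "Q b z = (\<Sum>\<rho>\<in>UNIV. B \<rho> b * w $ \<rho>)" for b
        unfolding Q_def B_def w_def[symmetric] sum_distrib_right by (simp add: mult_ac)
      have "(\<Sum>\<rho>\<in>UNIV. (\<Sum>a\<in>UNIV. M x0 $ a $ \<sigma> * (\<Sum>b\<in>UNIV. g b a z * B \<rho> b)) * w $ \<rho>)
          = (\<Sum>\<rho>\<in>UNIV. \<Sum>a\<in>UNIV. \<Sum>b\<in>UNIV. M x0 $ a $ \<sigma> * (g a b z * (B \<rho> b * w $ \<rho>)))"
        by (simp add: sum_distrib_left sum_distrib_right mult_ac g_commute[OF z])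
      also have "\<dots> = (\<Sum>a\<in>UNIV. M x0 $ a $ \<sigma> * (\<Sum>b\<in>UNIV. g a b z * Q b z))"
        unfolding Qw by (subst sum_rotate) (simp add: sum_distrib_left)
      finally show ?thesis .
    qed
    ultimately show ?thesis
      using pd_pd_F[of w] z by (simp add: Mw B_def distrib_right sum.distrib)
  qed
  have second: "pd \<sigma> (\<lambda>x. F x w) x0 = (\<Sum>a\<in>UNIV. pd a f z * B \<sigma> a)" for \<sigma>
    using pd_F_horizontal[of w \<sigma>] z by (simp add: Mw B_def)
  have cc: "(\<Sum>n\<in>UNIV. cc a d n * z $ n) = (\<Sum>\<sigma>\<in>UNIV. E x0 $ \<sigma> $ d * (A \<sigma> a - B \<sigma> a))" for a
  proof -
    have "(\<Sum>n\<in>UNIV. (\<Sum>\<rho>\<in>UNIV. E x0 $ \<rho> $ n * (\<Sum>\<mu>\<in>UNIV. dM \<rho> a \<mu> * E x0 $ \<mu> $ d)) * z $ n)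
        = (\<Sum>\<rho>\<in>UNIV. w $ \<rho> * (\<Sum>\<mu>\<in>UNIV. dM \<rho> a \<mu> * E x0 $ \<mu> $ d))"
      unfolding wE sum_distrib_right by (subst sum.swap) (simp add: mult_ac)
    also have "\<dots> = (\<Sum>\<sigma>\<in>UNIV. E x0 $ \<sigma> $ d * A \<sigma> a)"
      unfolding A_def sum_distrib_left by (subst sum.swap) (simp add: mult_ac)
    finally have 1: "(\<Sum>n\<in>UNIV. (\<Sum>\<rho>\<in>UNIV. E x0 $ \<rho> $ n * (\<Sum>\<mu>\<in>UNIV. dM \<rho> a \<mu> * E x0 $ \<mu> $ d)) * z $ n)
        = (\<Sum>\<sigma>\<in>UNIV. E x0 $ \<sigma> $ d * A \<sigma> a)" .
    have "(\<Sum>n\<in>UNIV. (\<Sum>\<mu>\<in>UNIV. dM \<rho> a \<mu> * E x0 $ \<mu> $ n) * z $ n) = B \<rho> a" for \<rho>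
      unfolding B_def wE sum_distrib_right sum_distrib_left by (subst sum.swap) (simp add: mult_ac)
    moreover have "(\<Sum>n\<in>UNIV. (\<Sum>\<rho>\<in>UNIV. E x0 $ \<rho> $ d * (\<Sum>\<mu>\<in>UNIV. dM \<rho> a \<mu> * E x0 $ \<mu> $ n)) * z $ n)
        = (\<Sum>\<rho>\<in>UNIV. E x0 $ \<rho> $ d * (\<Sum>n\<in>UNIV. (\<Sum>\<mu>\<in>UNIV. dM \<rho> a \<mu> * E x0 $ \<mu> $ n) * z $ n))"
      unfolding sum_distrib_left[of "E x0 $ _ $ d"] sum_distrib_right[of _ _ "z $ _"]
      by (subst sum.swap) (simp add: mult_ac sum_distrib_left sum_distrib_right)
    ultimately have 2: "(\<Sum>n\<in>UNIV. (\<Sum>\<rho>\<in>UNIV. E x0 $ \<rho> $ d * (\<Sum>\<mu>\<in>UNIV. dM \<rho> a \<mu> * E x0 $ \<mu> $ n)) * z $ n)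
        = (\<Sum>\<sigma>\<in>UNIV. E x0 $ \<sigma> $ d * B \<sigma> a)" by simp
    show ?thesis
      unfolding commutation_eq left_diff_distrib right_diff_distrib sum_subtractf 1 2 ..
  qed
  have M_part: "(\<Sum>\<sigma>\<in>UNIV. E x0 $ \<sigma> $ d * (\<Sum>a\<in>UNIV. M x0 $ a $ \<sigma> * u a)) = u d" for u
  proof -
    have "(\<Sum>\<sigma>\<in>UNIV. E x0 $ \<sigma> $ d * (\<Sum>a\<in>UNIV. M x0 $ a $ \<sigma> * u a))
        = (\<Sum>a\<in>UNIV. (\<Sum>\<sigma>\<in>UNIV. M x0 $ a $ \<sigma> * E x0 $ \<sigma> $ d) * u a)"
      unfolding sum_distrib_left sum_distrib_right by (subst sum.swap) (simp add: mult_ac)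
    then show ?thesis by (simp add: ME_sum[OF x0])
  qed
  have f_part: "(\<Sum>\<sigma>\<in>UNIV. E x0 $ \<sigma> $ d * ((\<Sum>a\<in>UNIV. pd a f z * A \<sigma> a) - (\<Sum>a\<in>UNIV. pd a f z * B \<sigma> a)))
      = (\<Sum>a\<in>UNIV. pd a f z * (\<Sum>n\<in>UNIV. cc a d n * z $ n))"
    unfolding cc sum_subtractf[symmetric] right_diff_distrib[symmetric] sum_distrib_left
    by (subst sum.swap) (simp add: mult_ac)
  have "E x0 $ \<sigma> $ d * ((\<Sum>\<rho>\<in>UNIV. pd \<rho> (\<lambda>x. pd \<sigma> (F x) w) x0 * w $ \<rho>) - pd \<sigma> (\<lambda>x. F x w) x0)
     = E x0 $ \<sigma> $ d * (\<Sum>a\<in>UNIV. M x0 $ a $ \<sigma> * (\<Sum>b\<in>UNIV. g a b z * Q b z))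
      + E x0 $ \<sigma> $ d * ((\<Sum>a\<in>UNIV. pd a f z * A \<sigma> a) - (\<Sum>a\<in>UNIV. pd a f z * B \<sigma> a))" for \<sigma>
    unfolding first second by (simp add: distrib_left right_diff_distrib)
  then show ?thesis by (simp only: sum.distrib M_part f_part)
qed

text \<open>The inverse metric cancels the metric in front of \<open>Q\<close> and turns the
  commutator term into \<open>H\<close>; the remaining \<open>E\<close> converts the frame index to
  a coordinate index.\<close>

lemma spray_frame:
  assumes z: "z \<in> S"
  shows "spray F x0 \<mu> (E x0 *v z) = (\<Sum>c\<in>UNIV. 1/2 * E x0 $ \<mu> $ c * (Q c z + H c z))"
proof -
  define w where "w = E x0 *v z"
  define B where "B \<sigma> = (\<Sum>\<rho>\<in>UNIV. pd \<rho> (\<lambda>x. pd \<sigma> (F x) w) x0 * w $ \<rho>) - pd \<sigma> (\<lambda>x. F x w) x0" for \<sigma>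
  have "spray F x0 \<mu> w = 1/2 * (\<Sum>\<sigma>\<in>UNIV. \<Sum>c\<in>UNIV. \<Sum>d\<in>UNIV. E x0 $ \<mu> $ c * (gi c d z * (E x0 $ \<sigma> $ d * B \<sigma>)))"
    unfolding spray_def B_def[symmetric] unfolding w_def metric_inv_F[OF z] by (simp add: sum_distrib_left sum_distrib_right mult_ac)
  also have "\<dots> = 1/2 * (\<Sum>c\<in>UNIV. E x0 $ \<mu> $ c * (\<Sum>d\<in>UNIV. gi c d z * (\<Sum>\<sigma>\<in>UNIV. E x0 $ \<sigma> $ d * B \<sigma>)))"
    by (subst sum_rotate) (simp add: sum_distrib_left)
  also have "(\<lambda>d. \<Sum>\<sigma>\<in>UNIV. E x0 $ \<sigma> $ d * B \<sigma>) = (\<lambda>d. (\<Sum>b\<in>UNIV. g d b z * Q b z)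
      + (\<Sum>a\<in>UNIV. pd a f z * (\<Sum>n\<in>UNIV. cc a d n * z $ n)))"
    unfolding B_def w_def spray_bracket[OF z] ..
  also have "(\<lambda>c. \<Sum>d\<in>UNIV. gi c d z * ((\<Sum>b\<in>UNIV. g d b z * Q b z)
      + (\<Sum>a\<in>UNIV. pd a f z * (\<Sum>n\<in>UNIV. cc a d n * z $ n)))) = (\<lambda>c. Q c z + H c z)"
  proof
    fix c
    have "(\<Sum>d\<in>UNIV. gi c d z * (\<Sum>a\<in>UNIV. pd a f z * (\<Sum>n\<in>UNIV. cc a d n * z $ n))) = H c z"
      unfolding H_def contract_def sum_distrib_left by (subst sum.swap) (simp add: mult_ac)
    then show "(\<Sum>d\<in>UNIV. gi c d z * ((\<Sum>b\<in>UNIV. g d b z * Q b z)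
      + (\<Sum>a\<in>UNIV. pd a f z * (\<Sum>n\<in>UNIV. cc a d n * z $ n)))) = Q c z + H c z"
      by (simp add: distrib_left sum.distrib raise_lower[OF z])
  qed
  finally show ?thesis by (simp add: w_def sum_distrib_left mult.assoc)
qed

end

section \<open>Third derivatives and linear changes of coordinates\<close>

lemma differentiable_lincomb:
  fixes u :: "'i \<Rightarrow> 'a::real_normed_vector \<Rightarrow> real"
  assumes "\<And>r. r \<in> I \<Longrightarrow> u r differentiable (at x)"
  shows "(\<lambda>x. \<Sum>r\<in>I. c r * u r x) differentiable (at x)"
  using assms by (cases "finite I") (auto intro!: differentiable_sum differentiable_mult)

lemma pd_lincomb:
  assumes "\<And>r. r \<in> I \<Longrightarrow> u r differentiable (at x)"
  shows "pd i (\<lambda>x. \<Sum>r\<in>I. c r * u r x) x = (\<Sum>r\<in>I. c r * pd i (u r) x)"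
  using assms by (subst pd_sum) (auto intro!: differentiable_mult simp: pd_cmult)

lemma pd2_lincomb:
  assumes S: "open S" and u: "\<And>r. r \<in> I \<Longrightarrow> Ck_on 2 (u r) S"
    and eq: "\<And>z. z \<in> S \<Longrightarrow> h z = (\<Sum>r\<in>I. c r * u r z)" and y: "y \<in> S"
  shows "pd j (pd k h) y = (\<Sum>r\<in>I. c r * pd j (pd k (u r)) y)"
proof -
  have d: "u r differentiable (at z)" "pd i (u r) differentiable (at z)" if "r \<in> I" "z \<in> S" for r i z
    using Ck_on_imp_differentiable[OF S u[OF that(1)]] Ck_on_pd[of 1 "u r" S i] u[OF that(1)] that
      Ck_on_imp_differentiable[OF S, of 1 "pd i (u r)"] by (simp_all add: numeral_2_eq_2 del: Ck_on.simps)
  have "pd k h z = (\<Sum>r\<in>I. c r * pd k (u r) z)" if "z \<in> S" for z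
    using pd_cong[OF S that eq] pd_lincomb[of I u z] d that by simp
  from pd_cong[OF S y this] show ?thesis
    using pd_lincomb[of I "\<lambda>r. pd k (u r)" y] d y by simp
qed

text \<open>Class C2 gives the second derivatives a meaning near \<open>y\<close>; their
  differentiability is assumed at \<open>y\<close> alone. This suits functions whose third
  derivatives exist only at the point considered.\<close>

lemma pd3_lincomb:
  assumes S: "open S" and u: "\<And>r. r \<in> I \<Longrightarrow> Ck_on 2 (u r) S"
    and eq: "\<And>z. z \<in> S \<Longrightarrow> h z = (\<Sum>r\<in>I. c r * u r z)" and y: "y \<in> S"
    and d: "\<And>r. r \<in> I \<Longrightarrow> pd j (pd k (u r)) differentiable (at y)"
  shows "pd j (pd k h) differentiable (at y)"
    and "pd i (pd j (pd k h)) y = (\<Sum>r\<in>I. c r * pd i (pd j (pd k (u r))) y)"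
proof -
  have eq2: "(\<Sum>r\<in>I. c r * pd j (pd k (u r)) z) = pd j (pd k h) z" if "z \<in> S" for z
    using pd2_lincomb[OF S u eq that] by simp
  show "pd j (pd k h) differentiable (at y)"
    by (rule differentiable_transform_open[OF differentiable_lincomb S y eq2]) (rule d)
  show "pd i (pd j (pd k h)) y = (\<Sum>r\<in>I. c r * pd i (pd j (pd k (u r))) y)"
  proof -
    have "pd i (pd j (pd k h)) y = pd i (\<lambda>z. \<Sum>r\<in>I. c r * pd j (pd k (u r)) z) y"
      by (rule pd_cong[OF S y eq2, symmetric])
    then show ?thesis using pd_lincomb[of I "\<lambda>r. pd j (pd k (u r))" y] d by simp
  qed
qed

lemma pd2_comp_matrix:
  fixes B :: "real^'n^'m"
  assumes R: "open R" and h: "Ck_on 2 h R" and y: "B *v y \<in> R"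
  shows "pd j (pd k (\<lambda>z. h (B *v z))) y
    = (\<Sum>\<beta>\<in>UNIV. \<Sum>\<gamma>\<in>UNIV. B $ \<beta> $ j * B $ \<gamma> $ k * pd \<beta> (pd \<gamma> h) (B *v y))"
proof -
  let ?S = "{z. B *v z \<in> R}"
  have S: "open ?S"
    using open_vimage[OF R linear_continuous_on[OF matrix_vector_mul_bounded_linear[of B]]]
    by (simp add: vimage_def)
  have d: "h differentiable (at z)" "pd i h differentiable (at z)" if "z \<in> R" for i z
    using Ck_on_imp_differentiable[OF R h] Ck_on_pd[of 1 h R i] h that
      Ck_on_imp_differentiable[OF R, of 1 "pd i h"] by (simp_all add: numeral_2_eq_2 del: Ck_on.simps)
  have "pd j (pd k (\<lambda>z. h (B *v z))) y = pd j (\<lambda>z. \<Sum>\<gamma>\<in>UNIV. B $ \<gamma> $ k * pd \<gamma> h (B *v z)) y"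
    using d y by (intro pd_cong[OF S]) (auto simp: pd_comp_matrix)
  also have "\<dots> = (\<Sum>\<gamma>\<in>UNIV. B $ \<gamma> $ k * (\<Sum>\<beta>\<in>UNIV. B $ \<beta> $ j * pd \<beta> (pd \<gamma> h) (B *v y)))"
    using d y by (subst pd_lincomb) (auto simp: pd_comp_matrix differentiable_comp_matrix)
  also have "\<dots> = (\<Sum>\<beta>\<in>UNIV. \<Sum>\<gamma>\<in>UNIV. B $ \<beta> $ j * B $ \<gamma> $ k * pd \<beta> (pd \<gamma> h) (B *v y))"
    unfolding sum_distrib_left by (subst sum.swap) (simp add: mult_ac)
  finally show ?thesis .
qed

lemma pd3_comp_matrix:
  fixes B :: "real^'n^'m"
  assumes R: "open R" and h: "Ck_on 2 h R" and y: "B *v y \<in> R"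
    and d: "\<And>\<beta> \<gamma>. pd \<beta> (pd \<gamma> h) differentiable (at (B *v y))"
  shows "pd j (pd k (\<lambda>z. h (B *v z))) differentiable (at y)"
    and "pd i (pd j (pd k (\<lambda>z. h (B *v z)))) y = (\<Sum>\<alpha>\<in>UNIV. \<Sum>\<beta>\<in>UNIV. \<Sum>\<gamma>\<in>UNIV.
      B $ \<alpha> $ i * B $ \<beta> $ j * B $ \<gamma> $ k * pd \<alpha> (pd \<beta> (pd \<gamma> h)) (B *v y))"
proof -
  let ?S = "{z. B *v z \<in> R}"
  have S: "open ?S"
    using open_vimage[OF R linear_continuous_on[OF matrix_vector_mul_bounded_linear[of B]]]
    by (simp add: vimage_def)
  have yS: "y \<in> ?S" using y by simp
  \<comment> \<open>The double sum is indexed by pairs so that the rules for a single linear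
    combination apply.\<close>
  let ?G = "\<lambda>z. \<Sum>q\<in>UNIV. (B $ fst q $ j * B $ snd q $ k) * pd (fst q) (pd (snd q) h) (B *v z)"
  have eq: "?G z = pd j (pd k (\<lambda>z. h (B *v z))) z" if "z \<in> ?S" for z
    using that by (simp add: pd2_comp_matrix[OF R h] sum.cartesian_product case_prod_beta)
  have dG: "(\<lambda>z. pd (fst q) (pd (snd q) h) (B *v z)) differentiable (at y)" for q
    by (intro differentiable_comp_matrix d)
  show "pd j (pd k (\<lambda>z. h (B *v z))) differentiable (at y)"
    by (rule differentiable_transform_open[OF differentiable_lincomb S yS eq]) (rule dG)
  have "pd i (pd j (pd k (\<lambda>z. h (B *v z)))) y = pd i ?G y"
    by (rule pd_cong[OF S yS eq, symmetric])
  also have "\<dots> = (\<Sum>q\<in>UNIV. (B $ fst q $ j * B $ snd q $ k)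
      * (\<Sum>\<alpha>\<in>UNIV. B $ \<alpha> $ i * pd \<alpha> (pd (fst q) (pd (snd q) h)) (B *v y)))"
    using dG d by (subst pd_lincomb) (simp_all add: pd_comp_matrix)
  also have "\<dots> = (\<Sum>\<beta>\<in>UNIV. \<Sum>\<gamma>\<in>UNIV. (B $ \<beta> $ j * B $ \<gamma> $ k)
      * (\<Sum>\<alpha>\<in>UNIV. B $ \<alpha> $ i * pd \<alpha> (pd \<beta> (pd \<gamma> h)) (B *v y)))"
    by (simp add: sum.cartesian_product case_prod_beta)
  also have "\<dots> = (\<Sum>\<beta>\<in>UNIV. \<Sum>\<gamma>\<in>UNIV. \<Sum>\<alpha>\<in>UNIV.
      B $ \<alpha> $ i * B $ \<beta> $ j * B $ \<gamma> $ k * pd \<alpha> (pd \<beta> (pd \<gamma> h)) (B *v y))"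
    by (simp add: sum_distrib_left mult_ac)
  also have "\<dots> = (\<Sum>\<alpha>\<in>UNIV. \<Sum>\<beta>\<in>UNIV. \<Sum>\<gamma>\<in>UNIV.
      B $ \<alpha> $ i * B $ \<beta> $ j * B $ \<gamma> $ k * pd \<alpha> (pd \<beta> (pd \<gamma> h)) (B *v y))"
    by (rule sum_rotate[symmetric])
  finally show "pd i (pd j (pd k (\<lambda>z. h (B *v z)))) y = (\<Sum>\<alpha>\<in>UNIV. \<Sum>\<beta>\<in>UNIV. \<Sum>\<gamma>\<in>UNIV.
      B $ \<alpha> $ i * B $ \<beta> $ j * B $ \<gamma> $ k * pd \<alpha> (pd \<beta> (pd \<gamma> h)) (B *v y))" .
qed

section \<open>The Berwald curvature in a moving frame\<close>

context moving_frame
begin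

text \<open>Coordinate components of the spray, but as functions of the frame components of the
  vector.\<close>

definition G :: "'n \<Rightarrow> real^'n \<Rightarrow> real" where
  "G \<mu> z = spray F x0 \<mu> (E x0 *v z)"

lemma Ck_H: "Ck_on 2 (H r) S"
  unfolding H_def contract_def
  by (intro Ck_on_sum Ck_on_cmult Ck_on_mult open_S Ck_gi Ck_vec_nth Ck_on_mono[OF Ck_pd]) simp

lemma Ck_Q: "Ck_on k (Q b) S"
  unfolding Q_def matrix_vector_mult_def
  by (simp, intro Ck_on_sum Ck_on_cmult Ck_on_mult open_S Ck_vec_nth)

lemma Ck_G: "Ck_on 2 (G \<mu>) S"
proof (rule Ck_on_cong[OF open_S])
  show "Ck_on 2 (\<lambda>z. \<Sum>c\<in>UNIV. 1/2 * E x0 $ \<mu> $ c * (Q c z + H c z)) S"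
    by (intro Ck_on_sum Ck_on_cmult Ck_on_add open_S Ck_H Ck_Q)
qed (simp add: G_def spray_frame)

text \<open>As a combination of monomials \<open>z_i z_j\<close>, whose second derivatives are
  constant, \<open>Q\<close> has no third derivatives.\<close>

lemma pd3_Q: "y \<in> S \<Longrightarrow> pd i (pd j (pd k (Q b))) y = 0"
proof -
  let ?P = "\<lambda>q z. z $ fst q * z $ snd q :: real"
  have CkP: "Ck_on 2 (?P q) S" for q
    by (intro Ck_on_mult open_S Ck_vec_nth)
  have 1: "pd k (?P q) = (\<lambda>z. kron (fst q) k * z $ snd q + kron (snd q) k * z $ fst q)" for q k
    by (rule ext) (simp add: pd_mult pd_vec_nth)
  have 2: "pd j (pd k (?P q)) = (\<lambda>z. kron (fst q) k * kron (snd q) j + kron (snd q) k * kron (fst q) j)" for q j k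
    unfolding 1 by (rule ext) (simp add: pd_add pd_cmult pd_vec_nth differentiable_mult)
  have EP: "Q b z = (\<Sum>q\<in>UNIV. (\<Sum>\<rho>\<in>UNIV. \<Sum>\<nu>\<in>UNIV. dM \<rho> b \<nu> * (E x0 $ \<rho> $ fst q * E x0 $ \<nu> $ snd q)) * ?P q z)" for z
  proof -
    have "(E x0 *v z) $ \<rho> * (E x0 *v z) $ \<nu> = (\<Sum>q\<in>UNIV. E x0 $ \<rho> $ fst q * E x0 $ \<nu> $ snd q * ?P q z)" for \<rho> \<nu>
      unfolding matrix_vector_mult_def vec_lambda_beta sum_product
      by (simp add: sum.cartesian_product case_prod_beta mult_ac)
    then have "Q b z = (\<Sum>\<rho>\<in>UNIV. \<Sum>\<nu>\<in>UNIV. \<Sum>q\<in>UNIV. dM \<rho> b \<nu> * (E x0 $ \<rho> $ fst q * E x0 $ \<nu> $ snd q) * ?P q z)"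
      by (simp add: Q_def sum_distrib_left mult.assoc)
    also have "\<dots> = (\<Sum>q\<in>UNIV. \<Sum>\<rho>\<in>UNIV. \<Sum>\<nu>\<in>UNIV. dM \<rho> b \<nu> * (E x0 $ \<rho> $ fst q * E x0 $ \<nu> $ snd q) * ?P q z)"
      by (rule sum_rotate[symmetric])
    finally show ?thesis by (simp only: sum_distrib_right)
  qed
  assume "y \<in> S"
  then show ?thesis
    using pd3_lincomb(2)[where h = "Q b", OF open_S CkP EP] by (simp add: 2)
qed

lemma differentiable_pd2_Q:
  assumes "y \<in> S"
  shows "pd j (pd k (Q b)) differentiable (at y)"
proof -
  have "Ck_on 1 (pd j (pd k (Q b))) S"
    by (rule Ck_on_pd[OF Ck_on_pd[OF Ck_Q[of "Suc (Suc 1)"]]])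
  then show ?thesis
    by (rule Ck_on_imp_differentiable[OF open_S _ _ assms]) simp
qed

lemma G_third:
  assumes y: "y \<in> S" and d: "\<And>r. pd j (pd k (H r)) differentiable (at y)"
  shows "pd j (pd k (G \<mu>)) differentiable (at y)"
    and "pd i (pd j (pd k (G \<mu>))) y = (\<Sum>c\<in>UNIV. 1/2 * E x0 $ \<mu> $ c * pd i (pd j (pd k (H c))) y)"
proof -
  let ?u = "\<lambda>c z. Q c z + H c z"
  have u: "Ck_on 2 (?u c) S" for c
    by (intro Ck_on_add open_S Ck_H Ck_Q)
  \<comment> \<open>A sum of two functions as a linear combination over \<open>bool\<close>, to
    which \<open>pd3_lincomb\<close> applies.\<close>
  have QH: "?u c z = (\<Sum>b\<in>UNIV. 1 * (if b then Q c else H c) z)" for c z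
    by (simp add: UNIV_bool)
  have ifC: "Ck_on 2 (if b then Q c else H c) S" and
    ifd: "pd j (pd k (if b then Q c else H c)) differentiable (at y)" for b c
    using Ck_H Ck_Q d differentiable_pd2_Q[OF y] by auto
  have u3: "pd j (pd k (?u c)) differentiable (at y)"
    "pd i (pd j (pd k (?u c))) y = pd i (pd j (pd k (Q c))) y + pd i (pd j (pd k (H c))) y" for c
    using pd3_lincomb[where I = UNIV and h = "?u c" and u = "\<lambda>b. if b then Q c else H c" and c = "\<lambda>_. 1", OF open_S ifC[of _ c] QH[of c] y ifd[of _ c]]
    by (simp_all add: UNIV_bool)
  have G: "G \<mu> z = (\<Sum>c\<in>UNIV. 1/2 * E x0 $ \<mu> $ c * ?u c z)" if "z \<in> S" for z
    using that by (simp add: G_def spray_frame)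
  note G3 = pd3_lincomb[OF open_S u G y u3(1)]
  show "pd j (pd k (G \<mu>)) differentiable (at y)" by (rule G3(1))
  have "pd i (pd j (pd k (G \<mu>))) y = (\<Sum>c\<in>UNIV. 1/2 * E x0 $ \<mu> $ c * pd i (pd j (pd k (?u c))) y)"
    by (rule G3(2))
  then show "pd i (pd j (pd k (G \<mu>))) y = (\<Sum>c\<in>UNIV. 1/2 * E x0 $ \<mu> $ c * pd i (pd j (pd k (H c))) y)"
    unfolding u3(2) by (simp add: pd3_Q[OF y])
qed

text \<open>The converse of \<open>G_third\<close>: multiplying \<open>spray_frame\<close> by the
  dual basis gives \<open>H^r = 2 M^r_mu G^mu - Q^r\<close>, and \<open>Q\<close> is smooth.\<close>

lemma H_third:
  assumes y: "y \<in> S" and d: "\<And>\<mu>. pd j (pd k (G \<mu>)) differentiable (at y)"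
  shows "pd j (pd k (H r)) differentiable (at y)"
proof -
  \<comment> \<open>The value \<open>None\<close> indexes the summand \<open>Q\<close>, with
    coefficient \<open>- 1\<close>; \<open>Some \<mu>\<close> indexes the components of the
    spray.\<close>
  let ?u = "\<lambda>q. case q of None \<Rightarrow> Q r | Some \<mu> \<Rightarrow> G \<mu>"
  let ?c = "\<lambda>q. case q of None \<Rightarrow> - 1 | Some \<mu> \<Rightarrow> 2 * M x0 $ r $ \<mu>"
  have "(\<Sum>\<mu>\<in>UNIV. 2 * M x0 $ r $ \<mu> * G \<mu> z) = Q r z + H r z" if "z \<in> S" for z
  proof -
    have "(\<Sum>\<mu>\<in>UNIV. 2 * M x0 $ r $ \<mu> * G \<mu> z)
        = (\<Sum>c\<in>UNIV. (\<Sum>\<mu>\<in>UNIV. M x0 $ r $ \<mu> * E x0 $ \<mu> $ c) * (Q c z + H c z))"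
      unfolding G_def spray_frame[OF that] sum_distrib_left sum_distrib_right
      by (subst sum.swap) (simp add: mult_ac)
    then show ?thesis by (simp add: ME_sum[OF x0])
  qed
  then have eq: "H r z = (\<Sum>q\<in>UNIV. ?c q * ?u q z)" if "z \<in> S" for z
    using that by (simp add: UNIV_option_conv sum.reindex)
  have "Ck_on 2 (?u q) S" "pd j (pd k (?u q)) differentiable (at y)" for q
    using Ck_Q Ck_G d differentiable_pd2_Q[OF y] by (auto split: option.split)
  from pd3_lincomb(1)[OF open_S this(1) eq y this(2)] show ?thesis .
qed

text \<open>The three factors \<open>E\<close> are those of the chain rule for a constant linear
  change of coordinates, which makes the derivatives frame derivatives; the dual basis then cancels
  the \<open>E\<close> of \<open>spray_frame\<close>, leaving its factor \<open>1/2\<close>.\<close>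

lemma berwald_frame_eq:
  assumes y: "y \<in> S" and d: "\<And>r j k. pd j (pd k (H r)) differentiable (at y)"
  shows "berwald_frame F (E x0) x0 (E x0 *v y) r a b c = 1/2 * pd a (pd b (pd c (H r))) y"
proof -
  let ?R = "{w. M x0 *v w \<in> S}"
  have R: "open ?R" by (rule open_coord)
  have sprayG: "spray F x0 \<rho> w = G \<rho> (M x0 *v w)" for \<rho> w
    by (simp add: G_def EM_vec)
  have CkS: "Ck_on 2 (spray F x0 \<rho>) ?R" for \<rho>
    unfolding sprayG[abs_def]
    by (rule Ck_on_comp_linear[OF open_S Ck_G matrix_vector_mul_bounded_linear R]) auto
  have yR: "E x0 *v y \<in> ?R" using y by (simp add: ME_vec)
  have dS: "pd \<beta> (pd \<gamma> (spray F x0 \<rho>)) differentiable (at (E x0 *v y))" for \<rho> \<beta> \<gamma>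
    unfolding sprayG[abs_def]
    using y d by (intro pd3_comp_matrix(1)[OF open_S Ck_G]) (auto simp: ME_vec intro!: G_third(1))
  have "berwald_frame F (E x0) x0 (E x0 *v y) r a b c = (\<Sum>\<rho>\<in>UNIV. M x0 $ r $ \<rho> * (\<Sum>\<alpha>\<in>UNIV. \<Sum>\<beta>\<in>UNIV. \<Sum>\<gamma>\<in>UNIV.
      E x0 $ \<alpha> $ a * E x0 $ \<beta> $ b * E x0 $ \<gamma> $ c * pd \<alpha> (pd \<beta> (pd \<gamma> (spray F x0 \<rho>))) (E x0 *v y)))"
    unfolding berwald_frame_def berwald_def matrix_inv_E[OF x0] by (simp add: sum_distrib_left mult_ac)
  also have "\<dots> = (\<Sum>\<rho>\<in>UNIV. M x0 $ r $ \<rho> * pd a (pd b (pd c (G \<rho>))) y)"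
    using pd3_comp_matrix(2)[OF R CkS yR dS] by (simp add: G_def[abs_def])
  also have "\<dots> = 1/2 * (\<Sum>e\<in>UNIV. (\<Sum>\<rho>\<in>UNIV. M x0 $ r $ \<rho> * E x0 $ \<rho> $ e) * pd a (pd b (pd c (H e))) y)"
    unfolding G_third(2)[OF y d] sum_distrib_left sum_distrib_right by (subst sum.swap) (simp add: mult_ac)
  finally show ?thesis by (simp add: ME_sum[OF x0])
qed

text \<open>Carries the regularity assumption from the coordinates of the chart to the frame
  components by the linear map \<open>E x0\<close>, and from there to \<open>H\<close>.\<close>

lemma third_derivatives_H_of_spray:
  assumes y: "y \<in> S" and d: "\<And>\<rho>. has_third_derivatives (spray F x0 \<rho>) (E x0 *v y)"
  shows "pd j (pd k (H r)) differentiable (at y)"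
proof -
  let ?R = "{w. M x0 *v w \<in> S}"
  have R: "open ?R" by (rule open_coord)
  have sprayG: "spray F x0 \<rho> w = G \<rho> (M x0 *v w)" for \<rho> w
    by (simp add: G_def EM_vec)
  have CkS: "Ck_on 2 (spray F x0 \<rho>) ?R" for \<rho>
    unfolding sprayG[abs_def]
    by (rule Ck_on_comp_linear[OF open_S Ck_G matrix_vector_mul_bounded_linear R]) auto
  have yR: "E x0 *v y \<in> ?R" using y by (simp add: ME_vec)
  have "pd j (pd k (G \<mu>)) differentiable (at y)" for \<mu> j k
    unfolding G_def[abs_def] using d
    by (intro pd3_comp_matrix(1)[OF R CkS yR]) (simp add: has_third_derivatives_def)
  then show ?thesis by (rule H_third[OF y])
qed

lemma H_lincomb:
  "H r z = (\<Sum>q\<in>UNIV. cc (fst q) (fst (snd q)) (snd (snd q))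
    * (gi r (fst (snd q)) z * pd (fst q) f z * z $ snd (snd q)))"
  by (simp add: H_def contract_def sum.cartesian_product case_prod_beta)

lemma third_derivatives_H:
  assumes y: "y \<in> S" and d: "\<And>m e n. has_third_derivatives (\<lambda>z. gi r m z * pd e f z * z $ n) y"
  shows "pd j (pd k (H r)) differentiable (at y)"
    and "pd i (pd j (pd k (H r))) y = contract cc (\<lambda>e m n. pd i (pd j (pd k (\<lambda>z. gi r m z * pd e f z * z $ n))) y)"
proof -
  have C: "Ck_on 2 (\<lambda>z. gi r m z * pd e f z * z $ n) S" for m e n
    by (intro Ck_on_mult open_S Ck_gi Ck_vec_nth Ck_on_mono[OF Ck_pd]) simp
  have d': "pd j (pd k (\<lambda>z. gi r m z * pd e f z * z $ n)) differentiable (at y)" for m e n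
    using d unfolding has_third_derivatives_def by blast
  note third = pd3_lincomb[OF open_S C H_lincomb y d']
  show "pd j (pd k (H r)) differentiable (at y)" by (rule third(1))
  show "pd i (pd j (pd k (H r))) y = contract cc (\<lambda>e m n. pd i (pd j (pd k (\<lambda>z. gi r m z * pd e f z * z $ n))) y)"
    unfolding third(2) by (simp add: contract_def sum.cartesian_product case_prod_beta)
qed

end

section \<open>The fibre of the model\<close>

lemma frechet_derivative_comp_linear:
  assumes "h differentiable (at (T y))" "bounded_linear T"
  shows "frechet_derivative (\<lambda>z. h (T z)) (at y) v = frechet_derivative h (at (T y)) (T v)"
proof -
  have "((\<lambda>z. h (T z)) has_derivative (\<lambda>v. frechet_derivative h (at (T y)) (T v))) (at y)"
    using has_derivative_compose[OF bounded_linear_imp_has_derivative[OF assms(2)]] assms(1)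
    unfolding frechet_derivative_works by blast
  then show ?thesis by (simp add: frechet_derivative_eqI)
qed

text \<open>The first derivatives are homogeneous of degree one; differentiating this along the ray
  at \<open>s = 1\<close> gives Euler's relation with the two derivatives in the other order, which
  Schwarz's theorem exchanges.\<close>

lemma euler_homogeneous_pd:
  fixes f :: "real^'n \<Rightarrow> real"
  assumes S: "open S" and f: "Ck_on 2 f S" and cone: "\<And>y s. y \<in> S \<Longrightarrow> 0 < s \<Longrightarrow> s *\<^sub>R y \<in> S"
    and hom: "\<And>y s. y \<in> S \<Longrightarrow> 0 < s \<Longrightarrow> f (s *\<^sub>R y) = s\<^sup>2 * f y" and y: "y \<in> S"
  shows "(\<Sum>b\<in>UNIV. pd a (pd b f) y * y $ b) = pd a f y"
proof -
  have d: "f differentiable (at z)" if "z \<in> S" for z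
    using Ck_on_imp_differentiable[OF S f _ that] by simp
  have d2: "pd a f differentiable (at z)" if "z \<in> S" for z
    using Ck_on_pd[of 1 f S a] f Ck_on_imp_differentiable[OF S _ _ that, of 1 "pd a f"]
    by (simp add: numeral_2_eq_2 del: Ck_on.simps)
  have hom1: "pd a f (s *\<^sub>R y) = s * pd a f y" if s: "0 < s" for s
  proof -
    have "s * pd a f (s *\<^sub>R y) = frechet_derivative f (at (s *\<^sub>R y)) (s *\<^sub>R axis a 1)"
      using linear_cmul[OF linear_frechet_derivative[OF d[OF cone[OF y s]]]] by (simp add: pd_def)
    also have "\<dots> = frechet_derivative (\<lambda>z. f (s *\<^sub>R z)) (at y) (axis a 1)"
      using frechet_derivative_comp_linear[of f "\<lambda>z. s *\<^sub>R z" y "axis a 1"] d[OF cone[OF y s]]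
      by (simp add: bounded_linear_scaleR_right)
    also have "\<dots> = pd a (\<lambda>z. s\<^sup>2 * f z) y"
      unfolding pd_def[symmetric] using s by (intro pd_cong[OF S y]) (simp add: hom)
    also have "\<dots> = s * (s * pd a f y)"
      using d[OF y] by (simp add: pd_cmult power2_eq_square)
    finally show ?thesis using s by simp
  qed
  have "((\<lambda>s. s *\<^sub>R y) has_derivative (\<lambda>h. h *\<^sub>R y)) (at 1)"
    by (auto intro!: derivative_eq_intros)
  moreover have "(pd a f has_derivative frechet_derivative (pd a f) (at y)) (at (1 *\<^sub>R y))"
    using d2[OF y] by (simp add: frechet_derivative_works)
  ultimately have "((\<lambda>s. pd a f (s *\<^sub>R y)) has_derivative (\<lambda>h. frechet_derivative (pd a f) (at y) (h *\<^sub>R y))) (at 1)"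
    by (rule has_derivative_compose)
  then have "((\<lambda>s. s * pd a f y) has_derivative (\<lambda>h. frechet_derivative (pd a f) (at y) (h *\<^sub>R y))) (at 1)"
    by (rule has_derivative_transform_within_open[of _ _ _ _ "{0<..}"]) (auto simp: hom1)
  moreover have "((\<lambda>s. s * pd a f y) has_derivative (\<lambda>h. h * pd a f y)) (at 1)"
    by (auto intro!: derivative_eq_intros)
  ultimately have "(\<lambda>h. frechet_derivative (pd a f) (at y) (h *\<^sub>R y)) = (\<lambda>h. h * pd a f y)"
    by (rule has_derivative_unique)
  from fun_cong[OF this, of 1] have "frechet_derivative (pd a f) (at y) y = pd a f y" by simp
  then have "(\<Sum>b\<in>UNIV. y $ b * pd b (pd a f) y) = pd a f y"
    by (simp add: frechet_derivative_pd[OF d2[OF y]])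
  then show ?thesis
    using pd_commute[OF S f y, of _ a] by (simp add: mult.commute)
qed

definition frame_vector :: "('n::finite \<Rightarrow> 'v::euclidean_space) \<Rightarrow> real^'n \<Rightarrow> 'v" where
  "frame_vector bas y = (\<Sum>a\<in>UNIV. (y $ a) *\<^sub>R bas a)"

lemma frame_fun_eq: "frame_fun bas L y = L (frame_vector bas y)"
  by (simp add: frame_fun_def frame_vector_def)

lemma linear_frame_vector: "linear (frame_vector bas)"
  by (rule linearI) (simp_all add: frame_vector_def scaleR_add_left sum.distrib scaleR_sum_right)

lemma bounded_linear_frame_vector: "bounded_linear (frame_vector bas)"
  using linear_frame_vector linear_conv_bounded_linear by blast

lemma frame_vector_axis: "frame_vector bas (axis a 1) = bas a"
proof -
  have "frame_vector bas (axis a 1) = (\<Sum>b\<in>UNIV. if b = a then bas b else 0)"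
    unfolding frame_vector_def by (rule sum.cong) (auto simp: axis_def)
  then show ?thesis by simp
qed

lemma bij_frame_vector:
  assumes "vector_basis bas"
  shows "bij (frame_vector bas)"
proof -
  interpret B: linear "frame_vector bas" by (rule linear_frame_vector)
  have inj: "inj bas" and ind: "independent (range bas)" and span: "span (range bas) = UNIV"
    using assms by (auto simp: vector_basis_def)
  have "y = 0" if "frame_vector bas y = 0" for y
  proof -
    define u where "u v = y $ (inv bas v)" for v
    have "(\<Sum>v\<in>range bas. u v *\<^sub>R v) = frame_vector bas y"
      using inj by (simp add: sum.reindex u_def frame_vector_def)
    then have "\<forall>v\<in>range bas. u v = 0"
      using ind that independentD[OF ind, of "range bas" u] by auto
    then have "y $ a = 0" for a
      using inj by (metis inv_f_f rangeI u_def)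
    then show ?thesis by (simp add: vec_eq_iff)
  qed
  then have "inj (frame_vector bas)"
    by (simp add: linear_injective_0[OF linear_frame_vector])
  moreover have "surj (frame_vector bas)"
  proof -
    have "span (range bas) \<subseteq> range (frame_vector bas)"
      by (intro span_minimal linear_subspace_image[OF linear_frame_vector] subspace_UNIV)
         (auto simp: frame_vector_axis[symmetric])
    then show ?thesis using span by auto
  qed
  ultimately show ?thesis by (simp add: bij_def)
qed

text \<open>In a basis, the Hessian of the model is the bilinear form of \<open>fmetric\<close>.
  Since the coordinate map is bijective, non-degeneracy becomes invertibility of the matrix.\<close>

lemma fibre_frame_fun:
  assumes mink: "pseudo_minkowski \<omega> L" and basis: "vector_basis bas"
  shows "fibre (frame_fun bas L) (frame_vector bas -` \<omega>)"
proof -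
  let ?B = "frame_vector bas" and ?f = "frame_fun bas L"
  let ?S = "?B -` \<omega>"
  have \<omega>: "open \<omega>" "\<And>y s. y \<in> \<omega> \<Longrightarrow> 0 < s \<Longrightarrow> s *\<^sub>R y \<in> \<omega>" and L: "Ck_on 4 L \<omega>"
    and hom: "\<And>y s. y \<in> \<omega> \<Longrightarrow> 0 < s \<Longrightarrow> L (s *\<^sub>R y) = s\<^sup>2 * L y"
    and nondeg: "\<And>y u. y \<in> \<omega> \<Longrightarrow> (\<And>v. hessian L y u v = 0) \<Longrightarrow> u = 0"
    using mink closure_subset[of \<omega>] unfolding pseudo_minkowski_def by blast+
  have S: "open ?S"
    by (intro open_vimage \<omega>(1) linear_continuous_on bounded_linear_frame_vector)
  have f: "Ck_on 4 ?f ?S"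
    unfolding frame_fun_eq[abs_def]
    by (rule Ck_on_comp_linear[OF \<omega>(1) L bounded_linear_frame_vector S]) auto
  have dL: "L differentiable (at z)" if "z \<in> \<omega>" for z
    using Ck_on_imp_differentiable[OF \<omega>(1) L _ that] by simp
  have L2: "Ck_on (Suc 3) L \<omega>" using L by (simp add: eval_nat_numeral del: Ck_on.simps)
  have "Ck_on 3 (\<lambda>z. frechet_derivative L (at z) v) \<omega>" for v
    using L2 unfolding Ck_on.simps by blast
  then have dL2: "(\<lambda>z. frechet_derivative L (at z) v) differentiable (at z)" if "z \<in> \<omega>" for z v
    using Ck_on_imp_differentiable[OF \<omega>(1) _ _ that] by (metis zero_less_numeral)
  have df: "?f differentiable (at z)" "pd b ?f differentiable (at z)" if "z \<in> ?S" for z b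
    using Ck_on_imp_differentiable[OF S f _ that] Ck_on_pd[of 3 ?f ?S b] f
      Ck_on_imp_differentiable[OF S _ _ that, of 3 "pd b ?f"] by (simp_all add: eval_nat_numeral del: Ck_on.simps)
  have first: "frechet_derivative L (at (?B z)) (?B w) = (\<Sum>b\<in>UNIV. w $ b * pd b ?f z)" if "z \<in> ?S" for z w
    using that frechet_derivative_comp_linear[OF dL bounded_linear_frame_vector, of bas z w]
      frechet_derivative_pd[OF df(1)[OF that]] by (simp add: frame_fun_eq[abs_def])
  have hess: "hessian L (?B y) (?B v) (?B w) = (\<Sum>b\<in>UNIV. w $ b * (\<Sum>a\<in>UNIV. v $ a * pd a (pd b ?f) y))"
    if y: "y \<in> ?S" for y v w
  proof -
    have "hessian L (?B y) (?B v) (?B w) = frechet_derivative (\<lambda>z. frechet_derivative L (at (?B z)) (?B w)) (at y) v"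
      unfolding hessian_def using y
      by (subst frechet_derivative_comp_linear[OF dL2 bounded_linear_frame_vector]) auto
    also have "\<dots> = frechet_derivative (\<lambda>z. \<Sum>b\<in>UNIV. w $ b * pd b ?f z) (at y) v"
      by (subst frechet_derivative_transform_open[OF S y first]) auto
    also have "\<dots> = (\<Sum>a\<in>UNIV. v $ a * pd a (\<lambda>z. \<Sum>b\<in>UNIV. w $ b * pd b ?f z) y)"
      using y df(2) by (intro frechet_derivative_pd differentiable_lincomb) auto
    also have "\<dots> = (\<Sum>a\<in>UNIV. v $ a * (\<Sum>b\<in>UNIV. w $ b * pd a (pd b ?f) y))"
      using df(2)[OF y] by (simp add: pd_lincomb)
    also have "\<dots> = (\<Sum>b\<in>UNIV. w $ b * (\<Sum>a\<in>UNIV. v $ a * pd a (pd b ?f) y))"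
      unfolding sum_distrib_left by (subst sum.swap) (simp add: mult_ac)
    finally show ?thesis .
  qed
  show ?thesis
  proof
    show "open ?S" by (rule S)
    show "Ck_on 4 ?f ?S" by (rule f)
    show "invertible (fmetric ?f y)" if y: "y \<in> ?S" for y
    proof -
      \<comment> \<open>The vector enters the Hessian through the first index, that is, through the
        rows of \<open>fmetric\<close>; hence the kernel of the transpose.\<close>
      have "v = 0" if v: "transpose (fmetric ?f y) *v v = 0" for v
      proof -
        have "(\<Sum>a\<in>UNIV. v $ a * pd a (pd b ?f) y) = 0" for b
          using arg_cong[OF v, of "\<lambda>u. u $ b"]
          by (simp add: matrix_vector_mult_def transpose_def fmetric_def mult.commute)
        then have "hessian L (?B y) (?B v) (?B w) = 0" for w
          by (simp add: hess[OF y])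
        then have "hessian L (?B y) (?B v) u = 0" for u
          using bij_frame_vector[OF basis] by (metis bij_pointE)
        then have "?B v = 0" using nondeg y by simp
        then show ?thesis
          using bij_frame_vector[OF basis] linear_injective_0[OF linear_frame_vector] by (metis bij_is_inj)
      qed
      then show ?thesis
        using matrix_left_invertible_ker invertible_left_inverse transpose_invertible transpose_transpose
        by metis
    qed
    show "(\<Sum>b\<in>UNIV. pd a (pd b ?f) y * y $ b) = pd a ?f y" if y: "y \<in> ?S" for y a
    proof (rule euler_homogeneous_pd[OF S Ck_on_mono[OF f] _ _ y])
      show "s *\<^sub>R z \<in> ?S" "?f (s *\<^sub>R z) = s\<^sup>2 * ?f z" if "z \<in> ?S" "0 < s" for z s
        using that \<omega>(2) hom by (simp_all add: frame_fun_eq linear_cmul[OF linear_frame_vector])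
    qed simp
  qed
qed

section \<open>Tangent spaces in coordinates\<close>

locale C3_atlas =
  fixes X :: "'m topology" and A :: "('m, 'n::finite) chart set"
  assumes C3: "C3_manifold X A"
begin

lemma chart_subset: "c \<in> A \<Longrightarrow> fst c \<subseteq> topspace X"
  using C3 unfolding C3_manifold_def by auto

lemma homeomorphic_chart:
  "c \<in> A \<Longrightarrow> homeomorphic_map (subtopology X (fst c)) (top_of_set (snd c ` fst c)) (snd c)"
  using C3 unfolding C3_manifold_def by blast

lemma inj_chart: "c \<in> A \<Longrightarrow> inj_on (snd c) (fst c)"
  using homeomorphic_imp_injective_map[OF homeomorphic_chart] chart_subset
  by (metis topspace_subtopology_subset)

lemma chart_inv: "c \<in> A \<Longrightarrow> p \<in> fst c \<Longrightarrow> chart_inv c (snd c p) = p"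
  unfolding chart_inv_def by (simp add: inj_chart)

lemma open_chart_image:
  assumes "c \<in> A" "openin X V" "V \<subseteq> fst c"
  shows "open (snd c ` V)"
proof -
  have "openin (subtopology X (fst c)) V"
    using assms by (auto simp: openin_subtopology)
  then have "openin (top_of_set (snd c ` fst c)) (snd c ` V)"
    using homeomorphic_imp_open_map[OF homeomorphic_chart[OF assms(1)]] unfolding open_map_def by blast
  moreover have "open (snd c ` fst c)"
    using C3 assms(1) unfolding C3_manifold_def by blast
  ultimately show ?thesis by (simp add: openin_open_eq)
qed

lemma openin_chart: "c \<in> A \<Longrightarrow> openin X (fst c)"
  using C3 unfolding C3_manifold_def by blast

lemma transition: "c \<in> A \<Longrightarrow> p \<in> fst c \<Longrightarrow> transition c c' (snd c p) = snd c' p"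
  by (simp add: transition_def chart_inv)

lemma differentiable_transition:
  assumes "c \<in> A" "c' \<in> A" "p \<in> fst c \<inter> fst c'"
  shows "transition c c' differentiable (at (snd c p))"
proof (rule Ck_on_imp_differentiable)
  show "open (snd c ` (fst c \<inter> fst c'))"
    using assms(1,2) by (intro open_chart_image openin_Int openin_chart) auto
  show "Ck_on 3 (transition c c') (snd c ` (fst c \<inter> fst c'))"
    using C3 assms unfolding C3_manifold_def by blast
qed (use assms in auto)

text \<open>The cocycle identity of the Jacobians; the composite agrees with the direct transition
  map on the image of the triple overlap, which is open.\<close>

lemma frechet_transition_chain:
  assumes "c \<in> A" "c' \<in> A" "c'' \<in> A" "p \<in> fst c" "p \<in> fst c'" "p \<in> fst c''"
  shows "frechet_derivative (transition c c'') (at (snd c p)) v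
    = frechet_derivative (transition c' c'') (at (snd c' p)) (frechet_derivative (transition c c') (at (snd c p)) v)"
proof -
  let ?V = "fst c \<inter> fst c' \<inter> fst c''"
  have "frechet_derivative (transition c' c'' \<circ> transition c c') (at (snd c p))
      = frechet_derivative (transition c c'') (at (snd c p))"
    using assms
    by (intro frechet_derivative_transform_open[of "snd c ` ?V"] open_chart_image openin_Int openin_chart)
       (auto simp: transition)
  moreover have "frechet_derivative (transition c' c'' \<circ> transition c c') (at (snd c p))
      = frechet_derivative (transition c' c'') (at (snd c' p)) \<circ> frechet_derivative (transition c c') (at (snd c p))"
    using assms differentiable_transition
    by (subst frechet_derivative_compose) (auto simp: transition)
  ultimately show ?thesis by (metis comp_apply)
qed

lemma tvec_of_in_tangent_space:
  assumes "c \<in> A" "p \<in> fst c"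
  shows "tvec_of A c p y \<in> tangent_space A p"
proof -
  have "tvec_of A c p y c2 = frechet_derivative (transition c1 c2) (at (snd c1 p)) (tvec_of A c p y c1)"
    if "c1 \<in> A" "c2 \<in> A" "p \<in> fst c1 \<inter> fst c2" for c1 c2
    using that assms frechet_transition_chain[of c c1 c2 p y] by (simp add: tvec_of_def)
  moreover have "tvec_of A c p y c' = 0" if "\<not> (c' \<in> A \<and> p \<in> fst c')" for c'
    using that by (auto simp: tvec_of_def)
  ultimately show ?thesis unfolding tangent_space_def by blast
qed

text \<open>A tangent vector is determined by its components in one chart, so the fibre may be
  treated as \<open>real^'n\<close>.\<close>

lemma tangent_space_eq_tvec_of:
  assumes "c \<in> A" "p \<in> fst c" "v \<in> tangent_space A p"
  shows "tvec_of A c p (v c) = v"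
proof
  fix c'
  show "tvec_of A c p (v c) c' = v c'"
  proof (cases "c' \<in> A \<and> p \<in> fst c'")
    case True
    then have "v c' = frechet_derivative (transition c c') (at (snd c p)) (v c)"
      using assms unfolding tangent_space_def by blast
    then show ?thesis using True by (simp add: tvec_of_def)
  next
    case False
    then have "v c' = 0" using assms(3) unfolding tangent_space_def by blast
    then show ?thesis using False by (auto simp: tvec_of_def)
  qed
qed

lemma tvec_of_linear:
  assumes "c \<in> A" "p \<in> fst c"
  shows "tvec_of A c p (r *\<^sub>R y + s *\<^sub>R z) = (\<lambda>c'. r *\<^sub>R tvec_of A c p y c' + s *\<^sub>R tvec_of A c p z c')"
proof
  fix c'
  show "tvec_of A c p (r *\<^sub>R y + s *\<^sub>R z) c' = r *\<^sub>R tvec_of A c p y c' + s *\<^sub>R tvec_of A c p z c'"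
  proof (cases "c' \<in> A \<and> p \<in> fst c'")
    case True
    then have "linear (frechet_derivative (transition c c') (at (snd c p)))"
      using assms by (intro linear_frechet_derivative differentiable_transition) auto
    then show ?thesis
      using True by (simp add: tvec_of_def linear_add linear_cmul)
  qed (auto simp: tvec_of_def)
qed

end

section \<open>A modeled space as a moving frame\<close>

text \<open>The dual basis as a matrix. It is built from \<phi>, for which
  \<open>local_model\<close> supplies C1 regularity; the vierbein inherits this regularity as the
  inverse matrix.\<close>

definition frame_matrix where
  "frame_matrix A \<phi> bas c x
    = matrix (\<lambda>y. inv (frame_vector bas) (\<phi> (chart_inv c x) (tvec_of A c (chart_inv c x) y)))"

locale modeled_frame = C3_atlas X A
  for X :: "'m topology" and A :: "('m, 'n::finite) chart set" +
  fixes \<Omega> :: "'m \<Rightarrow> ('m, 'n) tvec set" and \<L> :: "'m \<Rightarrow> ('m, 'n) tvec \<Rightarrow> real"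
    and \<omega> :: "'v::euclidean_space set" and L :: "'v \<Rightarrow> real" and bas :: "'n \<Rightarrow> 'v"
    and U :: "'m set" and \<phi> :: "'m \<Rightarrow> ('m, 'n) tvec \<Rightarrow> 'v" and ch :: "('m, 'n) chart"
  assumes \<Omega>: "\<And>p. p \<in> topspace X \<Longrightarrow> \<Omega> p \<subseteq> tangent_space A p"
    and frame: "local_model X A \<Omega> \<L> \<omega> L U \<phi>"
    and basis: "vector_basis bas"
    and ch: "ch \<in> A"
begin

abbreviation "B \<equiv> frame_vector bas"
abbreviation "M \<equiv> frame_matrix A \<phi> bas ch"
abbreviation "N \<equiv> snd ch ` (fst ch \<inter> U)"

lemma openin_U: "openin X U"
  using frame unfolding local_model_def by blast

lemma bij_B: "bij B"
  by (rule bij_frame_vector[OF basis])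

lemma inv_B: "inv B (B y) = y" "B (inv B u) = u"
  using bij_B by (simp_all add: bij_is_inj bij_is_surj surj_f_inv_f)

lemma linear_inv_B: "linear (inv B)"
  by (rule linearI; rule inv_f_eq[OF bij_is_inj[OF bij_B]])
     (simp_all add: linear_add[OF linear_frame_vector] linear_cmul[OF linear_frame_vector] inv_B)

lemma open_N: "open N"
  by (intro open_chart_image openin_Int openin_chart openin_U ch) auto

lemma \<phi>_linear:
  assumes "p \<in> U" "u \<in> tangent_space A p" "v \<in> tangent_space A p"
  shows "\<phi> p (\<lambda>c. r *\<^sub>R u c + s *\<^sub>R v c) = r *\<^sub>R \<phi> p u + s *\<^sub>R \<phi> p v"
  using frame assms unfolding local_model_def by blast

lemma bij_\<phi>: "p \<in> U \<Longrightarrow> bij_betw (\<phi> p) (tangent_space A p) UNIV"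
  using frame unfolding local_model_def by blast

lemma linear_\<phi>_tvec_of:
  assumes "p \<in> fst ch \<inter> U"
  shows "linear (\<lambda>y. \<phi> p (tvec_of A ch p y))"
proof -
  have *: "\<phi> p (tvec_of A ch p (r *\<^sub>R y + s *\<^sub>R z)) = r *\<^sub>R \<phi> p (tvec_of A ch p y) + s *\<^sub>R \<phi> p (tvec_of A ch p z)"
    for r s y z
    using assms ch by (simp add: tvec_of_linear \<phi>_linear tvec_of_in_tangent_space)
  show ?thesis
  proof (rule linearI)
    show "\<phi> p (tvec_of A ch p (y + z)) = \<phi> p (tvec_of A ch p y) + \<phi> p (tvec_of A ch p z)" for y z
      using *[of 1 y 1 z] by simp
    show "\<phi> p (tvec_of A ch p (r *\<^sub>R y)) = r *\<^sub>R \<phi> p (tvec_of A ch p y)" for r y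
      using *[of r y 0 y] by simp
  qed
qed

lemma M_eq:
  assumes "p \<in> fst ch \<inter> U"
  shows "M (snd ch p) *v y = inv B (\<phi> p (tvec_of A ch p y))"
proof -
  have "linear (\<lambda>y. inv B (\<phi> p (tvec_of A ch p y)))"
    using linear_compose[OF linear_\<phi>_tvec_of[OF assms] linear_inv_B] by (simp add: o_def)
  then show ?thesis
    using assms ch by (simp add: frame_matrix_def chart_inv matrix_works)
qed

lemma C1_M: "Ck_on 1 (\<lambda>x. M x $ i $ j) N"
proof (rule Ck_on_cong[OF open_N])
  have "Ck_on 1 (\<lambda>x. \<phi> (chart_inv ch x) (tvec_of A ch (chart_inv ch x) (axis j 1))) N"
    using frame ch unfolding local_model_def by blast
  then show "Ck_on 1 (\<lambda>x. inv B (\<phi> (chart_inv ch x) (tvec_of A ch (chart_inv ch x) (axis j 1))) $ i) N"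
    by (intro Ck_on_vec_nth_comp[OF open_N] Ck_on_linear_comp[OF open_N, where T = "inv B"]
        linear_inv_B[THEN linear_conv_bounded_linear[THEN iffD1]])
qed (simp add: frame_matrix_def matrix_def)

lemma M_vierbein:
  assumes "x \<in> N"
  shows "M x ** vierbein A \<phi> bas ch x = mat 1"
proof -
  obtain p where p: "p \<in> fst ch \<inter> U" and x: "x = snd ch p" using assms by blast
  have "M x *v column a (vierbein A \<phi> bas ch x) = axis a 1" for a
  proof -
    let ?v = "inv_into (tangent_space A p) (\<phi> p) (bas a)"
    have "bas a \<in> \<phi> p ` tangent_space A p"
      using bij_\<phi>[of p] p by (simp add: bij_betw_def)
    then have v: "?v \<in> tangent_space A p" "\<phi> p ?v = bas a"
      by (simp_all add: inv_into_into f_inv_into_f)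
    have "column a (vierbein A \<phi> bas ch x) = ?v ch"
      using p ch by (simp add: column_def vierbein_def x chart_inv vec_eq_iff)
    then have "M x *v column a (vierbein A \<phi> bas ch x) = inv B (bas a)"
      using p ch v by (simp add: x M_eq tangent_space_eq_tvec_of)
    then show ?thesis by (metis frame_vector_axis inv_B(1))
  qed
  then have "(M x ** vierbein A \<phi> bas ch x) *v axis a 1 = axis a 1" for a
    by (subst matrix_vector_mul_assoc[symmetric]) (simp add: matrix_vector_mult_basis)
  then have column: "column a (M x ** vierbein A \<phi> bas ch x) = axis a 1" for a
    by (simp only: matrix_vector_mult_basis)
  have "(M x ** vierbein A \<phi> bas ch x) $ i $ a = mat 1 $ i $ a" for i a
    using arg_cong[OF column[of a], of "\<lambda>u. u $ i"] by (simp add: column_def mat_def axis_def)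
  then show ?thesis by (simp add: vec_eq_iff)
qed

lemma M_mem:
  assumes "p \<in> fst ch \<inter> U" "v \<in> \<Omega> p"
  shows "M (snd ch p) *v v ch \<in> B -` \<omega>"
proof -
  have "v \<in> tangent_space A p"
    using \<Omega>[of p] chart_subset[OF ch] assms by auto
  moreover have "\<phi> p v \<in> \<omega>"
    using frame assms unfolding local_model_def by blast
  ultimately show ?thesis
    using assms ch by (simp add: M_eq inv_B tangent_space_eq_tvec_of)
qed

text \<open>\<open>local_model\<close> relates the two functions only on vectors of the cone at
  \<open>p\<close>. That the vector lies there follows from its frame components, since \<phi> is
  injective and maps the cone onto \<omega>.\<close>

lemma coord_fun_eq:
  assumes x: "x \<in> N" and y: "M x *v y \<in> B -` \<omega>"
  shows "coord_fun A ch \<L> x y = frame_fun bas L (M x *v y)"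
proof -
  obtain p where p: "p \<in> fst ch \<inter> U" and xp: "x = snd ch p" using x by blast
  let ?v = "tvec_of A ch p y"
  have v: "?v \<in> tangent_space A p" using p ch by (simp add: tvec_of_in_tangent_space)
  have B: "B (M x *v y) = \<phi> p ?v" using p by (simp add: xp M_eq inv_B)
  have "\<phi> p ` \<Omega> p = \<omega>" using frame p unfolding local_model_def by blast
  then obtain w where w: "w \<in> \<Omega> p" "\<phi> p w = \<phi> p ?v"
    using y B by (metis imageE vimageD)
  have "w \<in> tangent_space A p" using \<Omega>[of p] chart_subset[OF ch] p w by auto
  then have "w = ?v"
    using bij_\<phi>[of p] p v w(2) by (auto simp: bij_betw_def inj_on_def)
  then have "?v \<in> closure (\<Omega> p)" using w closure_subset by blast
  then have "L (\<phi> p ?v) = \<L> p ?v" using frame p unfolding local_model_def by blast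
  then show ?thesis
    using p ch B by (simp add: coord_fun_def frame_fun_eq xp chart_inv)
qed

lemma moving_frame:
  assumes "pseudo_minkowski \<omega> L" "p \<in> fst ch \<inter> U"
  shows "moving_frame (frame_fun bas L) (B -` \<omega>) M (vierbein A \<phi> bas ch) (coord_fun A ch \<L>) N (snd ch p)"
proof (intro moving_frame.intro fibre_frame_fun moving_frame_axioms.intro)
  show "snd ch p \<in> N" using assms(2) by blast
qed (use assms(1) basis open_N C1_M M_vierbein coord_fun_eq in auto)

end

section \<open>The Landsberg tensor\<close>

lemma (in moving_frame) landsberg_frame_eq_coord:
  "(\<Sum>\<alpha>\<in>UNIV. \<Sum>\<beta>\<in>UNIV. \<Sum>\<gamma>\<in>UNIV.
      landsberg_coord f F (E x0) x0 w \<alpha> \<beta> \<gamma> * E x0 $ \<alpha> $ a * E x0 $ \<beta> $ b * E x0 $ \<gamma> $ c)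
    = landsberg_frame f F (E x0) x0 w a b c"
proof -
  let ?L = "landsberg_frame f F (E x0) x0 w"
  have contract: "(\<Sum>\<gamma>\<in>UNIV. (\<Sum>k\<in>UNIV. u k * M x0 $ k $ \<gamma>) * E x0 $ \<gamma> $ l) = u l" for u l
  proof -
    have "(\<Sum>\<gamma>\<in>UNIV. (\<Sum>k\<in>UNIV. u k * M x0 $ k $ \<gamma>) * E x0 $ \<gamma> $ l)
        = (\<Sum>k\<in>UNIV. u k * (\<Sum>\<gamma>\<in>UNIV. M x0 $ k $ \<gamma> * E x0 $ \<gamma> $ l))"
      unfolding sum_distrib_left sum_distrib_right by (subst sum.swap) (simp add: mult_ac)
    then show ?thesis by (simp add: ME_sum[OF x0])
  qed
  \<comment> \<open>Nested so that the sums over \<gamma>, \<beta> and \<alpha> can be contracted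
    with the vierbein one after the other, from the outside inwards.\<close>
  have coord: "landsberg_coord f F (E x0) x0 w \<alpha> \<beta> \<gamma> = (\<Sum>k\<in>UNIV. (\<Sum>j\<in>UNIV. (\<Sum>i\<in>UNIV. ?L i j k * M x0 $ i $ \<alpha>)
      * M x0 $ j $ \<beta>) * M x0 $ k $ \<gamma>)" for \<alpha> \<beta> \<gamma>
    unfolding landsberg_coord_def matrix_inv_E[OF x0]
    by (subst sum_rotate, subst sum_rotate, simp add: sum_distrib_right,
        rule sum.cong[OF refl], rule sum.swap)
  have "(\<Sum>\<gamma>\<in>UNIV. landsberg_coord f F (E x0) x0 w \<alpha> \<beta> \<gamma> * E x0 $ \<gamma> $ c)
      = (\<Sum>j\<in>UNIV. (\<Sum>i\<in>UNIV. ?L i j c * M x0 $ i $ \<alpha>) * M x0 $ j $ \<beta>)" for \<alpha> \<beta>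
    unfolding coord by (rule contract)
  then have "(\<Sum>\<beta>\<in>UNIV. (\<Sum>\<gamma>\<in>UNIV. landsberg_coord f F (E x0) x0 w \<alpha> \<beta> \<gamma> * E x0 $ \<gamma> $ c) * E x0 $ \<beta> $ b)
      = (\<Sum>i\<in>UNIV. ?L i b c * M x0 $ i $ \<alpha>)" for \<alpha>
    by (simp only: contract)
  then have "(\<Sum>\<alpha>\<in>UNIV. (\<Sum>\<beta>\<in>UNIV. (\<Sum>\<gamma>\<in>UNIV. landsberg_coord f F (E x0) x0 w \<alpha> \<beta> \<gamma> * E x0 $ \<gamma> $ c)
      * E x0 $ \<beta> $ b) * E x0 $ \<alpha> $ a) = ?L a b c"
    by (simp only: contract)
  then show ?thesis by (simp add: sum_distrib_left sum_distrib_right mult_ac)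
qed

context moving_frame
begin

text \<open>The factor \<open>1/4\<close> is the \<open>1/2\<close> in the definition of the
  Landsberg tensor times the \<open>1/2\<close> in front of \<open>H\<close> in the spray.\<close>

lemma landsberg_frame_eq:
  assumes y: "y \<in> S" and d: "\<And>r j k. pd j (pd k (H r)) differentiable (at y)"
  shows "landsberg_frame f F (E x0) x0 (E x0 *v y) a b c
    = - 1/4 * (\<Sum>r\<in>UNIV. pd r f y * pd a (pd b (pd c (H r))) y)"
  unfolding landsberg_frame_def berwald_frame_eq[OF y d] matrix_inv_E[OF x0] ME_vec
  by (simp add: sum_divide_distrib[symmetric])

lemma landsberg_frame_contract:
  assumes y: "y \<in> S" and d: "\<And>r j k. pd j (pd k (H r)) differentiable (at y)"
  shows "landsberg_frame f F (E x0) x0 (E x0 *v y) a b c = - 1/2 * contract cc (\<lambda>e m n.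
     y $ m * cartan f y e b c * kron n a + y $ m * cartan f y e c a * kron n b + y $ m * cartan f y e a b * kron n c
     + cartan_up f y m b c * g e a y * y $ n + cartan_up f y m c a * g e b y * y $ n + cartan_up f y m a b * g e c y * y $ n
     + cartan_up f y m b c * pd e f y * kron n a + cartan_up f y m c a * pd e f y * kron n b
     + cartan_up f y m a b * pd e f y * kron n c
     + 2 * vcartan_deriv_up y a b c m * pd e f y * y $ n)"
  unfolding landsberg_frame_eq[OF y d]
  by (rule third_derivative_contract[OF commutation_antisym H_def y d])

text \<open>Here the derivatives are taken inside the sum over \<open>e\<close>, \<open>m\<close>,
  \<open>n\<close>, so each product has to be three times differentiable, not merely their
  combination \<open>H\<close>.\<close>

lemma landsberg_frame_third:
  assumes y: "y \<in> S" and d: "\<And>r m e n. has_third_derivatives (\<lambda>z. gi r m z * pd e f z * z $ n) y"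
  shows "landsberg_frame f F (E x0) x0 (E x0 *v y) a b c
    = - 1/4 * (\<Sum>e\<in>UNIV. \<Sum>m\<in>UNIV. \<Sum>n\<in>UNIV. \<Sum>r\<in>UNIV. cc e m n * pd r f y *
        pd a (pd b (pd c (\<lambda>z. gi r m z * pd e f z * z $ n))) y)"
proof -
  let ?P = "\<lambda>r e m n. pd a (pd b (pd c (\<lambda>z. gi r m z * pd e f z * z $ n))) y"
  have "(\<Sum>r\<in>UNIV. pd r f y * pd a (pd b (pd c (H r))) y)
      = (\<Sum>r\<in>UNIV. \<Sum>e\<in>UNIV. \<Sum>m\<in>UNIV. \<Sum>n\<in>UNIV. cc e m n * pd r f y * ?P r e m n)"
    unfolding third_derivatives_H(2)[OF y d] contract_def by (simp add: sum_distrib_left mult_ac)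
  also have "\<dots> = (\<Sum>e\<in>UNIV. \<Sum>m\<in>UNIV. \<Sum>n\<in>UNIV. \<Sum>r\<in>UNIV. cc e m n * pd r f y * ?P r e m n)"
    by (subst sum.swap, rule sum.cong[OF refl], rule sum_rotate)
  finally show ?thesis
    unfolding landsberg_frame_eq[OF y third_derivatives_H(1)[OF y d]] by simp
qed

end

text \<open>The two regularity conditions belong to different expressions: the condition on the
  spray gives meaning to the Berwald curvature, that on the single products to the third derivatives
  in \<open>Third\<close>. The last three expressions contain at most fourth derivatives of
  \<open>L\<close>, so their equality is asserted without either condition.\<close>

theorem mainTheorem6:
  fixes X :: "'m topology" and A :: "('m, 'n::finite) chart set"
    and \<Omega> :: "'m \<Rightarrow> ('m, 'n) tvec set" and \<L> :: "'m \<Rightarrow> ('m, 'n) tvec \<Rightarrow> real"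
    and \<omega> :: "'v::euclidean_space set" and L :: "'v \<Rightarrow> real" and bas :: "'n \<Rightarrow> 'v"
    and U :: "'m set" and \<phi> :: "'m \<Rightarrow> ('m, 'n) tvec \<Rightarrow> 'v"
    and ch :: "('m, 'n) chart" and p :: 'm and Y :: "('m, 'n) tvec" and a b c :: 'n
  assumes minkowski: "pseudo_minkowski \<omega> L"
    and finsler: "pseudo_finsler X A \<Omega> \<L>"
    and modeled: "modeled_on X A \<Omega> \<L> \<omega> L"
    and frame: "local_model X A \<Omega> \<L> \<omega> L U \<phi>"
    and basis: "vector_basis bas"
    and chart: "ch \<in> A" and point: "p \<in> U \<inter> fst ch" and vector: "Y \<in> \<Omega> p"
  shows
    "let x = snd ch p; \<eta> = Y ch;
         E = vierbein A \<phi> bas ch x; y = matrix_inv E *v \<eta>;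
         F = coord_fun A ch \<L>; f = frame_fun bas L;
         cc = commutation (vierbein A \<phi> bas ch) x;
         g = fmetric f y; k = kcoef g cc; yl = (\<lambda>e. pd e f y);
         C = cartan f y; Cu = cartan_up f y; C4u = cartan4_up f y;
         h = hproj f y; hu = hproj_up f y;
         Landsberg = landsberg_frame f F E x \<eta> a b c;
         Third = - 1/4 * (\<Sum>e\<in>UNIV. \<Sum>m\<in>UNIV. \<Sum>n\<in>UNIV. \<Sum>r\<in>UNIV. cc e m n * yl r *
            pd a (pd b (pd c (\<lambda>z. metric_inv f z $ r $ m * pd e f z * z $ n))) y);
         Line2 = - 1/2 * (\<Sum>e\<in>UNIV. \<Sum>m\<in>UNIV. \<Sum>n\<in>UNIV. cc e m n *
            (y $ m * C e b c * kron n a + y $ m * C e c a * kron n b + y $ m * C e a b * kron n c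
           + Cu m b c * g $ e $ a * y $ n + Cu m c a * g $ e $ b * y $ n + Cu m a b * g $ e $ c * y $ n
           + Cu m b c * yl e * kron n a + Cu m c a * yl e * kron n b + Cu m a b * yl e * kron n c
           + 2 * (C4u m a b c - (\<Sum>s\<in>UNIV. Cu m s a * Cu s b c) - (\<Sum>s\<in>UNIV. Cu m s c * Cu s a b)
                  - (\<Sum>s\<in>UNIV. Cu m s b * Cu s c a)) * yl e * y $ n));
         Line3 =
            (\<Sum>m\<in>UNIV. \<Sum>n\<in>UNIV. \<Sum>e\<in>UNIV. k m n e * y $ e *
              (Cu m b c * kron n a + Cu m c a * kron n b + Cu m a b * kron n c))
          + (\<Sum>m\<in>UNIV. \<Sum>n\<in>UNIV. \<Sum>e\<in>UNIV. k m n e * y $ n * y $ e *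
              (C4u m a b c - (\<Sum>s\<in>UNIV. Cu s b c * Cu m a s) - (\<Sum>s\<in>UNIV. Cu s c a * Cu m b s)
                - (\<Sum>s\<in>UNIV. Cu s a b * Cu m c s)));
         Line4 = (\<Sum>m\<in>UNIV. \<Sum>n\<in>UNIV. \<Sum>e\<in>UNIV. k m n e * y $ e *
            (antisymm (\<lambda>i j. Cu i b c * h j a) m n + antisymm (\<lambda>i j. Cu i c a * h j b) m n
           + antisymm (\<lambda>i j. Cu i a b * h j c) m n
           + (\<Sum>s\<in>UNIV. \<Sum>t\<in>UNIV. \<Sum>q\<in>UNIV. \<Sum>r\<in>UNIV. antisymm (\<lambda>i j. y $ i * hu j s) n m *
                h t a * h q b * h r c * vcartan_deriv f y s t q r)))
     in Landsberg = (\<Sum>\<alpha>\<in>UNIV. \<Sum>\<beta>\<in>UNIV. \<Sum>\<gamma>\<in>UNIV.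
            landsberg_coord f F E x \<eta> \<alpha> \<beta> \<gamma> * E $ \<alpha> $ a * E $ \<beta> $ b * E $ \<gamma> $ c) \<and>
        Landsberg = - 1/2 * (\<Sum>r\<in>UNIV. yl r * berwald_frame F E x \<eta> r a b c) \<and>
        ((\<forall>\<rho>. has_third_derivatives (spray F x \<rho>) \<eta>) \<longrightarrow> Landsberg = Line2) \<and>
        ((\<forall>r m e n. has_third_derivatives (\<lambda>z. metric_inv f z $ r $ m * pd e f z * z $ n) y) \<longrightarrow>
            Landsberg = Third \<and> Third = Line2) \<and>
        Line2 = Line3 \<and> Line3 = Line4"
proof -
  let ?x = "snd ch p" and ?f = "frame_fun bas L" and ?F = "coord_fun A ch \<L>"
  let ?V = "vierbein A \<phi> bas ch"
  have p: "p \<in> fst ch \<inter> U" using point by blast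
  interpret model: modeled_frame X A \<Omega> \<L> \<omega> L bas U \<phi> ch
    using finsler frame basis chart by unfold_locales (auto simp: pseudo_finsler_def)
  interpret mf: moving_frame ?f "frame_vector bas -` \<omega>" "frame_matrix A \<phi> bas ch" ?V ?F
    "snd ch ` (fst ch \<inter> U)" ?x
    by (rule model.moving_frame[OF minkowski p])
  define y where "y = matrix_inv (?V ?x) *v Y ch"
  define cc where "cc = commutation ?V ?x"
  have y_eq: "y = frame_matrix A \<phi> bas ch ?x *v Y ch"
    unfolding y_def mf.matrix_inv_E[OF mf.x0] ..
  have y: "y \<in> frame_vector bas -` \<omega>"
    unfolding y_eq by (rule model.M_mem[OF p vector])
  have Ey: "Y ch = ?V ?x *v y"
    unfolding y_eq mf.EM_vec ..
  have anti: "cc e m n = - cc e n m" for e m n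
    unfolding cc_def by (rule mf.commutation_antisym)

  \<comment> \<open>The three algebraic expressions are first named in the form in which the lemmas
    on a fibre deliver them; the equations below identify them with the written-out sums.\<close>
  define line2 where "line2 = - 1/2 * contract cc (\<lambda>e m n.
     y $ m * cartan ?f y e b c * kron n a + y $ m * cartan ?f y e c a * kron n b + y $ m * cartan ?f y e a b * kron n c
     + cartan_up ?f y m b c * pd e (pd a ?f) y * y $ n + cartan_up ?f y m c a * pd e (pd b ?f) y * y $ n
     + cartan_up ?f y m a b * pd e (pd c ?f) y * y $ n
     + cartan_up ?f y m b c * pd e ?f y * kron n a + cartan_up ?f y m c a * pd e ?f y * kron n b
     + cartan_up ?f y m a b * pd e ?f y * kron n c
     + 2 * mf.vcartan_deriv_up y a b c m * pd e ?f y * y $ n)"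
  let ?k = "kcoef (fmetric ?f y) cc"
  define line3 where "line3 = kcontract ?k y (\<lambda>m n. cartan_up ?f y m b c * kron n a
      + cartan_up ?f y m c a * kron n b + cartan_up ?f y m a b * kron n c)
     + kcontract ?k y (\<lambda>m n. mf.vcartan_deriv_up y a b c m * y $ n)"
  define line4 where "line4 = kcontract ?k y (\<lambda>m n.
       antisymm (\<lambda>i j. cartan_up ?f y i b c * hproj ?f y j a) m n
     + antisymm (\<lambda>i j. cartan_up ?f y i c a * hproj ?f y j b) m n
     + antisymm (\<lambda>i j. cartan_up ?f y i a b * hproj ?f y j c) m n
     + (\<Sum>s\<in>UNIV. \<Sum>t\<in>UNIV. \<Sum>q\<in>UNIV. \<Sum>r\<in>UNIV. antisymm (\<lambda>i j. y $ i * hproj_up ?f y j s) n m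
        * hproj ?f y t a * hproj ?f y q b * hproj ?f y r c * vcartan_deriv ?f y s t q r))"
  let ?landsberg = "landsberg_frame ?f ?F (?V ?x) ?x (Y ch) a b c"
  let ?third = "- 1/4 * (\<Sum>e\<in>UNIV. \<Sum>m\<in>UNIV. \<Sum>n\<in>UNIV. \<Sum>r\<in>UNIV. cc e m n * pd r ?f y *
            pd a (pd b (pd c (\<lambda>z. metric_inv ?f z $ r $ m * pd e ?f z * z $ n))) y)"

  have line2: "- 1/2 * (\<Sum>e\<in>UNIV. \<Sum>m\<in>UNIV. \<Sum>n\<in>UNIV. cc e m n *
      (y $ m * cartan ?f y e b c * kron n a + y $ m * cartan ?f y e c a * kron n b + y $ m * cartan ?f y e a b * kron n c
     + cartan_up ?f y m b c * fmetric ?f y $ e $ a * y $ n + cartan_up ?f y m c a * fmetric ?f y $ e $ b * y $ n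
     + cartan_up ?f y m a b * fmetric ?f y $ e $ c * y $ n
     + cartan_up ?f y m b c * pd e ?f y * kron n a + cartan_up ?f y m c a * pd e ?f y * kron n b
     + cartan_up ?f y m a b * pd e ?f y * kron n c
     + 2 * (cartan4_up ?f y m a b c - (\<Sum>s\<in>UNIV. cartan_up ?f y m s a * cartan_up ?f y s b c)
            - (\<Sum>s\<in>UNIV. cartan_up ?f y m s c * cartan_up ?f y s a b)
            - (\<Sum>s\<in>UNIV. cartan_up ?f y m s b * cartan_up ?f y s c a)) * pd e ?f y * y $ n)) = line2"
    unfolding line2_def contract_def mf.vcartan_deriv_up_def fmetric_def vec_lambda_beta ..
  have line3: "(\<Sum>m\<in>UNIV. \<Sum>n\<in>UNIV. \<Sum>e\<in>UNIV. ?k m n e * y $ e *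
        (cartan_up ?f y m b c * kron n a + cartan_up ?f y m c a * kron n b + cartan_up ?f y m a b * kron n c))
    + (\<Sum>m\<in>UNIV. \<Sum>n\<in>UNIV. \<Sum>e\<in>UNIV. ?k m n e * y $ n * y $ e *
        (cartan4_up ?f y m a b c - (\<Sum>s\<in>UNIV. cartan_up ?f y s b c * cartan_up ?f y m a s)
          - (\<Sum>s\<in>UNIV. cartan_up ?f y s c a * cartan_up ?f y m b s)
          - (\<Sum>s\<in>UNIV. cartan_up ?f y s a b * cartan_up ?f y m c s))) = line3"
  proof -
    \<comment> \<open>The two expressions differ in the order of the lower indices and of the
      factors; the symmetry of the raised Cartan tensor reconciles them.\<close>
    have "cartan4_up ?f y m a b c - (\<Sum>s\<in>UNIV. cartan_up ?f y s b c * cartan_up ?f y m a s)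
          - (\<Sum>s\<in>UNIV. cartan_up ?f y s c a * cartan_up ?f y m b s)
          - (\<Sum>s\<in>UNIV. cartan_up ?f y s a b * cartan_up ?f y m c s) = mf.vcartan_deriv_up y a b c m" for m
      unfolding mf.vcartan_deriv_up_def
      by (simp add: mf.cartan_up_commute[OF y, of m a] mf.cartan_up_commute[OF y, of m b]
          mf.cartan_up_commute[OF y, of m c] mult.commute)
    then show ?thesis unfolding line3_def kcontract_def by (simp add: mult_ac)
  qed
  have line4: "(\<Sum>m\<in>UNIV. \<Sum>n\<in>UNIV. \<Sum>e\<in>UNIV. ?k m n e * y $ e *
      (antisymm (\<lambda>i j. cartan_up ?f y i b c * hproj ?f y j a) m n
     + antisymm (\<lambda>i j. cartan_up ?f y i c a * hproj ?f y j b) m n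
     + antisymm (\<lambda>i j. cartan_up ?f y i a b * hproj ?f y j c) m n
     + (\<Sum>s\<in>UNIV. \<Sum>t\<in>UNIV. \<Sum>q\<in>UNIV. \<Sum>r\<in>UNIV. antisymm (\<lambda>i j. y $ i * hproj_up ?f y j s) n m
        * hproj ?f y t a * hproj ?f y q b * hproj ?f y r c * vcartan_deriv ?f y s t q r))) = line4"
    unfolding line4_def kcontract_def ..

  have "?landsberg = (\<Sum>\<alpha>\<in>UNIV. \<Sum>\<beta>\<in>UNIV. \<Sum>\<gamma>\<in>UNIV.
      landsberg_coord ?f ?F (?V ?x) ?x (Y ch) \<alpha> \<beta> \<gamma> * ?V ?x $ \<alpha> $ a * ?V ?x $ \<beta> $ b * ?V ?x $ \<gamma> $ c)"
    by (rule mf.landsberg_frame_eq_coord[symmetric])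
  moreover have "?landsberg = - 1/2 * (\<Sum>r\<in>UNIV. pd r ?f y * berwald_frame ?F (?V ?x) ?x (Y ch) r a b c)"
    unfolding landsberg_frame_def y_def ..
  \<comment> \<open>The assumption concerns the chart components \<open>Y ch\<close>; by
    \<open>Ey\<close> these are the image of \<open>y\<close> under the vierbein, as required for
    the transfer to \<open>H\<close>.\<close>
  moreover have "?landsberg = line2" if "\<forall>\<rho>. has_third_derivatives (spray ?F ?x \<rho>) (Y ch)"
    using that unfolding Ey line2_def cc_def
    by (intro mf.landsberg_frame_contract y mf.third_derivatives_H_of_spray) auto
  moreover have "?landsberg = ?third \<and> ?third = line2"
    if "\<forall>r m e n. has_third_derivatives (\<lambda>z. metric_inv ?f z $ r $ m * pd e ?f z * z $ n) y"
  proof -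
    have d: "has_third_derivatives (\<lambda>z. metric_inv ?f z $ r $ m * pd e ?f z * z $ n) y" for r m e n
      using that by blast
    have "?landsberg = ?third"
      unfolding Ey cc_def by (rule mf.landsberg_frame_third[OF y d])
    moreover have "?landsberg = line2"
      unfolding Ey line2_def cc_def
      by (rule mf.landsberg_frame_contract[OF y mf.third_derivatives_H(1)[OF y d]])
    ultimately show ?thesis by simp
  qed
  moreover have "line2 = line3"
    unfolding line2_def line3_def by (rule mf.contract_eq_kcontract[OF anti y])
  moreover have "line3 = line4"
    unfolding line3_def line4_def by (rule mf.kcontract_hproj[OF anti y])
  ultimately show ?thesis
    unfolding Let_def y_def[symmetric] cc_def[symmetric] line2 line3 line4 by blast
qed

end
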